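(* Let $H=\mathcal{A}+V$ be the Schrödinger operator on the tree $\mathcal{T}$. Suppose $H$ has purely absolutely continuous spectrum in some measurable set $I\subseteq\mathbb{R}$, and let $\nu_E$ ($E\in\mathfrak{S}$) be the measures on $\partial\mathcal{T}$ described in the context (the functions $P_{E,\xi}$, $\Psi_{E,v}$ and the measure $\nu_E$ are defined for all $E\in\mathfrak{S}$, hence for Lebesgue-a.e. $E$). (i) For any bounded Borel $F:I\to\mathbb{C}$ and any $v,w\in\mathcal{T}$, $$F(H)(v,w)=\int_I F(E)\,\Psi_{E,v}(w)\,\mathrm{d}E=\int_I\int_{\partial\mathcal{T}}F(E)\,P_{E,\xi}(v)\,\overline{P_{E,\xi}(w)}\,\mathrm{d}\nu_E(\xi)\,\mathrm{d}E .$$ (ii) For any $f:\mathcal{T}\to\mathbb{C}$ with finite support, any bounded Borel $F:I\to\mathbb{C}$ and any $v\in\mathcal{T}$, $$[F(H)f](v)=\int_I F(E)\,\langle\overline{f},\Psi_{E,v}\rangle\,\mathrm{d}E=\int_I\int_{\partial\mathcal{T}}F(E)\,P_{E,\xi}(v)\,\langle P_{E,\xi},f\rangle\,\mathrm{d}\nu_E(\xi)\,\mathrm{d}E .$$ (iii) For any $K:\mathcal{T}\times\mathcal{T}\to\mathbb{C}$ with finite support and any bounded Borel $F:I\to\mathbb{C}$, $$\operatorname{tr}[F(H)K]=\int_I\int_{\partial\mathcal{T}}F(E)\,\langle P_{E,\xi},KP_{E,\xi}\rangle\,\mathrm{d}\nu_E(\xi)\,\mathrm{d}E .$$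
   Context: Setting. $\mathcal{T}$ is a tree with uniformly bounded degree; its vertex set is also denoted $\mathcal{T}$, $w\sim v$ means that $v,w$ are nearest neighbors, $d$ is the graph distance. $V:\mathcal{T}\to\mathbb{R}$ is an arbitrary real potential and $H=\mathcal{A}+V$, i.e. $(H\psi)(v)=\sum_{w\sim v}\psi(w)+V(v)\psi(v)$, self-adjoint on $D(H)=\{\psi\in\ell^2(\mathcal{T}):V\psi\in\ell^2(\mathcal{T})\}$. The scalar product $\langle f,g\rangle=\sum_{v}\overline{f(v)}g(v)$ is conjugate-linear in the first entry; the notation is also used for arbitrary functions on $\mathcal{T}$ when one of them has finite support. For a bounded Borel function $F$ on $I$, $F(H)$ is given by the functional calculus with $F$ extended by $0$ outside $I$, and $F(H)(v,w)=\langle\delta_v,F(H)\delta_w\rangle$. "Purely absolutely continuous spectrum in $I$" means: for all $\phi\in\ell^2(\mathcal{T})$ the spectral measure $J\mapsto\langle\phi,\chi_J(H)\phi\rangle$, restricted to $I$, is absolutely continuous with respect to Lebesgue measure. A kernel $K$ on $\mathcal{T}\times\mathcal{T}$ with finite support acts by $(Kf)(v)=\sum_w K(v,w)f(w)$. Green functions. $\mathbb{C}^+=\{z\in\mathbb{C}:\operatorname{Im}z>0\}$. For $v\sim w$, $\mathcal{T}^{(v|w)}$ is the tree obtained from $\mathcal{T}$ by removing the branch emanating from $v$ that passes through $w$ (the vertex $v$ is kept), and $H^{(v|w)}$ is the restriction of $H$ to it: $H^{(v|w)}(u,u')=H(u,u')$ if $u,u'\in\mathcal{T}^{(v|w)}$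 and $0$ otherwise. For $\gamma\in\mathbb{C}\setminus\mathbb{R}$, $G(u,u';\gamma)=\langle\delta_u,(H-\gamma)^{-1}\delta_{u'}\rangle$, $G^{(v|w)}(u,u';\gamma)=\langle\delta_u,(H^{(v|w)}-\gamma)^{-1}\delta_{u'}\rangle$, and $\zeta_w^\gamma(v)=-G^{(v|w)}(v,v;\gamma)$. Let $\mathfrak{A}\subset\mathbb{R}$ be a Lebesgue-null set such that for all $E\in\mathfrak{S}:=\mathbb{R}\setminus\mathfrak{A}$, all $v\in\mathcal{T}$ and $w\sim v$, the limits $G(v,v;E+i0)=\lim_{\eta\downarrow0}G(v,v;E+i\eta)$ and $\zeta_w^{E+i0}(v)=\lim_{\eta\downarrow0}\zeta_w^{E+i\eta}(v)$ exist, are finite and non-zero (such a set exists; for $E\in\mathfrak{S}$ the limits $G(v,w;E+i0)=\lim_{\eta\downarrow0}G(v,w;E+i\eta)$ then exist for all $v,w$). Boundary. An arc is a finite non-backtracking path; $[v,w]$ is the unique arc from $v$ to $w$. A chain is an infinite non-backtracking path; chains $(u_0,u_1,\dots)$ and $(v_0,v_1,\dots)$ are equivalent if $u_k=v_{k+n}$ for some $n\in\mathbb{Z}$ and all $k$. The geometric boundary $\partial\mathcal{T}$ is the set of equivalence classes of chains; each class $\xi$ has a representative $[v,\xi]$ starting at any given $v\in\mathcal{T}$. Fix an origin $o\in\mathcal{T}$, put $|v|=d(v,o)$ and $\mathcal{N}_u^+=\{w\sim u:|w|=|u|+1\}$. For $w\ne o$, $\partial\mathcal{T}_w=\{\xi\in\partial\mathcal{T}:[o,w]\text{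 is a subchain of }[o,\xi]\}$. For $v\in\mathcal{T}$, $\xi\in\partial\mathcal{T}$, $v\wedge\xi$ is the vertex of maximal length $|\cdot|$ in $[o,v]\cap[o,\xi]$. Poisson kernel and generalized eigenfunctions. For $\gamma\in\mathbb{C}^+$, $P_{\gamma,\xi}(v)=\dfrac{G(v\wedge\xi,v;\gamma)}{G(o,v\wedge\xi;\gamma)}$ and $\Psi_{\gamma,v}(w)=\frac1\pi\operatorname{Im}G(v,w;\gamma)$. For $E\in\mathfrak{S}$, $P_{E,\xi}(v)=\lim_{\eta\downarrow0}P_{E+i\eta,\xi}(v)$ and $\Psi_{E,v}(w)=\lim_{\eta\downarrow0}\Psi_{E+i\eta,v}(w)$; these limits exist. Measure. For $E\in\mathfrak{S}$, $\nu_E$ is the (non-negative, countably additive) measure on the $\sigma$-algebra generated by the sets $\partial\mathcal{T}_v$, $v\in\mathcal{T}\setminus\{o\}$, determined by $\nu_E(\partial\mathcal{T})=\Psi_{E,o}(o)$ and, for $u\in\mathcal{T}$, $u_+\in\mathcal{N}_u^+$, $$\nu_E(\partial\mathcal{T}_{u_+})=\frac1\pi\,|G(o,u;E+i0)|^2\,|\operatorname{Im}\zeta_u^{E+i0}(u_+)| .$$ *)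

theory Defs
  imports "HOL-Analysis.Analysis"
begin

text \<open>Graphs are given by their adjacency relation; the vertex set is the whole type.\<close>

definition is_cycle :: "('v \<Rightarrow> 'v \<Rightarrow> bool) \<Rightarrow> 'v list \<Rightarrow> bool" where
  "is_cycle adj p \<longleftrightarrow>
     length p \<ge> 3 \<and> distinct p \<and> successively adj p \<and> adj (last p) (hd p)"

definition is_tree :: "('v \<Rightarrow> 'v \<Rightarrow> bool) \<Rightarrow> bool" where
  "is_tree adj \<longleftrightarrow> symp adj \<and> irreflp adj \<and> (\<forall>v w. adj\<^sup>*\<^sup>* v w) \<and> (\<nexists>p. is_cycle adj p)"

definition bounded_degree :: "('v \<Rightarrow> 'v \<Rightarrow> bool) \<Rightarrow> bool" where
  "bounded_degree adj \<longleftrightarrow> (\<exists>D. \<forall>v. finite {w. adj v w} \<and> card {w. adj v w} \<le> D)"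

definition gdist :: "('v \<Rightarrow> 'v \<Rightarrow> bool) \<Rightarrow> 'v \<Rightarrow> 'v \<Rightarrow> nat" where
  "gdist adj v w = (LEAST n. (adj ^^ n) v w)"

definition is_arc :: "('v \<Rightarrow> 'v \<Rightarrow> bool) \<Rightarrow> 'v list \<Rightarrow> bool" where
  "is_arc adj p \<longleftrightarrow> p \<noteq> [] \<and> successively adj p \<and> (\<forall>k. k + 2 < length p \<longrightarrow> p ! k \<noteq> p ! (k + 2))"

definition arc_between :: "('v \<Rightarrow> 'v \<Rightarrow> bool) \<Rightarrow> 'v \<Rightarrow> 'v \<Rightarrow> 'v list" where
  "arc_between adj v w = (THE p. is_arc adj p \<and> hd p = v \<and> last p = w)"

definition is_chain :: "('v \<Rightarrow> 'v \<Rightarrow> bool) \<Rightarrow> (nat \<Rightarrow> 'v) \<Rightarrow> bool" where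
  "is_chain adj c \<longleftrightarrow> (\<forall>k. adj (c k) (c (k + 1)) \<and> c k \<noteq> c (k + 2))"

text \<open>Chains are equivalent if, up to an index shift in the integers, they agree for all
  sufficiently large indices, i.e. if they have a common tail.\<close>

definition chain_equiv :: "('v \<Rightarrow> 'v \<Rightarrow> bool) \<Rightarrow> ((nat \<Rightarrow> 'v) \<times> (nat \<Rightarrow> 'v)) set" where
  "chain_equiv adj =
     {(c, c'). is_chain adj c \<and> is_chain adj c' \<and> (\<exists>m n. \<forall>k. c (k + m) = c' (k + n))}"

definition tree_boundary :: "('v \<Rightarrow> 'v \<Rightarrow> bool) \<Rightarrow> (nat \<Rightarrow> 'v) set set" where
  "tree_boundary adj = {c. is_chain adj c} // chain_equiv adj"

text \<open>The representative \<open>[v, \<xi>]\<close> of a boundary point.\<close>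

definition ray :: "'v \<Rightarrow> (nat \<Rightarrow> 'v) set \<Rightarrow> nat \<Rightarrow> 'v" where
  "ray v \<xi> = (THE c. c \<in> \<xi> \<and> c 0 = v)"

definition boundary_beyond :: "('v \<Rightarrow> 'v \<Rightarrow> bool) \<Rightarrow> 'v \<Rightarrow> 'v \<Rightarrow> (nat \<Rightarrow> 'v) set set" where
  "boundary_beyond adj orig w =
     {\<xi> \<in> tree_boundary adj.
        \<exists>n. map (ray orig \<xi>) [n..<n + length (arc_between adj orig w)] = arc_between adj orig w}"

text \<open>The confluent \<open>v \<and> \<xi>\<close>.\<close>

definition confluent :: "('v \<Rightarrow> 'v \<Rightarrow> bool) \<Rightarrow> 'v \<Rightarrow> 'v \<Rightarrow> (nat \<Rightarrow> 'v) set \<Rightarrow> 'v" where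
  "confluent adj orig v \<xi> =
     (ARG_MAX (gdist adj orig) u. u \<in> set (arc_between adj orig v) \<inter> range (ray orig \<xi>))"

definition forward_nbrs :: "('v \<Rightarrow> 'v \<Rightarrow> bool) \<Rightarrow> 'v \<Rightarrow> 'v \<Rightarrow> 'v set" where
  "forward_nbrs adj orig u = {w. adj u w \<and> gdist adj orig w = gdist adj orig u + 1}"

text \<open>For adjacent \<open>v\<close>, \<open>w\<close>: the tree without the branch at \<open>v\<close> through \<open>w\<close>.\<close>

definition truncated :: "('v \<Rightarrow> 'v \<Rightarrow> bool) \<Rightarrow> 'v \<Rightarrow> 'v \<Rightarrow> 'v set" where
  "truncated adj v w = {u. w \<notin> set (arc_between adj v u)}"


definition l2 :: "('v \<Rightarrow> complex) set" where
  "l2 = {\<psi>. (\<lambda>v. (norm (\<psi> v))\<^sup>2) summable_on UNIV}"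

definition l2_norm :: "('v \<Rightarrow> complex) \<Rightarrow> real" where
  "l2_norm \<psi> = sqrt (\<Sum>\<^sub>\<infinity>v. (norm (\<psi> v))\<^sup>2)"

definition l2_inner :: "('v \<Rightarrow> complex) \<Rightarrow> ('v \<Rightarrow> complex) \<Rightarrow> complex" where
  "l2_inner f g = (\<Sum>\<^sub>\<infinity>v. cnj (f v) * g v)"

definition delta :: "'v \<Rightarrow> 'v \<Rightarrow> complex" where
  "delta v = (\<lambda>u. if u = v then 1 else 0)"

text \<open>The operator whose kernel is that of \<open>A + V\<close> on \<open>S \<times> S\<close> and zero elsewhere, acting on
  \<open>\<ell>\<^sup>2\<close> of the full vertex set; \<open>S = UNIV\<close> is the full Schroedinger operator.\<close>

definition schr :: "('v \<Rightarrow> 'v \<Rightarrow> bool) \<Rightarrow> ('v \<Rightarrow> real) \<Rightarrow> 'v set \<Rightarrow> ('v \<Rightarrow> complex) \<Rightarrow> 'v \<Rightarrow> complex" where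
  "schr adj V S \<psi> = (\<lambda>v. if v \<in> S
     then (\<Sum>w | adj v w \<and> w \<in> S. \<psi> w) + of_real (V v) * \<psi> v else 0)"

definition schr_dom :: "('v \<Rightarrow> real) \<Rightarrow> 'v set \<Rightarrow> ('v \<Rightarrow> complex) set" where
  "schr_dom V S = {\<psi> \<in> l2. (\<lambda>v. if v \<in> S then of_real (V v) * \<psi> v else 0) \<in> l2}"

definition schr_resolvent ::
  "('v \<Rightarrow> 'v \<Rightarrow> bool) \<Rightarrow> ('v \<Rightarrow> real) \<Rightarrow> 'v set \<Rightarrow> complex \<Rightarrow> ('v \<Rightarrow> complex) \<Rightarrow> 'v \<Rightarrow> complex" where
  "schr_resolvent adj V S \<gamma> = inv_into (schr_dom V S) (\<lambda>\<psi> v. schr adj V S \<psi> v - \<gamma> * \<psi> v)"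

definition green_on ::
  "('v \<Rightarrow> 'v \<Rightarrow> bool) \<Rightarrow> ('v \<Rightarrow> real) \<Rightarrow> 'v set \<Rightarrow> complex \<Rightarrow> 'v \<Rightarrow> 'v \<Rightarrow> complex" where
  "green_on adj V S \<gamma> u u' = l2_inner (delta u) (schr_resolvent adj V S \<gamma> (delta u'))"

abbreviation green ::
  "('v \<Rightarrow> 'v \<Rightarrow> bool) \<Rightarrow> ('v \<Rightarrow> real) \<Rightarrow> complex \<Rightarrow> 'v \<Rightarrow> 'v \<Rightarrow> complex" where
  "green adj V \<equiv> green_on adj V UNIV"

text \<open>\<open>zeta adj V \<gamma> w v\<close> is \<open>\<zeta>\<^sub>w\<^sup>\<gamma>(v)\<close>, with \<open>w\<close> the removed neighbour of \<open>v\<close>.\<close>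

definition zeta ::
  "('v \<Rightarrow> 'v \<Rightarrow> bool) \<Rightarrow> ('v \<Rightarrow> real) \<Rightarrow> complex \<Rightarrow> 'v \<Rightarrow> 'v \<Rightarrow> complex" where
  "zeta adj V \<gamma> w v = - green_on adj V (truncated adj v w) \<gamma> v v"

definition poisson ::
  "('v \<Rightarrow> 'v \<Rightarrow> bool) \<Rightarrow> ('v \<Rightarrow> real) \<Rightarrow> 'v \<Rightarrow> complex \<Rightarrow> (nat \<Rightarrow> 'v) set \<Rightarrow> 'v \<Rightarrow> complex" where
  "poisson adj V orig \<gamma> \<xi> v =
     green adj V \<gamma> (confluent adj orig v \<xi>) v / green adj V \<gamma> orig (confluent adj orig v \<xi>)"

definition Psi :: "('v \<Rightarrow> 'v \<Rightarrow> bool) \<Rightarrow> ('v \<Rightarrow> real) \<Rightarrow> complex \<Rightarrow> 'v \<Rightarrow> 'v \<Rightarrow> real" where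
  "Psi adj V \<gamma> v w = Im (green adj V \<gamma> v w) / pi"

text \<open>Boundary values at \<open>E + i0\<close>.\<close>

definition bval :: "(complex \<Rightarrow> 'a::t2_space) \<Rightarrow> real \<Rightarrow> 'a" where
  "bval g E = Lim (at_right 0) (\<lambda>\<eta>. g (Complex E \<eta>))"

definition poisson_bv ::
  "('v \<Rightarrow> 'v \<Rightarrow> bool) \<Rightarrow> ('v \<Rightarrow> real) \<Rightarrow> 'v \<Rightarrow> real \<Rightarrow> (nat \<Rightarrow> 'v) set \<Rightarrow> 'v \<Rightarrow> complex" where
  "poisson_bv adj V orig E \<xi> v = bval (\<lambda>\<gamma>. poisson adj V orig \<gamma> \<xi> v) E"

definition Psi_bv :: "('v \<Rightarrow> 'v \<Rightarrow> bool) \<Rightarrow> ('v \<Rightarrow> real) \<Rightarrow> real \<Rightarrow> 'v \<Rightarrow> 'v \<Rightarrow> real" where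
  "Psi_bv adj V E v w = bval (\<lambda>\<gamma>. Psi adj V \<gamma> v w) E"

text \<open>\<open>\<AA>\<close> is an exceptional null set, i.e. its complement may serve as the set of energies at
  which boundary values are taken.\<close>

definition exceptional_set :: "('v \<Rightarrow> 'v \<Rightarrow> bool) \<Rightarrow> ('v \<Rightarrow> real) \<Rightarrow> real set \<Rightarrow> bool" where
  "exceptional_set adj V \<AA> \<longleftrightarrow> \<AA> \<in> null_sets lebesgue \<and>
     (\<forall>E. E \<notin> \<AA> \<longrightarrow>
        (\<forall>v. \<exists>L. L \<noteq> 0 \<and> ((\<lambda>\<eta>. green adj V (Complex E \<eta>) v v) \<longlongrightarrow> L) (at_right 0)) \<and>
        (\<forall>v w. adj v w \<longrightarrow>
           (\<exists>L. L \<noteq> 0 \<and> ((\<lambda>\<eta>. zeta adj V (Complex E \<eta>) w v) \<longlongrightarrow> L) (at_right 0))))"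

text \<open>The properties that determine the measure \<open>\<nu>\<^sub>E\<close>.\<close>

definition is_boundary_measure ::
  "('v \<Rightarrow> 'v \<Rightarrow> bool) \<Rightarrow> ('v \<Rightarrow> real) \<Rightarrow> 'v \<Rightarrow> real \<Rightarrow> (nat \<Rightarrow> 'v) set measure \<Rightarrow> bool" where
  "is_boundary_measure adj V orig E \<nu> \<longleftrightarrow>
     space \<nu> = tree_boundary adj \<and>
     sets \<nu> = sigma_sets (tree_boundary adj) (boundary_beyond adj orig ` (UNIV - {orig})) \<and>
     emeasure \<nu> (tree_boundary adj) = ennreal (Psi_bv adj V E orig orig) \<and>
     (\<forall>u. \<forall>u' \<in> forward_nbrs adj orig u.
        emeasure \<nu> (boundary_beyond adj orig u') =
          ennreal ((norm (bval (\<lambda>\<gamma>. green adj V \<gamma> orig u) E))\<^sup>2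
                     * \<bar>Im (bval (\<lambda>\<gamma>. zeta adj V \<gamma> u u') E)\<bar> / pi))"


definition bounded_borel :: "(real \<Rightarrow> complex) set" where
  "bounded_borel = {F \<in> borel_measurable borel. bounded (range F)}"

text \<open>\<open>\<Phi>\<close> is the Borel functional calculus of the operator \<open>A\<close> with domain \<open>D\<close> in \<open>\<ell>\<^sup>2\<close>, i.e.
  \<open>\<Phi> F\<close> is \<open>F(A)\<close>. These are the properties by which the spectral theorem (Reed and Simon,
  Methods of Modern Mathematical Physics I, Section VIII.3) characterises the functional
  calculus of a self-adjoint operator: a norm-bounded *-homomorphism into the bounded operators
  that is strongly continuous under bounded pointwise convergence, and that reproduces \<open>A\<close>
  through approximations of the identity function. For self-adjoint \<open>A\<close> it exists and is unique.
  Only bounded Borel \<open>F\<close> and vectors in \<open>\<ell>\<^sup>2\<close> are constrained.\<close>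

definition borel_functional_calculus ::
  "('v \<Rightarrow> complex) set \<Rightarrow> (('v \<Rightarrow> complex) \<Rightarrow> 'v \<Rightarrow> complex)
    \<Rightarrow> ((real \<Rightarrow> complex) \<Rightarrow> ('v \<Rightarrow> complex) \<Rightarrow> 'v \<Rightarrow> complex) \<Rightarrow> bool" where
  "borel_functional_calculus D A \<Phi> \<longleftrightarrow>
     (\<forall>F \<in> bounded_borel. \<forall>\<psi> \<in> l2. \<Phi> F \<psi> \<in> l2) \<and>
     (\<forall>F \<in> bounded_borel. \<forall>\<phi> \<in> l2. \<forall>\<psi> \<in> l2. \<forall>a b.
        \<Phi> F (\<lambda>v. a * \<phi> v + b * \<psi> v) = (\<lambda>v. a * \<Phi> F \<phi> v + b * \<Phi> F \<psi> v)) \<and>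
     (\<forall>F \<in> bounded_borel. \<forall>G \<in> bounded_borel. \<forall>\<psi> \<in> l2. \<forall>a b.
        \<Phi> (\<lambda>x. a * F x + b * G x) \<psi> = (\<lambda>v. a * \<Phi> F \<psi> v + b * \<Phi> G \<psi> v)) \<and>
     (\<forall>F \<in> bounded_borel. \<forall>G \<in> bounded_borel. \<forall>\<psi> \<in> l2. \<Phi> (\<lambda>x. F x * G x) \<psi> = \<Phi> F (\<Phi> G \<psi>)) \<and>
     (\<forall>\<psi> \<in> l2. \<Phi> (\<lambda>x. 1) \<psi> = \<psi>) \<and>
     (\<forall>F \<in> bounded_borel. \<forall>\<phi> \<in> l2. \<forall>\<psi> \<in> l2.
        l2_inner \<phi> (\<Phi> F \<psi>) = l2_inner (\<Phi> (\<lambda>x. cnj (F x)) \<phi>) \<psi>) \<and>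
     (\<forall>F \<in> bounded_borel. \<forall>\<psi> \<in> l2. l2_norm (\<Phi> F \<psi>) \<le> (SUP x. norm (F x)) * l2_norm \<psi>) \<and>
     (\<forall>h. (\<forall>n. h n \<in> bounded_borel) \<and> (\<forall>n x. norm (h n x) \<le> \<bar>x\<bar>) \<and>
          (\<forall>x. (\<lambda>n. h n x) \<longlonglongrightarrow> of_real x) \<longrightarrow>
        (\<forall>\<psi> \<in> D. (\<lambda>n. l2_norm (\<lambda>v. \<Phi> (h n) \<psi> v - A \<psi> v)) \<longlonglongrightarrow> 0)) \<and>
     (\<forall>h F. (\<forall>n. h n \<in> bounded_borel) \<and> (\<exists>C. \<forall>n x. norm (h n x) \<le> C) \<and>
          (\<forall>x. (\<lambda>n. h n x) \<longlonglongrightarrow> F x) \<longrightarrow>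
        (\<forall>\<psi> \<in> l2. (\<lambda>n. l2_norm (\<lambda>v. \<Phi> (h n) \<psi> v - \<Phi> F \<psi> v)) \<longlonglongrightarrow> 0))"

definition spectral_measure ::
  "((real \<Rightarrow> complex) \<Rightarrow> ('v \<Rightarrow> complex) \<Rightarrow> 'v \<Rightarrow> complex) \<Rightarrow> ('v \<Rightarrow> complex) \<Rightarrow> real measure" where
  "spectral_measure \<Phi> \<phi> =
     measure_of UNIV (sets borel) (\<lambda>J. ennreal (Re (l2_inner \<phi> (\<Phi> (indicator J) \<phi>))))"

definition purely_ac_spectrum_in ::
  "((real \<Rightarrow> complex) \<Rightarrow> ('v \<Rightarrow> complex) \<Rightarrow> 'v \<Rightarrow> complex) \<Rightarrow> real set \<Rightarrow> bool" where
  "purely_ac_spectrum_in \<Phi> I \<longleftrightarrow>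
     (\<forall>\<phi> \<in> l2. absolutely_continuous (restrict_space lborel I)
                                       (restrict_space (spectral_measure \<Phi> \<phi>) I))"

definition bounded_borel_on :: "real set \<Rightarrow> (real \<Rightarrow> complex) set" where
  "bounded_borel_on I = {F \<in> borel_measurable (restrict_space borel I). bounded (F ` I)}"

definition extend0 :: "real set \<Rightarrow> (real \<Rightarrow> complex) \<Rightarrow> real \<Rightarrow> complex" where
  "extend0 I F = (\<lambda>x. if x \<in> I then F x else 0)"

definition kernel_apply :: "('v \<Rightarrow> 'v \<Rightarrow> complex) \<Rightarrow> ('v \<Rightarrow> complex) \<Rightarrow> 'v \<Rightarrow> complex" where
  "kernel_apply K f = (\<lambda>v. \<Sum>\<^sub>\<infinity>w. K v w * f w)"

definition op_trace :: "(('v \<Rightarrow> complex) \<Rightarrow> 'v \<Rightarrow> complex) \<Rightarrow> complex" where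
  "op_trace T = (\<Sum>\<^sub>\<infinity>v. l2_inner (delta v) (T (delta v)))"

end

theory Submission
  imports Defs
begin

text \<open>For finitely supported \<open>\<phi>\<close>, the quantity \<open>Im \<langle>\<phi>, (H - E - i\<eta>)\<^sup>-\<^sup>1 \<phi>\<rangle> / \<pi>\<close> is the Poisson integral of the spectral
  measure of \<open>\<phi>\<close>. As its limit exists for almost every \<open>E\<close>, it is the density of the absolutely
  continuous measure on \<open>I\<close>: Fatou's lemma on compact subsets of \<open>I\<close> bounds the limit from above, and the same
  bound for a complementary measure bounds it from below. Polarisation gives the first formula.

  On a tree the Green function is multiplicative along arcs, \<open>G(v, y) = \<zeta>\<^sub>w(v) G(w, y)\<close> whenever \<open>w\<close> is
  the second vertex of the arc from \<open>v\<close> to \<open>y\<close>. Hence \<open>P\<^sub>\<xi>(v) = G(v, u) / G(o, u)\<close> for every vertex \<open>u\<close> of the ray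
  \<open>[o, \<xi>]\<close> with \<open>|u| \<ge> |v|\<close>, so \<open>P\<^sub>\<xi>\<close> is locally constant in \<open>\<xi>\<close>. Green's formula for
  \<open>G(\<cdot>, v)\<close> and \<open>cnj G(\<cdot>, w)\<close> on a ball of radius \<open>n \<ge> |v|, |w|\<close> expresses \<open>Im G(v, w)\<close> as a sum over the
  edges leaving the ball, and this sum is the integral of \<open>P\<^sub>\<xi>(v) cnj P\<^sub>\<xi>(w)\<close> against \<open>\<nu>\<^sub>E\<close>.\<close>

section \<open>Boundary values of Poisson integrals\<close>

text \<open>Limits at real energies say nothing on a Lebesgue-null set of \<open>E\<close>, and
  singular spectrum could sit entirely on such a set; absolute continuity on \<open>I\<close> is
  what lets the exceptional energies be discarded. Spectrum outside \<open>I\<close> is arbitrary,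
  yet it enters every Poisson integral; the upper estimate is therefore integrated over a compact
  set of energies, where the contribution of all other spectrum dies out as the height tends to
  zero.

  Measurability in \<open>E\<close> is not visible from boundary values. It is inherited almost
  everywhere: by \<open>Psi_bv\<close> from a Radon-Nikodym density, and by the inner boundary
  integral from \<open>Psi_bv\<close>.

  Green's formula is applied to the limits \<open>G(., v; E + i0)\<close> themselves. They solve the
  resolvent equation with real \<open>E\<close> and real \<open>V\<close>, so inside the ball only
  the two poles act as sources. Each outgoing edge contributes a factor \<open>- Im\<close> of some
  zeta, and this explains the weights of the boundary measure: the mass beyond an edge is the flux
  of \<open>G(., o)\<close> through it, divided by \<open>pi\<close>.\<close>

definition poisson_kernel :: "real \<Rightarrow> real \<Rightarrow> real" where
  "poisson_kernel \<eta> t = \<eta> / (pi * (t\<^sup>2 + \<eta>\<^sup>2))"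

lemma poisson_kernel_nonneg: "\<eta> > 0 \<Longrightarrow> poisson_kernel \<eta> t \<ge> 0"
  by (simp add: poisson_kernel_def)

lemma poisson_kernel_minus: "poisson_kernel \<eta> (x - y) = poisson_kernel \<eta> (y - x)"
  by (simp add: poisson_kernel_def power2_commute)

lemma borel_measurable_poisson_kernel [measurable]: "poisson_kernel \<eta> \<in> borel_measurable borel"
  unfolding poisson_kernel_def by measurable

lemma poisson_kernel_bound: "\<eta> > 0 \<Longrightarrow> d > 0 \<Longrightarrow> \<bar>t\<bar> \<ge> d \<Longrightarrow> poisson_kernel \<eta> t \<le> \<eta> / (pi * d\<^sup>2)"
proof -
  assume a: "\<eta> > 0" "d > 0" "\<bar>t\<bar> \<ge> d"
  have "d\<^sup>2 \<le> t\<^sup>2" using a abs_le_square_iff[of d t] by simp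
  then have "pi * d\<^sup>2 \<le> pi * (t\<^sup>2 + \<eta>\<^sup>2)" using a by (intro mult_left_mono) (auto intro: add_increasing2)
  then show ?thesis unfolding poisson_kernel_def using a
    by (intro divide_left_mono mult_pos_pos) (auto intro!: add_nonneg_pos)
qed

lemma poisson_kernel_le: "\<eta> > 0 \<Longrightarrow> poisson_kernel \<eta> t \<le> 1 / (pi * \<eta>)"
proof -
  assume a: "\<eta> > 0"
  have "poisson_kernel \<eta> t \<le> \<eta> / (pi * \<eta>\<^sup>2)"
    unfolding poisson_kernel_def using a by (intro divide_left_mono mult_left_mono) (auto intro!: mult_pos_pos add_nonneg_pos)
  then show ?thesis using a by (simp add: power2_eq_square)
qed

text \<open>The primitive in \<open>t\<close> is \<open>arctan ((t - x) / \<eta>) / pi\<close>, so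
  the factor \<open>pi\<close> in the kernel normalises its total mass to one.\<close>

lemma poisson_kernel_integral_Icc:
  assumes "\<eta> > 0" "a \<le> b"
  shows "(\<integral>\<^sup>+ t \<in> {a..b}. ennreal (poisson_kernel \<eta> (x - t)) \<partial>lborel)
         = ennreal ((arctan ((b - x) / \<eta>) - arctan ((a - x) / \<eta>)) / pi)"
proof -
  have "((\<lambda>t. arctan ((t - x) / \<eta>) / pi) has_real_derivative poisson_kernel \<eta> (x - t)) (at t)" for t
  proof -
    have "((\<lambda>t. arctan ((t - x) / \<eta>) / pi) has_real_derivative
            (inverse (1 + ((t - x) / \<eta>)\<^sup>2) * (1 / \<eta>)) / pi) (at t)"
      using assms by (auto intro!: derivative_eq_intros)
    moreover have "(inverse (1 + ((t - x) / \<eta>)\<^sup>2) * (1 / \<eta>)) / pi = poisson_kernel \<eta> (x - t)"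
    proof -
      have p: "(t - x)\<^sup>2 + \<eta>\<^sup>2 \<noteq> 0" using assms by (simp add: add_nonneg_eq_0_iff)
      have "1 + ((t - x) / \<eta>)\<^sup>2 = ((t - x)\<^sup>2 + \<eta>\<^sup>2) / \<eta>\<^sup>2"
        using assms by (simp add: power_divide field_simps)
      then show ?thesis unfolding poisson_kernel_def using assms p
        by (simp add: power2_commute[of x t]) (simp add: power2_eq_square)
    qed
    ultimately show ?thesis by simp
  qed
  then show ?thesis
    using nn_integral_FTC_Icc[of "\<lambda>t. poisson_kernel \<eta> (x - t)" a b "\<lambda>t. arctan ((t - x) / \<eta>) / pi"] assms
    by (auto simp: poisson_kernel_nonneg diff_divide_distrib)
qed

lemma poisson_kernel_integral_le_1:
  assumes "\<eta> > 0" "K \<subseteq> {a..b}" "a \<le> b"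
  shows "(\<integral>\<^sup>+ t \<in> K. ennreal (poisson_kernel \<eta> (x - t)) \<partial>lborel) \<le> 1"
proof -
  have "(\<integral>\<^sup>+ t \<in> K. ennreal (poisson_kernel \<eta> (x - t)) \<partial>lborel)
        \<le> (\<integral>\<^sup>+ t \<in> {a..b}. ennreal (poisson_kernel \<eta> (x - t)) \<partial>lborel)"
    using assms by (intro nn_integral_mono) (auto simp: indicator_def)
  also have "\<dots> \<le> 1"
    unfolding poisson_kernel_integral_Icc[OF assms(1,3)] ennreal_le_1
    using arctan_ubound[of "(b - x) / \<eta>"] arctan_lbound[of "(a - x) / \<eta>"] by simp
  finally show ?thesis .
qed

text \<open>Heights run through a sequence because Fatou's lemma is about sequences; with values in
  \<open>ennreal\<close> the \<open>liminf\<close> exists at every point.\<close>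

definition poisson_at_height :: "real measure \<Rightarrow> nat \<Rightarrow> real \<Rightarrow> ennreal" where
  "poisson_at_height \<mu> n x = (\<integral>\<^sup>+ t. ennreal (poisson_kernel (1 / real (Suc n)) (x - t)) \<partial>\<mu>)"

lemma borel_measurable_poisson_at_height [measurable]:
  assumes "finite_measure \<mu>" "sets \<mu> = sets borel"
  shows "poisson_at_height \<mu> n \<in> borel_measurable borel"
proof -
  interpret finite_measure \<mu> by fact
  have [measurable_cong]: "sets \<mu> = sets borel" by fact
  show ?thesis unfolding poisson_at_height_def poisson_kernel_def by measurable
qed

text \<open>After Fatou and an exchange of integrals, \<open>\<mu>\<close> is integrated against
  \<open>p n t\<close>, the mass that the kernel centred at \<open>t\<close> puts on
  \<open>K\<close>. This mass is at most one, and for \<open>t\<close> outside \<open>K\<close> it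
  tends to zero because compactness keeps \<open>t\<close> at a positive distance; dominated
  convergence for the finite measure then leaves only \<open>\<mu>\<close> of
  \<open>K\<close>.\<close>

lemma nn_integral_poisson_at_height_compact_le:
  assumes "finite_measure \<mu>" "sets \<mu> = sets borel" "compact K"
  shows "(\<integral>\<^sup>+ x \<in> K. liminf (\<lambda>n. poisson_at_height \<mu> n x) \<partial>lborel) \<le> emeasure \<mu> K"
proof -
  interpret finite_measure \<mu> by fact
  have S [measurable_cong]: "sets \<mu> = sets borel" by fact
  have [measurable]: "K \<in> sets borel" using assms(3) by (simp add: borel_compact)
  have [measurable]: "poisson_at_height \<mu> n \<in> borel_measurable borel" for n
    by (rule borel_measurable_poisson_at_height[OF assms(1,2)])
  interpret pair_sigma_finite lborel \<mu> ..
  obtain a b where ab: "K \<subseteq> {a..b}" "a \<le> b"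
  proof -
    obtain c where "\<And>x. x \<in> K \<Longrightarrow> \<bar>x\<bar> \<le> c"
      using compact_imp_bounded[OF assms(3)] by (auto simp: bounded_iff)
    then have "K \<subseteq> {- \<bar>c\<bar>..\<bar>c\<bar>}" by force
    then show ?thesis using that[of "- \<bar>c\<bar>" "\<bar>c\<bar>"] by auto
  qed
  define p where "p n t = (\<integral>\<^sup>+ x \<in> K. ennreal (poisson_kernel (1 / real (Suc n)) (x - t)) \<partial>lborel)" for n t
  have p_le: "p n t \<le> 1" for n t
    using poisson_kernel_integral_le_1[of "1 / real (Suc n)" K a b t] ab
    by (simp add: p_def poisson_kernel_minus[of _ _ t])
  have p_meas [measurable]: "p n \<in> borel_measurable borel" for n
    unfolding p_def poisson_kernel_def by measurable
  have p_lim: "(\<lambda>n. p n t) \<longlonglongrightarrow> 0" if t: "t \<notin> K" for t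
  proof -
    obtain d where d: "d > 0" "\<And>x. x \<in> K \<Longrightarrow> d \<le> dist t x"
      using separate_point_closed[OF compact_imp_closed[OF assms(3)] t] by auto
    have "p n t \<le> ennreal (inverse (real (Suc n)) * ((b - a) / (pi * d\<^sup>2)))" for n
    proof -
      have "p n t \<le> (\<integral>\<^sup>+ x. ennreal ((1 / real (Suc n)) / (pi * d\<^sup>2)) * indicator {a..b} x \<partial>lborel)"
        unfolding p_def
      proof (rule nn_integral_mono)
        fix x
        show "ennreal (poisson_kernel (1 / real (Suc n)) (x - t)) * indicator K x
              \<le> ennreal ((1 / real (Suc n)) / (pi * d\<^sup>2)) * indicator {a..b} x"
        proof (cases "x \<in> K")
          case True
          then have "poisson_kernel (1 / real (Suc n)) (x - t) \<le> (1 / real (Suc n)) / (pi * d\<^sup>2)"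
            using d(2)[of x] d(1) by (intro poisson_kernel_bound) (auto simp: dist_real_def)
          then show ?thesis using True ab by (auto simp: indicator_def intro!: ennreal_leI)
        qed simp
      qed
      also have "\<dots> = ennreal (inverse (real (Suc n)) * ((b - a) / (pi * d\<^sup>2)))"
        using ab d by (subst nn_integral_cmult_indicator) (auto simp: ennreal_mult[symmetric] field_simps)
      finally show ?thesis .
    qed
    moreover have "(\<lambda>n. ennreal (inverse (real (Suc n)) * ((b - a) / (pi * d\<^sup>2)))) \<longlonglongrightarrow> ennreal (0 * ((b - a) / (pi * d\<^sup>2)))"
      by (intro tendsto_ennrealI tendsto_mult LIMSEQ_inverse_real_of_nat tendsto_const)
    ultimately show ?thesis
      by (intro tendsto_sandwich[of "\<lambda>_. 0" "\<lambda>n. p n t" _ "\<lambda>n. ennreal (inverse (real (Suc n)) * ((b - a) / (pi * d\<^sup>2)))"])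
         auto
  qed
  have lim0: "(\<lambda>n. \<integral>\<^sup>+ t. p n t * indicator (- K) t \<partial>\<mu>) \<longlonglongrightarrow> (\<integral>\<^sup>+ t. 0 \<partial>\<mu>)"
  proof (rule nn_integral_dominated_convergence[where w = "\<lambda>_. 1"])
    show "AE t in \<mu>. (\<lambda>n. p n t * indicator (- K) t) \<longlonglongrightarrow> 0"
    proof (rule AE_I2)
      fix t show "(\<lambda>n. p n t * indicator (- K) t) \<longlonglongrightarrow> 0"
        using p_lim[of t] by (cases "t \<in> K") auto
    qed
    show "AE t in \<mu>. p j t * indicator (- K) t \<le> 1" for j
      using p_le by (auto simp: indicator_def)
    show "(\<integral>\<^sup>+ x. 1 \<partial>\<mu>) < \<infinity>" by (simp add: less_top[symmetric])
  qed auto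
  have "(\<integral>\<^sup>+ x \<in> K. liminf (\<lambda>n. poisson_at_height \<mu> n x) \<partial>lborel)
        = (\<integral>\<^sup>+ x. liminf (\<lambda>n. poisson_at_height \<mu> n x * indicator K x) \<partial>lborel)"
  proof (rule nn_integral_cong)
    fix x show "liminf (\<lambda>n. poisson_at_height \<mu> n x) * indicator K x = liminf (\<lambda>n. poisson_at_height \<mu> n x * indicator K x)"
      by (cases "x \<in> K") (auto simp: Liminf_const)
  qed
  also have "\<dots> \<le> liminf (\<lambda>n. \<integral>\<^sup>+ x \<in> K. poisson_at_height \<mu> n x \<partial>lborel)"
    by (rule nn_integral_liminf) measurable
  also have "\<dots> \<le> liminf (\<lambda>n. emeasure \<mu> K + (\<integral>\<^sup>+ t. p n t * indicator (- K) t \<partial>\<mu>))"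
  proof (rule Liminf_mono, rule always_eventually, rule allI)
    fix n
    have "(\<integral>\<^sup>+ x \<in> K. poisson_at_height \<mu> n x \<partial>lborel)
          = (\<integral>\<^sup>+ x. \<integral>\<^sup>+ t. ennreal (poisson_kernel (1 / real (Suc n)) (x - t)) * indicator K x \<partial>\<mu> \<partial>lborel)"
      unfolding poisson_at_height_def by (intro nn_integral_cong nn_integral_multc[symmetric]) measurable
    also have "\<dots> = (\<integral>\<^sup>+ t. p n t \<partial>\<mu>)"
      unfolding p_def by (rule Fubini'[symmetric]) (simp add: poisson_kernel_def, measurable)
    also have "\<dots> \<le> (\<integral>\<^sup>+ t. indicator K t + p n t * indicator (- K) t \<partial>\<mu>)"
      using p_le by (intro nn_integral_mono) (auto simp: indicator_def)
    also have "\<dots> = emeasure \<mu> K + (\<integral>\<^sup>+ t. p n t * indicator (- K) t \<partial>\<mu>)"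
      by (subst nn_integral_add) auto
    finally show "(\<integral>\<^sup>+ x \<in> K. poisson_at_height \<mu> n x \<partial>lborel) \<le> \<dots>" .
  qed
  also have "\<dots> = emeasure \<mu> K"
  proof -
    have "(\<lambda>n. emeasure \<mu> K + (\<integral>\<^sup>+ t. p n t * indicator (- K) t \<partial>\<mu>)) \<longlonglongrightarrow> emeasure \<mu> K + 0"
      using lim0 by (intro tendsto_add) auto
    then show ?thesis using lim_imp_Liminf[OF sequentially_bot] by fastforce
  qed
  finally show ?thesis .
qed

text \<open>Inner regularity. Cutting down to a bounded interval first makes the measure finite and
  closed subsets compact.\<close>

lemma not_null_contains_compact:
  assumes "B \<in> sets (borel :: real measure)" "emeasure lborel B \<noteq> 0"
  obtains K where "compact K" "K \<subseteq> B" "emeasure lborel K \<noteq> 0"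
proof -
  have "\<exists>n::nat. emeasure lborel (B \<inter> {- real n..real n}) \<noteq> 0"
  proof (rule ccontr)
    assume "\<not> ?thesis"
    then have "(\<Union>n. B \<inter> {- real n..real n}) \<in> null_sets lborel"
      using assms by (intro null_sets_UN) (auto simp: null_sets_def)
    moreover have "(\<Union>n. B \<inter> {- real n..real n}) = B"
    proof -
      have "\<exists>n. x \<in> {- real n..real n}" for x :: real
        using real_arch_simple[of "\<bar>x\<bar>"] by (simp add: abs_le_iff) (metis minus_le_iff)
      then show ?thesis by blast
    qed
    ultimately show False using assms by auto
  qed
  then obtain n where n: "emeasure lborel (B \<inter> {- real n..real n}) \<noteq> 0" by auto
  define S where "S = B \<inter> {- real n..real n}"
  have Sb: "S \<in> sets borel" using assms by (auto simp: S_def)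
  have Sl: "S \<in> lmeasurable"
  proof -
    have "emeasure lborel S \<le> emeasure lborel {- real n..real n}"
      by (intro emeasure_mono) (auto simp: S_def)
    then have "emeasure lborel S < \<infinity>" by (auto simp: top_unique intro: le_less_trans)
    then show ?thesis using Sb by (intro fmeasurableI) auto
  qed
  have "measure lebesgue S \<noteq> 0"
  proof
    assume "measure lebesgue S = 0"
    then have "emeasure lebesgue S = 0"
      using emeasure_eq_ennreal_measure[OF fmeasurableD2[OF Sl]] by simp
    then show False using n Sb by (simp add: S_def)
  qed
  then have m: "measure lebesgue S > 0" by (simp add: zero_less_measure_iff)
  \<comment> \<open>The tolerance is the full measure of \<open>S\<close>: the remainder
    \<open>S - T\<close> is then strictly smaller than \<open>S\<close>, so \<open>T\<close> cannot
    be null.\<close>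
  obtain T where T: "closed T" "T \<subseteq> S" "emeasure lebesgue (S - T) < ennreal (measure lebesgue S)"
    by (rule sets_lebesgue_inner_closed[OF fmeasurableD[OF Sl] m])
  have cT: "compact T"
    unfolding compact_eq_bounded_closed
    using T(1,2) by (auto simp: S_def intro: bounded_subset[OF bounded_closed_interval[of "- real n" "real n"]])
  have "emeasure lborel T \<noteq> 0"
  proof
    assume 0: "emeasure lborel T = 0"
    have Tb: "T \<in> sets borel" by (rule borel_closed[OF T(1)])
    then have "T \<in> sets lebesgue" by simp
    then have "emeasure lebesgue S = emeasure lebesgue T + emeasure lebesgue (S - T)"
      using T(2) Sl by (subst plus_emeasure) (auto simp: Un_absorb1 fmeasurableD)
    then have "emeasure lebesgue S = emeasure lebesgue (S - T)" using 0 Tb by simp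
    then show False
      using T(3) emeasure_eq_ennreal_measure[OF fmeasurableD2[OF Sl]] by simp
  qed
  then show ?thesis using that[OF cT] T S_def by auto
qed

text \<open>If the inequality failed on a set of positive measure, a compact \<open>K\<close> inside
  that set would satisfy the strict inequality between the integrals of \<open>f\<close> and of the
  \<open>liminf\<close>, although the latter is bounded by \<open>\<mu>\<close> of \<open>K\<close>,
  which is the former.\<close>

lemma liminf_poisson_at_height_le_density:
  assumes "finite_measure \<mu>" "sets \<mu> = sets borel" "I \<in> sets borel"
    and f [measurable]: "f \<in> borel_measurable borel"
    and "\<And>J. J \<in> sets borel \<Longrightarrow> J \<subseteq> I \<Longrightarrow> emeasure \<mu> J = (\<integral>\<^sup>+ x \<in> J. f x \<partial>lborel)"
  shows "AE x in lborel. x \<in> I \<longrightarrow> liminf (\<lambda>n. poisson_at_height \<mu> n x) \<le> f x"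
proof -
  interpret finite_measure \<mu> by fact
  have [measurable]: "poisson_at_height \<mu> n \<in> borel_measurable borel" for n
    by (rule borel_measurable_poisson_at_height[OF assms(1,2)])
  note assms(3)[measurable]
  define L where "L x = liminf (\<lambda>n. poisson_at_height \<mu> n x)" for x
  have [measurable]: "L \<in> borel_measurable borel" unfolding L_def by measurable
  define B where "B = {x \<in> space borel. x \<in> I \<and> f x < L x}"
  have B: "B \<in> sets borel" unfolding B_def by measurable
  have "emeasure lborel B = 0"
  proof (rule ccontr)
    assume "emeasure lborel B \<noteq> 0"
    then obtain K where K: "compact K" "K \<subseteq> B" "emeasure lborel K \<noteq> 0"
      using not_null_contains_compact[OF B] by blast
    have [measurable]: "K \<in> sets borel" using K by (simp add: borel_compact)
    have fin: "(\<integral>\<^sup>+ x \<in> K. f x \<partial>lborel) = emeasure \<mu> K"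
      using assms(5)[of K] K by (simp add: B_def subset_iff)
    have "(\<integral>\<^sup>+ x \<in> K. f x \<partial>lborel) < (\<integral>\<^sup>+ x \<in> K. L x \<partial>lborel)"
    proof (rule nn_integral_less)
      show "(\<integral>\<^sup>+ x \<in> K. f x \<partial>lborel) \<noteq> \<infinity>" using fin by simp
      show "AE x in lborel. f x * indicator K x \<le> L x * indicator K x"
        using K by (intro AE_I2) (auto simp: B_def indicator_def)
      show "\<not> (AE x in lborel. L x * indicator K x \<le> f x * indicator K x)"
      proof
        assume "AE x in lborel. L x * indicator K x \<le> f x * indicator K x"
        then have "AE x in lborel. x \<notin> K"
        proof (rule AE_mp, intro AE_I2 impI notI)
          fix x assume "L x * indicator K x \<le> f x * indicator K x" "x \<in> K"
          then show False using K by (auto simp: B_def)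
        qed
        then have "emeasure lborel K = 0"
          using AE_iff_measurable[of K lborel "\<lambda>x. x \<notin> K"] by auto
        then show False using K by simp
      qed
    qed measurable
    then show False
      using nn_integral_poisson_at_height_compact_le[OF assms(1,2) K(1)] fin by (simp add: L_def)
  qed
  then have "AE x in lborel. x \<notin> B"
    using AE_iff_measurable[of B lborel "\<lambda>x. x \<notin> B"] B by auto
  then show ?thesis by (rule AE_mp) (auto simp: B_def L_def not_less)
qed

lemma integrable_poisson_kernel:
  assumes "finite_measure \<mu>" "sets \<mu> = sets borel" "\<eta> > 0"
  shows "integrable \<mu> (\<lambda>t. poisson_kernel \<eta> (x - t))"
proof -
  interpret finite_measure \<mu> by fact
  have [measurable_cong]: "sets \<mu> = sets borel" by fact
  show ?thesis
    using assms(3) poisson_kernel_nonneg[of \<eta>] poisson_kernel_le[of \<eta>]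
    by (intro integrable_const_bound[where B = "1 / (pi * \<eta>)"]) auto
qed

lemma poisson_at_height_eq_integral:
  assumes "finite_measure \<mu>" "sets \<mu> = sets borel"
  shows "poisson_at_height \<mu> n x = ennreal (\<integral> t. poisson_kernel (1 / real (Suc n)) (x - t) \<partial>\<mu>)"
  unfolding poisson_at_height_def
  by (intro nn_integral_eq_integral integrable_poisson_kernel[OF assms] AE_I2 poisson_kernel_nonneg) auto

text \<open>Supplies the Poisson limit of a constant density on an interval, the total from which
  the complementary measure of the lower bound is formed.\<close>

lemma poisson_at_height_interval_tendsto:
  assumes "x \<in> {a<..<b}"
  shows "(\<lambda>n. \<integral>\<^sup>+ t \<in> {a..b}. ennreal (poisson_kernel (1 / real (Suc n)) (x - t)) \<partial>lborel) \<longlonglongrightarrow> 1"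
proof -
  have S: "filterlim (\<lambda>n. real (Suc n)) at_top sequentially"
    using filterlim_compose[OF filterlim_real_sequentially filterlim_Suc] by simp
  have 1: "(\<lambda>n. arctan ((b - x) * real (Suc n))) \<longlonglongrightarrow> pi / 2"
    using assms by (intro filterlim_compose[OF tendsto_arctan_at_top] filterlim_tendsto_pos_mult_at_top[OF tendsto_const _ S]) auto
  have 2: "(\<lambda>n. arctan ((x - a) * real (Suc n))) \<longlonglongrightarrow> pi / 2"
    using assms by (intro filterlim_compose[OF tendsto_arctan_at_top] filterlim_tendsto_pos_mult_at_top[OF tendsto_const _ S]) auto
  have "(\<lambda>n. ennreal ((arctan ((b - x) * real (Suc n)) + arctan ((x - a) * real (Suc n))) / pi)) \<longlonglongrightarrow> ennreal ((pi / 2 + pi / 2) / pi)"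
    by (intro tendsto_ennrealI tendsto_divide tendsto_add 1 2 tendsto_const) auto
  moreover have "(\<integral>\<^sup>+ t \<in> {a..b}. ennreal (poisson_kernel (1 / real (Suc n)) (x - t)) \<partial>lborel)
     = ennreal ((arctan ((b - x) * real (Suc n)) + arctan ((x - a) * real (Suc n))) / pi)" for n
  proof -
    have "arctan ((a - x) * real (Suc n)) = - arctan ((x - a) * real (Suc n))"
      by (subst arctan_minus[symmetric]) (simp add: algebra_simps)
    then show ?thesis using poisson_kernel_integral_Icc[of "1 / real (Suc n)" a b x] assms by simp
  qed
  ultimately show ?thesis by simp
qed

text \<open>The lower bound follows from the preceding upper bound, applied to the complementary measure
  \<open>(m \<cdot> 1\<^bsub>[-m, m]\<^esub> - g) dx\<close> with \<open>g = min f m\<close> cut off outside \<open>I \<inter> [-m, m]\<close>; no differentiation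
  theorem is needed because the limit is known to exist.\<close>

lemma density_le_poisson_limit:
  assumes "finite_measure \<mu>" "sets \<mu> = sets borel" "I \<in> sets borel"
    and f [measurable]: "f \<in> borel_measurable borel"
    and "\<And>J. J \<in> sets borel \<Longrightarrow> J \<subseteq> I \<Longrightarrow> emeasure \<mu> J = (\<integral>\<^sup>+ x \<in> J. f x \<partial>lborel)"
  shows "AE x in lborel. x \<in> I \<longrightarrow> (\<forall>u. (\<lambda>n. poisson_at_height \<mu> n x) \<longlonglongrightarrow> ennreal u \<longrightarrow> f x \<le> ennreal u)"
proof -
  interpret finite_measure \<mu> by fact
  have S [measurable_cong]: "sets \<mu> = sets borel" by fact
  note assms(3)[measurable]
  define g where "g m x = min (f x) (of_nat m) * indicator (I \<inter> {- real m..real m}) x" for m :: nat and x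
  have [measurable]: "g m \<in> borel_measurable borel" for m unfolding g_def by measurable
  define c where "c m x = of_nat m * indicator {- real m..real m} x - g m x" for m :: nat and x
  have [measurable]: "c m \<in> borel_measurable borel" for m unfolding c_def by measurable
  have g_le: "g m x \<le> of_nat m * indicator {- real m..real m} x" for m x
    by (auto simp: g_def indicator_def)
  have cg: "c m x + g m x = of_nat m * indicator {- real m..real m} x" for m x
    unfolding c_def using g_le[of m x] by (simp add: diff_add_cancel_ennreal)
  have c_le: "c m x \<le> of_nat m * indicator {- real m..real m} x" for m x
    unfolding c_def by (rule diff_le_self_ennreal)
  define \<sigma> where "\<sigma> m = density lborel (c m)" for m
  have \<sigma>_sets: "sets (\<sigma> m) = sets borel" for m by (simp add: \<sigma>_def)
  have \<sigma>_fin: "finite_measure (\<sigma> m)" for m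
  proof
    have "emeasure (\<sigma> m) UNIV = (\<integral>\<^sup>+ x. c m x \<partial>lborel)"
      unfolding \<sigma>_def by (subst emeasure_density) auto
    also have "\<dots> \<le> (\<integral>\<^sup>+ x. of_nat m * indicator {- real m..real m} x \<partial>lborel)"
      by (intro nn_integral_mono c_le)
    also have "\<dots> = ennreal (real m * (2 * real m))"
      by (simp add: nn_integral_cmult ennreal_mult ennreal_of_nat_eq_real_of_nat)
    also have "\<dots> < \<infinity>" by simp
    finally show "emeasure (\<sigma> m) (space (\<sigma> m)) \<noteq> \<infinity>" by (simp add: \<sigma>_def)
  qed
  \<comment> \<open>\<open>\<mu>\<close> is described by \<open>f\<close> inside \<open>I\<close>
    only, so it is restricted to \<open>I\<close>; dropping the rest can only lower the Poisson
    integral.\<close>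
  have poisson_at_height_g: "(\<integral>\<^sup>+ t. g m t * ennreal (poisson_kernel (1 / real (Suc n)) (x - t)) \<partial>lborel) \<le> poisson_at_height \<mu> n x" for m n x
  proof -
    have eq: "density \<mu> (indicator I) = density lborel (\<lambda>t. f t * indicator I t)"
    proof (rule measure_eqI)
      fix J assume "J \<in> sets (density \<mu> (indicator I))"
      then have [measurable]: "J \<in> sets borel" by (simp add: S)
      have "emeasure (density \<mu> (indicator I)) J = emeasure \<mu> (I \<inter> J)"
        by (simp add: emeasure_density indicator_inter_arith[symmetric])
      also have "\<dots> = emeasure (density lborel (\<lambda>t. f t * indicator I t)) J"
        by (subst assms(5)) (auto simp: emeasure_density indicator_inter_arith mult.assoc intro!: nn_integral_cong)
      finally show "emeasure (density \<mu> (indicator I)) J = \<dots>" .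
    qed (simp add: S)
    have "(\<integral>\<^sup>+ t. g m t * ennreal (poisson_kernel (1 / real (Suc n)) (x - t)) \<partial>lborel)
          \<le> (\<integral>\<^sup>+ t. (f t * indicator I t) * ennreal (poisson_kernel (1 / real (Suc n)) (x - t)) \<partial>lborel)"
      by (intro nn_integral_mono mult_right_mono) (auto simp: g_def indicator_def)
    also have "\<dots> = (\<integral>\<^sup>+ t. ennreal (poisson_kernel (1 / real (Suc n)) (x - t)) \<partial>density lborel (\<lambda>t. f t * indicator I t))"
      by (subst nn_integral_density) auto
    also have "\<dots> = (\<integral>\<^sup>+ t. indicator I t * ennreal (poisson_kernel (1 / real (Suc n)) (x - t)) \<partial>\<mu>)"
      unfolding eq[symmetric] by (subst nn_integral_density) auto
    also have "\<dots> \<le> poisson_at_height \<mu> n x"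
      unfolding poisson_at_height_def by (intro nn_integral_mono) (auto simp: indicator_def)
    finally show ?thesis .
  qed
  \<comment> \<open>The complementary measures have a density on the whole line, so the upper bound
    applies with \<open>UNIV\<close> in the role of \<open>I\<close>. Countably many
    \<open>m\<close> share one null set.\<close>
  have "AE x in lborel. \<forall>m. x \<in> UNIV \<longrightarrow> liminf (\<lambda>n. poisson_at_height (\<sigma> m) n x) \<le> c m x"
    unfolding AE_all_countable
    by (intro allI liminf_poisson_at_height_le_density \<sigma>_sets \<sigma>_fin) (auto simp: \<sigma>_def emeasure_density)
  then show ?thesis
  proof (rule AE_mp, intro AE_I2 impI allI)
    fix x u
    assume L: "\<forall>m. x \<in> UNIV \<longrightarrow> liminf (\<lambda>n. poisson_at_height (\<sigma> m) n x) \<le> c m x" and x: "x \<in> I"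
      and u: "(\<lambda>n. poisson_at_height \<mu> n x) \<longlonglongrightarrow> ennreal u"
    show "f x \<le> ennreal u"
    proof (rule ccontr)
      assume "\<not> f x \<le> ennreal u"
      then have fu: "ennreal u < f x" by simp
      \<comment> \<open>\<open>m\<close> exceeds \<open>\<bar>x\<bar>\<close> to put
        \<open>x\<close> in the interior of the interval, and exceeds \<open>\<bar>u\<bar>\<close>
        so that truncating \<open>f\<close> at \<open>m\<close> does not hide the assumed excess of
        \<open>f x\<close> over \<open>u\<close>.\<close>
      obtain m :: nat where m: "real m > max \<bar>x\<bar> \<bar>u\<bar>" using reals_Archimedean2 by blast
      have m0: "m > 0" using m by (cases m) auto
      define q where "q n = (\<integral>\<^sup>+ t \<in> {- real m..real m}. ennreal (poisson_kernel (1 / real (Suc n)) (x - t)) \<partial>lborel)" for n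
      have "(\<lambda>n. ennreal (real m) * q n) \<longlonglongrightarrow> ennreal (real m) * 1"
        unfolding q_def using m by (intro ennreal_tendsto_cmult poisson_at_height_interval_tendsto) auto
      then have "(\<lambda>n. ennreal (real m) * q n - poisson_at_height \<mu> n x) \<longlonglongrightarrow> ennreal (real m) - ennreal u"
        using u by (intro tendsto_diff_ennreal) auto
      then have "ennreal (real m) - ennreal u = liminf (\<lambda>n. ennreal (real m) * q n - poisson_at_height \<mu> n x)"
        using lim_imp_Liminf[OF sequentially_bot] by fastforce
      also have "\<dots> \<le> liminf (\<lambda>n. poisson_at_height (\<sigma> m) n x)"
      proof (rule Liminf_mono, rule always_eventually, rule allI)
        fix n
        have "ennreal (real m) * q n = (\<integral>\<^sup>+ t. (c m t + g m t) * ennreal (poisson_kernel (1 / real (Suc n)) (x - t)) \<partial>lborel)"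
          unfolding q_def cg
          by (subst nn_integral_cmult[symmetric]) (auto simp: ennreal_of_nat_eq_real_of_nat mult_ac)
        also have "\<dots> = (\<integral>\<^sup>+ t. c m t * ennreal (poisson_kernel (1 / real (Suc n)) (x - t)) \<partial>lborel)
             + (\<integral>\<^sup>+ t. g m t * ennreal (poisson_kernel (1 / real (Suc n)) (x - t)) \<partial>lborel)"
          by (subst nn_integral_add[symmetric]) (auto simp: distrib_right)
        also have "(\<integral>\<^sup>+ t. c m t * ennreal (poisson_kernel (1 / real (Suc n)) (x - t)) \<partial>lborel) = poisson_at_height (\<sigma> m) n x"
          unfolding poisson_at_height_def \<sigma>_def by (subst nn_integral_density) auto
        also have "poisson_at_height (\<sigma> m) n x + (\<integral>\<^sup>+ t. g m t * ennreal (poisson_kernel (1 / real (Suc n)) (x - t)) \<partial>lborel)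
            \<le> poisson_at_height (\<sigma> m) n x + poisson_at_height \<mu> n x"
          by (intro add_left_mono poisson_at_height_g)
        finally show "ennreal (real m) * q n - poisson_at_height \<mu> n x \<le> poisson_at_height (\<sigma> m) n x"
          by (simp add: ennreal_minus_le_iff add.commute poisson_at_height_eq_integral[OF assms(1,2)])
      qed
      also have "\<dots> \<le> c m x" using L by auto
      also have "c m x = ennreal (real m) - min (f x) (ennreal (real m))"
        using m x by (auto simp: c_def g_def indicator_def ennreal_of_nat_eq_real_of_nat abs_le_iff)
      finally have le: "ennreal (real m) - ennreal u \<le> ennreal (real m) - min (f x) (ennreal (real m))" .
      have um: "ennreal u < ennreal (real m)" using m m0 by (intro ennreal_lessI) auto
      have "min (f x) (ennreal (real m)) \<le> ennreal u"
        using um by (intro ennreal_mono_minus_cancel[OF le]) (use m in auto)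
      then show False using fu um by (auto simp: min_def split: if_splits)
    qed
  qed
qed

text \<open>Convergence for all small heights includes the sequence of heights, so the
  \<open>liminf\<close> of the upper bound and the limit of the lower bound are the same
  number.\<close>

lemma poisson_limit_eq_density:
  assumes "finite_measure \<mu>" "sets \<mu> = sets borel" "I \<in> sets borel" "\<AA> \<in> null_sets lebesgue"
    and f: "f \<in> borel_measurable borel"
    and d: "\<And>J. J \<in> sets borel \<Longrightarrow> J \<subseteq> I \<Longrightarrow> emeasure \<mu> J = (\<integral>\<^sup>+ x \<in> J. f x \<partial>lborel)"
    and lim: "\<And>x. x \<in> I - \<AA> \<Longrightarrow> ((\<lambda>\<eta>. \<integral> t. poisson_kernel \<eta> (x - t) \<partial>\<mu>) \<longlongrightarrow> u x) (at_right 0)"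
  shows "AE x in lebesgue. x \<in> I \<longrightarrow> f x = ennreal (u x)"
proof -
  have "filterlim (\<lambda>n. 1 / real (Suc n)) (at_right 0) sequentially"
    unfolding filterlim_at using LIMSEQ_inverse_real_of_nat by (auto simp: inverse_eq_divide)
  then have L: "(\<lambda>n. poisson_at_height \<mu> n x) \<longlonglongrightarrow> ennreal (u x)" if "x \<in> I - \<AA>" for x
    unfolding poisson_at_height_eq_integral[OF assms(1,2)]
    by (intro tendsto_ennrealI filterlim_compose[OF lim[OF that]])
  have "AE x in lebesgue. x \<in> I \<longrightarrow> liminf (\<lambda>n. poisson_at_height \<mu> n x) \<le> f x"
    by (intro AE_completion liminf_poisson_at_height_le_density assms)
  moreover have "AE x in lebesgue. x \<in> I \<longrightarrow> (\<forall>u. (\<lambda>n. poisson_at_height \<mu> n x) \<longlonglongrightarrow> ennreal u \<longrightarrow> f x \<le> ennreal u)"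
    by (intro AE_completion density_le_poisson_limit assms)
  moreover have "AE x in lebesgue. x \<notin> \<AA>" using assms(4) by (rule AE_not_in)
  ultimately show ?thesis
  proof eventually_elim
    case (elim x)
    show ?case
    proof
      assume "x \<in> I"
      then have l: "(\<lambda>n. poisson_at_height \<mu> n x) \<longlonglongrightarrow> ennreal (u x)" using L elim by auto
      then have "liminf (\<lambda>n. poisson_at_height \<mu> n x) = ennreal (u x)"
        by (rule lim_imp_Liminf[OF sequentially_bot])
      with l elim \<open>x \<in> I\<close> show "f x = ennreal (u x)" by (auto intro: antisym)
    qed
  qed
qed

text \<open>Completeness of Lebesgue measure. It provides the measurability of integrands built from
  boundary values, which are controlled only off a null set.\<close>

lemma borel_measurable_lebesgue_cong_AE:
  fixes f g :: "real \<Rightarrow> 'a::topological_space"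
  assumes "g \<in> borel_measurable lebesgue" "AE x in lebesgue. f x = g x"
  shows "f \<in> borel_measurable lebesgue"
proof (rule measurableI)
  fix A :: "'a set" assume "A \<in> sets borel"
  then have a: "g -` A \<inter> space lebesgue \<in> sets lebesgue" using assms(1) by measurable
  have b: "AE x in lebesgue. x \<in> g -` A \<inter> space lebesgue \<longleftrightarrow> x \<in> f -` A \<inter> space lebesgue"
    using assms(2) by (rule AE_mp) auto
  show "f -` A \<inter> space lebesgue \<in> sets lebesgue"
    by (rule completion.in_sets_AE[OF b a]) simp
qed auto

theorem integral_eq_poisson_limit:
  fixes F :: "real \<Rightarrow> complex"
  assumes "finite_measure \<mu>" "sets \<mu> = sets borel" "I \<in> sets borel" "\<AA> \<in> null_sets lebesgue"
    and ac: "\<And>J. J \<in> null_sets lborel \<Longrightarrow> J \<subseteq> I \<Longrightarrow> emeasure \<mu> J = 0"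
    and lim: "\<And>x. x \<in> I - \<AA> \<Longrightarrow> ((\<lambda>\<eta>. \<integral> t. poisson_kernel \<eta> (x - t) \<partial>\<mu>) \<longlongrightarrow> u x) (at_right 0)"
    and F: "F \<in> borel_measurable borel" "bounded (range F)"
  shows "set_integrable lebesgue I (\<lambda>x. F x * of_real (u x))"
    and "(\<integral> x. indicator I x *\<^sub>R F x \<partial>\<mu>) = (LINT x:I|lebesgue. F x * of_real (u x))"
proof -
  interpret finite_measure \<mu> by fact
  have S [measurable_cong]: "sets \<mu> = sets borel" by fact
  note assms(3)[measurable] F(1)[measurable]
  \<comment> \<open>Outside \<open>I\<close> the measure may be singular; Radon-Nikodym applies to
    its restriction to \<open>I\<close>.\<close>
  define N where "N = density \<mu> (indicator I)"
  have N_sets [measurable_cong]: "sets N = sets borel" by (simp add: N_def S)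
  have N_em: "emeasure N J = emeasure \<mu> (I \<inter> J)" if "J \<in> sets borel" for J :: "real set"
    using that by (simp add: N_def emeasure_density indicator_inter_arith[symmetric] S)
  have "absolutely_continuous lborel N"
    unfolding absolutely_continuous_def
  proof
    fix J :: "real set" assume J: "J \<in> null_sets lborel"
    then have "I \<inter> J \<in> null_sets lborel" by (intro null_set_Int1) auto
    then show "J \<in> null_sets N"
      using ac[of "I \<inter> J"] N_em[of J] J by (auto simp: null_sets_def N_sets)
  qed
  then obtain f where f [measurable]: "f \<in> borel_measurable borel" and fN: "density lborel f = N"
    using sigma_finite_measure.Radon_Nikodym[OF lborel.sigma_finite_measure_axioms, of N] N_sets by auto
  have N_fin: "emeasure N UNIV < \<infinity>"
    using N_em[of UNIV] by (simp add: less_top[symmetric])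
  have f_fin: "AE x in lborel. f x \<noteq> \<infinity>"
    using N_fin unfolding fN[symmetric] by (intro nn_integral_PInf_AE) (auto simp: emeasure_density)
  define f' where "f' x = enn2real (f x)" for x
  have [measurable]: "f' \<in> borel_measurable borel" unfolding f'_def by measurable
  have ff': "AE x in lborel. f x = ennreal (f' x)"
    using f_fin by (rule AE_mp) (auto simp: f'_def less_top)
  have f'0: "f' x \<ge> 0" for x by (simp add: f'_def)
  have Nf': "N = density lborel (\<lambda>x. ennreal (f' x))"
    unfolding fN[symmetric] using ff' by (intro density_cong) auto
  have "AE x in lebesgue. x \<in> I \<longrightarrow> f x = ennreal (u x)"
  proof (rule poisson_limit_eq_density[OF assms(1-4) f _ lim])
    fix J assume "J \<in> sets borel" "J \<subseteq> I"
    then show "emeasure \<mu> J = (\<integral>\<^sup>+ x \<in> J. f x \<partial>lborel)"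
      using N_em[of J] unfolding fN[symmetric] by (simp add: emeasure_density Int_absorb1)
  qed
  moreover have "AE x in lebesgue. f x = ennreal (f' x)" by (rule AE_completion[OF ff'])
  moreover have "AE x in lebesgue. x \<notin> \<AA>" using assms(4) by (rule AE_not_in)
  ultimately have uf': "AE x in lebesgue. indicator I x *\<^sub>R (F x * of_real (u x)) = indicator I x *\<^sub>R (f' x *\<^sub>R F x)"
  proof eventually_elim
    case (elim x)
    show ?case
    proof (cases "x \<in> I")
      case True
      \<comment> \<open>\<open>ennreal\<close> sends negative numbers to zero, so the sign of the
        limit is needed before \<open>ennreal (u x)\<close> determines \<open>u x\<close>.\<close>
      have "0 \<le> u x"
      proof (rule tendsto_lowerbound[OF lim])
        show "\<forall>\<^sub>F \<eta> in at_right 0. 0 \<le> (\<integral> t. poisson_kernel \<eta> (x - t) \<partial>\<mu>)"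
          using eventually_at_right_less[of 0]
          by eventually_elim (auto intro!: integral_nonneg_AE simp: poisson_kernel_nonneg)
      qed (use True elim in auto)
      then have "u x = f' x" using True elim f'0[of x] by simp
      then show ?thesis by (simp add: scaleR_conv_of_real)
    qed simp
  qed
  obtain C where C: "\<And>x. norm (F x) \<le> C" using F(2) by (auto simp: bounded_iff)
  have iN: "integrable N (\<lambda>x. indicator I x *\<^sub>R F x)"
  proof -
    have "space N = UNIV" using sets_eq_imp_space_eq[OF N_sets] by simp
    then interpret N: finite_measure N using N_fin by (intro finite_measureI) auto
    show ?thesis
      by (intro N.integrable_const_bound[where B = C])
         (use C order_trans[OF norm_ge_zero C] in \<open>auto simp: indicator_def intro!: AE_I2\<close>)
  qed
  then have iL: "integrable lborel (\<lambda>x. f' x *\<^sub>R (indicator I x *\<^sub>R F x))"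
    unfolding Nf' by (subst (asm) integrable_density) (auto simp: f'0)
  then have iL: "integrable lebesgue (\<lambda>x. indicator I x *\<^sub>R (f' x *\<^sub>R F x))"
    by (simp add: integrable_completion mult.commute)
  have meas: "(\<lambda>x. indicator I x *\<^sub>R (F x * of_real (u x))) \<in> borel_measurable lebesgue"
    by (rule borel_measurable_lebesgue_cong_AE[OF _ uf']) (use iL in auto)
  show "set_integrable lebesgue I (\<lambda>x. F x * of_real (u x))"
    unfolding set_integrable_def
    using iL uf' meas by (subst integrable_cong_AE[where g = "\<lambda>x. indicator I x *\<^sub>R (f' x *\<^sub>R F x)"]) auto
  have "(LINT x:I|lebesgue. F x * of_real (u x)) = (\<integral> x. indicator I x *\<^sub>R (f' x *\<^sub>R F x) \<partial>lebesgue)"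
    unfolding set_lebesgue_integral_def using iL uf' meas by (intro integral_cong_AE) auto
  also have "\<dots> = (\<integral> x. f' x *\<^sub>R (indicator I x *\<^sub>R F x) \<partial>lborel)"
    by (subst integral_completion) (auto simp: mult.commute)
  also have "\<dots> = (\<integral> x. indicator I x *\<^sub>R F x \<partial>N)"
    unfolding Nf' by (subst integral_density) (auto simp: f'0)
  also have "\<dots> = (\<integral> x. indicator I x *\<^sub>R (indicator I x *\<^sub>R F x) \<partial>\<mu>)"
  proof -
    have "N = density \<mu> (\<lambda>x. ennreal (indicator I x))" unfolding N_def by (simp add: ennreal_indicator)
    then show ?thesis by (simp only:) (subst integral_density, auto)
  qed
  also have "\<dots> = (\<integral> x. indicator I x *\<^sub>R F x \<partial>\<mu>)"
    by (intro Bochner_Integration.integral_cong) (auto simp: indicator_def)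
  finally show "(\<integral> x. indicator I x *\<^sub>R F x \<partial>\<mu>) = (LINT x:I|lebesgue. F x * of_real (u x))" ..
qed

section \<open>Arcs in a tree\<close>

text \<open>Loop erasure: when a step returns to a visited vertex, the path is cut back to that
  vertex.\<close>

lemma rtranclp_imp_distinct_path:
  assumes "R\<^sup>*\<^sup>* a b"
  shows "\<exists>p. p \<noteq> [] \<and> successively R p \<and> distinct p \<and> hd p = a \<and> last p = b"
  using assms
proof induction
  case base
  show ?case by (rule exI[of _ "[a]"]) auto
next
  case (step b c)
  then obtain p where p: "p \<noteq> []" "successively R p" "distinct p" "hd p = a" "last p = b" by blast
  show ?case
  proof (cases "c \<in> set p")
    case True
    then obtain q r where qr: "p = q @ c # r" by (meson split_list)
    have "successively R (q @ [c])" using p(2) unfolding qr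
      by (auto simp: successively_append_iff)
    then show ?thesis using p unfolding qr
      by (intro exI[of _ "q @ [c]"]) (auto simp: hd_append)
  next
    case False
    then show ?thesis using p step
      by (intro exI[of _ "p @ [c]"]) (auto simp: successively_append_iff hd_append)
  qed
qed

lemma is_arc_single [simp]: "is_arc adj [v]"
  by (simp add: is_arc_def)

lemma is_arc_pair [simp]: "is_arc adj [v, w] \<longleftrightarrow> adj v w"
  by (simp add: is_arc_def)

lemma is_arc_Cons3 [simp]:
  "is_arc adj (a # b # c # q) \<longleftrightarrow> adj a b \<and> a \<noteq> c \<and> is_arc adj (b # c # q)"
proof -
  have "(\<forall>k. k + 2 < length (a # b # c # q) \<longrightarrow> (a # b # c # q) ! k \<noteq> (a # b # c # q) ! (k + 2)) \<longleftrightarrow>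
      a \<noteq> c \<and> (\<forall>k. k + 2 < length (b # c # q) \<longrightarrow> (b # c # q) ! k \<noteq> (b # c # q) ! (k + 2))"
    (is "(\<forall>k. ?P k) \<longleftrightarrow> _ \<and> (\<forall>k. ?Q k)")
  proof -
    have "(\<forall>k. ?P k) \<longleftrightarrow> ?P 0 \<and> (\<forall>k. ?P (Suc k))"
      using not0_implies_Suc by (intro iffI conjI allI) (blast, blast, metis)
    moreover have "?P 0 \<longleftrightarrow> a \<noteq> c" by simp
    moreover have "?P (Suc k) \<longleftrightarrow> ?Q k" for k by simp
    ultimately show ?thesis by simp
  qed
  then show ?thesis unfolding is_arc_def by auto
qed

lemma is_arc_appendD1: "is_arc adj (p @ q) \<Longrightarrow> p \<noteq> [] \<Longrightarrow> is_arc adj p"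
proof -
  assume a: "is_arc adj (p @ q)" "p \<noteq> []"
  have "p ! k \<noteq> p ! (k + 2)" if "k + 2 < length p" for k
  proof -
    have "(p @ q) ! k \<noteq> (p @ q) ! (k + 2)" using a(1) that by (auto simp: is_arc_def)
    then show ?thesis using that by (simp add: nth_append)
  qed
  then show ?thesis using a by (auto simp: is_arc_def successively_append_iff)
qed

lemma is_arc_appendD2: "is_arc adj (p @ q) \<Longrightarrow> q \<noteq> [] \<Longrightarrow> is_arc adj q"
proof -
  assume a: "is_arc adj (p @ q)" "q \<noteq> []"
  have "q ! k \<noteq> q ! (k + 2)" if "k + 2 < length q" for k
  proof -
    have "\<forall>k. k + 2 < length (p @ q) \<longrightarrow> (p @ q) ! k \<noteq> (p @ q) ! (k + 2)"
      using a(1) unfolding is_arc_def by blast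
    from this[rule_format, of "length p + k"] that show ?thesis by (simp add: nth_append)
  qed
  then show ?thesis using a by (auto simp: is_arc_def successively_append_iff)
qed

text \<open>Absence of backtracking is a condition on three consecutive vertices, so at the junction
  \<open>c\<close> only \<open>a\<close> and \<open>b\<close> have to be compared.\<close>

lemma is_arc_join:
  assumes "is_arc adj (p @ [a, c])" "is_arc adj (c # b # q)" "a \<noteq> b"
  shows "is_arc adj (p @ a # c # b # q)"
  using assms(1)
proof (induction p)
  case Nil
  then show ?case using assms by simp
next
  case (Cons x p)
  show ?case
  proof (cases p)
    case Nil
    then show ?thesis using Cons assms by simp
  next
    case (Cons y p')
    then show ?thesis using Cons.IH Cons.prems by (cases p') auto
  qed
qed

section \<open>Branches and uniqueness of arcs\<close>

locale tree =
  fixes adj :: "'v \<Rightarrow> 'v \<Rightarrow> bool"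
  assumes is_tree: "is_tree adj"
begin

lemma adj_sym: "adj v w \<Longrightarrow> adj w v"
  using is_tree by (auto simp: is_tree_def dest: sympD)

lemma adj_commute: "adj v w \<longleftrightarrow> adj w v"
  using adj_sym by blast

lemma not_adj_self [simp]: "\<not> adj v v"
  using is_tree by (auto simp: is_tree_def dest: irreflpD)

lemma connected: "adj\<^sup>*\<^sup>* v w"
  using is_tree by (auto simp: is_tree_def)

text \<open>\<open>branch x y\<close> is the component of \<open>x\<close> once the edge between \<open>x\<close> and \<open>y\<close> is cut; acyclicity is
  used only through the fact that it does not contain \<open>y\<close>.\<close>

definition cut :: "'v \<Rightarrow> 'v \<Rightarrow> 'v \<Rightarrow> 'v \<Rightarrow> bool" where
  "cut x y u v \<longleftrightarrow> adj u v \<and> \<not> (u = x \<and> v = y) \<and> \<not> (u = y \<and> v = x)"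

definition branch :: "'v \<Rightarrow> 'v \<Rightarrow> 'v set" where
  "branch x y = {u. (cut x y)\<^sup>*\<^sup>* x u}"

lemma cut_commute: "cut x y = cut y x"
  by (auto simp: cut_def fun_eq_iff)

lemma self_in_branch [simp]: "x \<in> branch x y"
  by (simp add: branch_def)

text \<open>A distinct path from \<open>x\<close> to \<open>y\<close> that avoids their common edge
  has at least three vertices, and that edge closes it to a cycle.\<close>

lemma not_in_branch:
  assumes "adj x y" shows "y \<notin> branch x y"
proof
  assume "y \<in> branch x y"
  then obtain p where p: "p \<noteq> []" "successively (cut x y) p" "distinct p" "hd p = x" "last p = y"
    using rtranclp_imp_distinct_path[of "cut x y" x y] unfolding branch_def by auto
  have "x \<noteq> y" using assms by auto
  obtain r where r: "p = x # r" using p by (cases p) auto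
  have "length p \<ge> 3"
  proof (cases r)
    case Nil
    then show ?thesis using p r \<open>x \<noteq> y\<close> by simp
  next
    case (Cons b q)
    then show ?thesis using p r by (cases q) (auto simp: cut_def)
  qed
  moreover have "successively adj p" using p(2) by (rule successively_mono) (auto simp: cut_def)
  ultimately have "is_cycle adj p" using p adj_sym[OF assms] by (simp add: is_cycle_def)
  then show False using is_tree by (auto simp: is_tree_def)
qed

lemma branch_disjoint:
  assumes "adj x y" "u \<in> branch x y" shows "u \<notin> branch y x"
proof
  assume "u \<in> branch y x"
  moreover have "symp (cut x y)" by (auto simp: symp_def cut_def adj_commute)
  ultimately have "(cut x y)\<^sup>*\<^sup>* u y"
    using cut_commute[of x y] by (auto simp: branch_def dest: sympD[OF symp_rtranclp])
  moreover have "(cut x y)\<^sup>*\<^sup>* x u" using assms by (simp add: branch_def)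
  ultimately have "(cut x y)\<^sup>*\<^sup>* x y" by simp
  then show False using assms not_in_branch[of x y] by (simp add: branch_def)
qed

text \<open>A walk inside \<open>branch x2 x1\<close> never visits \<open>x1\<close>, hence never
  crosses the edge between \<open>x1\<close> and \<open>x0\<close>; it can be preceded by the step
  from \<open>x1\<close> to \<open>x2\<close>.\<close>

lemma branch_mono:
  assumes "adj x0 x1" "adj x1 x2" "x0 \<noteq> x2"
  shows "branch x2 x1 \<subseteq> branch x1 x0"
proof
  fix u assume "u \<in> branch x2 x1"
  then have "(cut x2 x1)\<^sup>*\<^sup>* x2 u" by (simp add: branch_def)
  then have "u \<in> branch x1 x0 \<and> u \<in> branch x2 x1"
  proof induction
    case base
    have "cut x1 x0 x1 x2" using assms by (auto simp: cut_def)
    then show ?case by (auto simp: branch_def)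
  next
    case (step u v)
    then have v: "v \<in> branch x2 x1" by (auto simp: branch_def)
    have "x1 \<notin> branch x2 x1" using assms not_in_branch adj_sym by blast
    then have "cut x1 x0 u v" using step v by (auto simp: cut_def)
    then show ?case using step v by (auto simp: branch_def)
  qed
  then show "u \<in> branch x1 x0" by simp
qed

lemma is_arc_adj: "is_arc adj (a # b # q) \<Longrightarrow> adj a b"
  by (simp add: is_arc_def)

lemma arc_subset_branch:
  "is_arc adj (a # b # q) \<Longrightarrow> set (b # q) \<subseteq> branch b a"
proof (induction q arbitrary: a b)
  case (Cons c q)
  then have "adj a b" "a \<noteq> c" and bc: "is_arc adj (b # c # q)" by auto
  moreover have "set (c # q) \<subseteq> branch c b" by (rule Cons.IH[OF bc])
  moreover have "adj b c" using bc by (rule is_arc_adj)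
  ultimately show ?case using branch_mono[of a b c] by auto
qed simp

lemma is_arc_ConsD: "is_arc adj (a # b # q) \<Longrightarrow> is_arc adj (b # q)"
  using is_arc_appendD2[of adj "[a]" "b # q"] by simp

text \<open>Arcs that leave the common start through different neighbours end in disjoint branches,
  so a common end forces the first steps to agree.\<close>

lemma arc_unique:
  "is_arc adj p \<Longrightarrow> is_arc adj q \<Longrightarrow> hd p = hd q \<Longrightarrow> last p = last q \<Longrightarrow> p = q"
proof (induction p arbitrary: q)
  case (Cons a p)
  \<comment> \<open>Excludes that one of the two arcs is a single vertex while the other is
    longer.\<close>
  have closed: "last (b # r) \<noteq> a" if "is_arc adj (a # b # r)" for b r
  proof -
    have "last (b # r) \<in> branch b a" using arc_subset_branch[OF that] last_in_set[of "b # r"] by auto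
    then show ?thesis using not_in_branch[OF adj_sym[OF is_arc_adj[OF that]]] by auto
  qed
  obtain q' where q': "q = a # q'" using Cons.prems by (cases q) (auto simp: is_arc_def)
  show ?case
  proof (cases p)
    case Nil
    then show ?thesis using Cons.prems closed unfolding q' by (cases q') auto
  next
    case p: (Cons b r)
    then obtain b' r' where r': "q' = b' # r'"
      using Cons.prems closed unfolding q' by (cases q') auto
    have P: "is_arc adj (a # b # r)" and Q: "is_arc adj (a # b' # r')"
      using Cons.prems unfolding p q' r' by auto
    have "b = b'"
    proof (rule ccontr)
      assume "b \<noteq> b'"
      have "last q \<in> branch b a" using arc_subset_branch[OF P] Cons.prems p last_in_set[of "b # r"] by auto
      moreover have "last q \<in> branch b' a"
        using arc_subset_branch[OF Q] last_in_set[of "b' # r'"] q' r' by auto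
      then have "last q \<in> branch a b"
        using branch_mono[of b a b'] \<open>b \<noteq> b'\<close> is_arc_adj[OF P] is_arc_adj[OF Q] adj_sym by blast
      ultimately show False using branch_disjoint[OF is_arc_adj[OF P]] by auto
    qed
    then have "b # r = b' # r'"
      using Cons.IH[of "b' # r'"] Cons.prems is_arc_ConsD[OF P] is_arc_ConsD[OF Q] p q' r' by auto
    then show ?thesis using p q' r' by simp
  qed
qed (simp add: is_arc_def)

lemma arc_exists: "\<exists>p. is_arc adj p \<and> hd p = v \<and> last p = w"
proof -
  obtain p where p: "p \<noteq> []" "successively adj p" "distinct p" "hd p = v" "last p = w"
    using rtranclp_imp_distinct_path[OF connected[of v w]] by auto
  have "p ! k \<noteq> p ! (k + 2)" if "k + 2 < length p" for k
    using p(3) that by (auto simp: distinct_conv_nth)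
  then show ?thesis using p by (auto simp: is_arc_def)
qed

abbreviation arc :: "'v \<Rightarrow> 'v \<Rightarrow> 'v list" where "arc \<equiv> arc_between adj"

lemma arc_eqI: "is_arc adj p \<Longrightarrow> hd p = v \<Longrightarrow> last p = w \<Longrightarrow> arc v w = p"
  unfolding arc_between_def
proof (rule the_equality)
  fix q assume "is_arc adj p" "hd p = v" "last p = w" "is_arc adj q \<and> hd q = v \<and> last q = w"
  then show "q = p" using arc_unique[of q p] by simp
qed simp

lemma is_arc_arc: "is_arc adj (arc v w)" and hd_arc [simp]: "hd (arc v w) = v"
  and last_arc [simp]: "last (arc v w) = w"
proof -
  obtain p where "is_arc adj p \<and> hd p = v \<and> last p = w" using arc_exists by blast
  then show "is_arc adj (arc v w)" "hd (arc v w) = v" "last (arc v w) = w"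
    using arc_eqI[of p v w] by auto
qed

lemma arc_nonempty [simp]: "arc v w \<noteq> []"
  using is_arc_arc[of v w] by (auto simp: is_arc_def)

lemma arc_self [simp]: "arc v v = [v]"
  by (rule arc_eqI) auto

lemma arc_adj: "adj v w \<Longrightarrow> arc v w = [v, w]"
  by (rule arc_eqI) auto

lemma arc_snoc: obtains p where "arc v w = p @ [w]"
  using append_butlast_last_id[OF arc_nonempty[of v w]] that[of "butlast (arc v w)"] by simp

text \<open>The alternative is decided by the penultimate vertex of the arc to \<open>u\<close>: if
  it is \<open>w\<close>, the last step is undone; if not, appending \<open>w\<close> does not
  backtrack.\<close>

lemma arc_step:
  assumes "adj u w"
  shows "arc v w = arc v u @ [w] \<or> arc v u = arc v w @ [u]"
proof -
  consider "arc v u = [u]" | p x where "arc v u = p @ [x, u]"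
  proof -
    obtain q where q: "arc v u = q @ [u]" by (rule arc_snoc)
    show ?thesis
    proof (cases q rule: rev_cases)
      case Nil
      then show ?thesis using q that(1) by simp
    next
      case (snoc p x)
      then show ?thesis using q that(2)[of p x] by simp
    qed
  qed
  then show ?thesis
  proof cases
    case 1
    then have "v = u" using hd_arc[of v u] by simp
    then show ?thesis using assms by (simp add: arc_adj)
  next
    case (2 p x)
    have A: "is_arc adj (p @ [x, u])" and h: "hd (p @ [x, u]) = v"
      using is_arc_arc[of v u] hd_arc[of v u] 2 by auto
    show ?thesis
    proof (cases "x = w")
      case True
      have "is_arc adj (p @ [w])" using is_arc_appendD1[of adj "p @ [x]" "[u]"] A True by simp
      then have "arc v w = p @ [w]" using h True by (intro arc_eqI) (auto simp: hd_append)
      then show ?thesis using 2 True by simp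
    next
      case False
      have "is_arc adj (p @ [x, u, w])" using is_arc_join[OF A, of w "[]"] assms False by simp
      then have "arc v w = p @ [x, u, w]" using h by (intro arc_eqI) (auto simp: hd_append)
      then show ?thesis using 2 by simp
    qed
  qed
qed

text \<open>The arc itself is a walk of this length. Conversely, by \<open>arc_step\<close> each
  step of a walk lengthens the arc to its current vertex by at most one.\<close>

lemma gdist_eq: "gdist adj v w = length (arc v w) - 1"
  unfolding gdist_def
proof (rule Least_equality)
  have "(adj ^^ (length p - 1)) (hd p) (last p)" if "is_arc adj p" for p
    using that
  proof (induction p)
    case (Cons a p)
    show ?case
    proof (cases p)
      case Nil
      then show ?thesis by simp
    next
      case p: (Cons b q)
      have "(adj ^^ (length p - 1)) b (last p)" using Cons.IH is_arc_ConsD[of a b q] Cons.prems p by auto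
      then have "(adj ^^ Suc (length p - 1)) a (last p)"
        using is_arc_adj[of a b q] Cons.prems p by (intro relpowp_Suc_I2) auto
      then show ?thesis using p by simp
    qed
  qed (simp add: is_arc_def)
  from this[OF is_arc_arc[of v w]] show "(adj ^^ (length (arc v w) - 1)) v w" by simp
next
  fix m assume "(adj ^^ m) v w"
  then show "length (arc v w) - 1 \<le> m"
  proof (induction m arbitrary: w)
    case (Suc m)
    then obtain u where "(adj ^^ m) v u" "adj u w" by (auto elim: relpowp_Suc_E)
    then show ?case using Suc.IH[of u] arc_step[of u w v] by auto
  qed auto
qed

lemma length_arc: "length (arc v w) = Suc (gdist adj v w)"
  unfolding gdist_eq using arc_nonempty[of v w] by (cases "arc v w") auto

lemma gdist_self [simp]: "gdist adj v v = 0"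
  by (simp add: gdist_eq)

lemma gdist_last: "is_arc adj p \<Longrightarrow> gdist adj (hd p) (last p) = length p - 1"
  using arc_eqI[of p] by (simp add: gdist_eq)

lemma gdist_step:
  assumes "adj u w"
  shows "(arc v w = arc v u @ [w] \<and> gdist adj v w = gdist adj v u + 1) \<or>
         (arc v u = arc v w @ [u] \<and> gdist adj v u = gdist adj v w + 1)"
  using arc_step[OF assms, of v] length_arc[of v u] length_arc[of v w] by auto

lemma gdist_arc_nth:
  assumes "i < length (arc v w)"
  shows "gdist adj v (arc v w ! i) = i"
proof -
  have "is_arc adj (take (Suc i) (arc v w))"
    using is_arc_appendD1[of adj "take (Suc i) (arc v w)" "drop (Suc i) (arc v w)"] is_arc_arc[of v w] by simp
  moreover have "hd (take (Suc i) (arc v w)) = v" using assms by (simp add: hd_take)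
  moreover have "last (take (Suc i) (arc v w)) = arc v w ! i" using assms by (simp add: take_Suc_conv_app_nth)
  ultimately show ?thesis using gdist_last[of "take (Suc i) (arc v w)"] assms by simp
qed

section \<open>Truncated trees and balls\<close>

lemma self_in_truncated: "adj v w \<Longrightarrow> v \<in> truncated adj v w"
  by (auto simp: truncated_def)

lemma removed_notin_truncated: "w \<notin> truncated adj v w"
  using last_in_set[OF arc_nonempty[of v w]] by (simp add: truncated_def)

text \<open>Along an edge the arc from \<open>v\<close> gains or loses its last vertex. Hence
  \<open>w\<close> can enter only as the appended vertex \<open>y\<close>, and comparison with the
  arc \<open>[v, w]\<close> identifies \<open>x\<close>.\<close>

lemma truncated_edge:
  assumes "adj v w" "x \<in> truncated adj v w" "adj x y" "y \<notin> truncated adj v w"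
  shows "x = v \<and> y = w"
proof -
  have x: "w \<notin> set (arc v x)" and y: "w \<in> set (arc v y)" using assms by (auto simp: truncated_def)
  then have a: "arc v y = arc v x @ [y]" using arc_step[OF assms(3), of v] by auto
  then have "y = w" using x y by auto
  then have "arc v x @ [w] = [v, w]" using a arc_adj[OF assms(1)] by simp
  then have "arc v x = [v]" by simp
  then show ?thesis using \<open>y = w\<close> last_arc[of v x] by simp
qed

lemma notin_truncated_second: "is_arc adj (x # u # q) \<Longrightarrow> last (u # q) \<notin> truncated adj x u"
  using arc_eqI[of "x # u # q" x] by (simp add: truncated_def)

text \<open>If \<open>v\<close> could be reached from \<open>y\<close> without passing
  \<open>u\<close>, the arc from \<open>r\<close> to \<open>v\<close> would run through
  \<open>u\<close> and \<open>y\<close> and make \<open>v\<close> more distant than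
  \<open>u\<close>. This is what lets \<open>green_zeta\<close> be used across an edge leaving a
  ball for every pole inside the ball.\<close>

lemma ball_notin_truncated:
  assumes "adj u y" "gdist adj r y = gdist adj r u + 1" "gdist adj r v \<le> gdist adj r u"
  shows "v \<notin> truncated adj y u"
proof
  assume v: "v \<in> truncated adj y u"
  have ry: "arc r y = arc r u @ [y]" using gdist_step[OF assms(1), of r] assms(2) by auto
  obtain p where p: "arc r u = p @ [u]" by (rule arc_snoc)
  obtain q where q: "arc y v = y # q" using hd_arc[of y v] by (cases "arc y v") auto
  have "q \<noteq> []" using assms q last_arc[of y v] by auto
  then obtain b q' where b: "q = b # q'" by (cases q) auto
  have "b \<noteq> u" using v q b by (auto simp: truncated_def)
  then have "is_arc adj (p @ u # y # b # q')"
    using is_arc_join[of adj p u y b q'] is_arc_arc[of r y] is_arc_arc[of y v] ry p q b by auto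
  then have "arc r v = p @ u # y # b # q'"
    using hd_arc[of r u] last_arc[of y v] p q b by (intro arc_eqI) (auto simp: hd_append split: if_splits)
  then have "gdist adj r v > length p" by (simp add: gdist_eq)
  moreover have "gdist adj r u = length p" by (simp add: gdist_eq p)
  ultimately show False using assms by simp
qed

lemma finite_ball:
  assumes "bounded_degree adj" shows "finite {u. gdist adj r u \<le> n}"
proof (induction n)
  case 0
  have "u = r" if "gdist adj r u = 0" for u
  proof -
    have "length (arc r u) = 1" using that by (simp add: length_arc)
    then obtain x where "arc r u = [x]" by (auto simp: length_Suc_conv)
    then show ?thesis using hd_arc[of r u] last_arc[of r u] by simp
  qed
  then have "{u. gdist adj r u \<le> 0} \<subseteq> {r}" by auto
  then show ?case by (rule finite_subset) simp
next
  case (Suc n)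
  have "{u. gdist adj r u \<le> Suc n} \<subseteq> {u. gdist adj r u \<le> n} \<union> (\<Union>u\<in>{u. gdist adj r u \<le> n}. {w. adj u w})"
  proof
    fix w assume w: "w \<in> {u. gdist adj r u \<le> Suc n}"
    show "w \<in> {u. gdist adj r u \<le> n} \<union> (\<Union>u\<in>{u. gdist adj r u \<le> n}. {w. adj u w})"
    proof (cases "gdist adj r w = Suc n")
      case True
      then have "length (arc r w) = Suc (Suc n)" by (simp add: length_arc)
      moreover obtain q where q: "arc r w = q @ [w]" by (rule arc_snoc)
      ultimately obtain p u where p: "arc r w = p @ [u, w]" by (cases q rule: rev_cases) auto
      then have "adj u w" using is_arc_arc[of r w] by (auto simp: is_arc_def successively_append_iff)
      moreover have "gdist adj r u = n"
      proof -
        have "is_arc adj (p @ [u])" using is_arc_appendD1[of adj "p @ [u]" "[w]"] is_arc_arc[of r w] p by simp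
        moreover have "hd (p @ [u]) = r" using hd_arc[of r w] p by (simp add: hd_append split: if_splits)
        ultimately have "arc r u = p @ [u]" by (intro arc_eqI) auto
        then show ?thesis using p True by (simp add: gdist_eq)
      qed
      ultimately show ?thesis by auto
    qed (use w in auto)
  qed
  moreover have "finite {w. adj u w}" for u using assms by (auto simp: bounded_degree_def)
  ultimately show ?case using Suc by (auto intro: finite_subset)
qed

end

section \<open>Rays and boundary points\<close>

context tree begin

lemma is_chain_arc:
  assumes "is_chain adj c" "m \<le> n" shows "is_arc adj (map c [m..<Suc n])"
  unfolding is_arc_def
proof (intro conjI allI impI)
  show "successively adj (map c [m..<Suc n])"
    using assms(1) unfolding successively_conv_nth is_chain_def by (auto simp del: upt_Suc)
  fix k assume "k + 2 < length (map c [m..<Suc n])"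
  then show "map c [m..<Suc n] ! k \<noteq> map c [m..<Suc n] ! (k + 2)"
    using assms(1) unfolding is_chain_def by (auto simp del: upt_Suc)
qed (use assms in auto)

lemma tree_boundaryE:
  assumes "\<xi> \<in> tree_boundary adj"
  obtains c0 where "is_chain adj c0"
    "\<And>c. c \<in> \<xi> \<longleftrightarrow> is_chain adj c \<and> (\<exists>m n. \<forall>k. c0 (k + m) = c (k + n))"
proof -
  obtain c0 where "is_chain adj c0" "\<xi> = chain_equiv adj `` {c0}"
    using assms unfolding tree_boundary_def by (auto elim!: quotientE)
  then show ?thesis using that[of c0] by (auto simp: chain_equiv_def)
qed

text \<open>Moving the start across an edge either drops the first vertex of the chain or prepends a
  new one. The tail, and with it the equivalence class, is unchanged, and connectedness reaches
  every start.\<close>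

lemma ray_exists:
  assumes "\<xi> \<in> tree_boundary adj"
  shows "\<exists>c. c \<in> \<xi> \<and> c 0 = v"
proof -
  from assms obtain c0 where c0: "is_chain adj c0"
    "\<And>c. c \<in> \<xi> \<longleftrightarrow> is_chain adj c \<and> (\<exists>m n. \<forall>k. c0 (k + m) = c (k + n))"
    by (rule tree_boundaryE) blast
  show ?thesis using connected[of "c0 0" v]
  proof induction
    case base
    have "c0 \<in> \<xi>" using c0 by auto
    then show ?case by blast
  next
    case (step u w)
    then obtain c where c: "c \<in> \<xi>" "c 0 = u" by blast
    then have "is_chain adj c" and "\<exists>m n. \<forall>k. c0 (k + m) = c (k + n)" using c0(2)[of c] by auto
    then obtain m n where c: "c \<in> \<xi>" "c 0 = u" "is_chain adj c" and t: "\<forall>k. c0 (k + m) = c (k + n)"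
      using c by auto
    show ?case
    proof (cases "c 1 = w")
      case True
      have "is_chain adj (\<lambda>k. c (k + 1))" using c(3) by (auto simp: is_chain_def)
      moreover have "\<forall>k. c0 (k + (m + 1)) = c (k + n + 1)"
        using t[rule_format, of "Suc _"] by simp
      ultimately have "(\<lambda>k. c (k + 1)) \<in> \<xi>" using c0(2) by blast
      then show ?thesis using True by (intro exI[of _ "\<lambda>k. c (k + 1)"]) auto
    next
      case False
      have "is_chain adj (case_nat w c)"
        unfolding is_chain_def
      proof
        fix k show "adj (case_nat w c k) (case_nat w c (k + 1)) \<and> case_nat w c k \<noteq> case_nat w c (k + 2)"
          using c False step.hyps(2) by (cases k) (auto simp: is_chain_def adj_sym)
      qed
      moreover have "\<forall>k. c0 (k + m) = case_nat w c (k + (n + 1))" using t by simp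
      ultimately have "case_nat w c \<in> \<xi>" using c0(2) by blast
      then show ?thesis by (intro exI[of _ "case_nat w c"]) auto
    qed
  qed
qed

lemma ray_unique:
  assumes "\<xi> \<in> tree_boundary adj" "c \<in> \<xi>" "c' \<in> \<xi>" "c 0 = c' 0"
  shows "c = c'"
proof -
  from assms(1) obtain c0 where c0:
    "\<And>c. c \<in> \<xi> \<longleftrightarrow> is_chain adj c \<and> (\<exists>m n. \<forall>k. c0 (k + m) = c (k + n))"
    by (rule tree_boundaryE) blast
  obtain m n where 1: "is_chain adj c" "\<And>k. c0 (k + m) = c (k + n)" using assms c0 by auto
  obtain m' n' where 2: "is_chain adj c'" "\<And>k. c0 (k + m') = c' (k + n')" using assms c0 by auto
  \<comment> \<open>Both shifts refer to the same tail of \<open>c0\<close>, the one that starts at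
    index \<open>m + m'\<close>.\<close>
  have tail: "c (k + (n + m')) = c' (k + (n' + m))" for k
    using 1(2)[of "k + m'"] 2(2)[of "k + m"] by (simp add: ac_simps)
  have eq: "map c [0..<Suc (k + (n + m'))] = map c' [0..<Suc (k + (n' + m))]" for k
  proof (rule arc_unique)
    show "is_arc adj (map c [0..<Suc (k + (n + m'))])" "is_arc adj (map c' [0..<Suc (k + (n' + m))])"
      by (rule is_chain_arc; use 1 2 in simp)+
  next
    show "hd (map c [0..<Suc (k + (n + m'))]) = hd (map c' [0..<Suc (k + (n' + m))])"
      using assms(4) by (simp add: hd_map del: upt_Suc)
  qed (use tail in simp)
  show ?thesis
  proof
    fix k
    have "map c [0..<Suc (k + (n + m'))] ! k = map c' [0..<Suc (k + (n' + m))] ! k"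
      using eq[of k] by simp
    then show "c k = c' k" by (simp del: upt_Suc)
  qed
qed

lemma ray_props:
  assumes "\<xi> \<in> tree_boundary adj"
  shows "ray v \<xi> \<in> \<xi>" "ray v \<xi> 0 = v" "is_chain adj (ray v \<xi>)"
proof -
  obtain c where c: "c \<in> \<xi> \<and> c 0 = v" using ray_exists[OF assms] by blast
  have "ray v \<xi> = c"
    unfolding ray_def
  proof (rule the_equality)
    fix d assume "d \<in> \<xi> \<and> d 0 = v"
    then show "d = c" using ray_unique[OF assms, of d c] c by auto
  qed (rule c)
  then show "ray v \<xi> \<in> \<xi>" "ray v \<xi> 0 = v" using c by auto
  then show "is_chain adj (ray v \<xi>)" using assms by (auto elim: tree_boundaryE)
qed

lemma arc_ray:
  assumes "\<xi> \<in> tree_boundary adj"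
  shows "arc v (ray v \<xi> n) = map (ray v \<xi>) [0..<Suc n]"
proof (rule arc_eqI)
  show "is_arc adj (map (ray v \<xi>) [0..<Suc n])" by (rule is_chain_arc[OF ray_props(3)[OF assms]]) simp
  show "hd (map (ray v \<xi>) [0..<Suc n]) = v" using ray_props(2)[OF assms] by (simp add: hd_map del: upt_Suc)
qed simp

lemma gdist_ray:
  assumes "\<xi> \<in> tree_boundary adj" shows "gdist adj v (ray v \<xi> n) = n"
  by (simp add: gdist_eq arc_ray[OF assms] del: upt_Suc)

lemma adj_ray:
  assumes "\<xi> \<in> tree_boundary adj" shows "adj (ray v \<xi> n) (ray v \<xi> (Suc n))"
  using ray_props(3)[OF assms, of v] by (simp add: is_chain_def)

text \<open>The definition allows the arc to occur anywhere in the ray, but an arc starting at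
  \<open>r\<close> can occur only at index zero because the ray never returns to
  \<open>r\<close>.\<close>

lemma boundary_beyond_iff:
  "\<xi> \<in> boundary_beyond adj r x \<longleftrightarrow> \<xi> \<in> tree_boundary adj \<and> ray r \<xi> (gdist adj r x) = x"
proof -
  have "(\<exists>n. map (ray r \<xi>) [n..<n + length (arc r x)] = arc r x) \<longleftrightarrow> ray r \<xi> (gdist adj r x) = x"
    if xi: "\<xi> \<in> tree_boundary adj"
  proof
    assume "\<exists>n. map (ray r \<xi>) [n..<n + length (arc r x)] = arc r x"
    then obtain n where n: "map (ray r \<xi>) [n..<n + length (arc r x)] = arc r x" ..
    then have e: "map (ray r \<xi>) [n..<Suc (n + gdist adj r x)] = arc r x" by (simp add: length_arc del: upt_Suc)
    have "hd (map (ray r \<xi>) [n..<Suc (n + gdist adj r x)]) = r" using e by simp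
    then have "ray r \<xi> n = r" by (simp add: hd_map del: upt_Suc)
    then have "n = 0" using gdist_ray[OF xi, of r n] by simp
    have "last (map (ray r \<xi>) [n..<Suc (n + gdist adj r x)]) = x" using e by simp
    then show "ray r \<xi> (gdist adj r x) = x" using \<open>n = 0\<close> by simp
  next
    assume "ray r \<xi> (gdist adj r x) = x"
    then have "arc r x = map (ray r \<xi>) [0..<Suc (gdist adj r x)]" using arc_ray[OF xi, of r "gdist adj r x"] by simp
    then show "\<exists>n. map (ray r \<xi>) [n..<n + length (arc r x)] = arc r x"
      by (intro exI[of _ 0]) (simp add: length_arc del: upt_Suc)
  qed
  then show ?thesis by (auto simp: boundary_beyond_def)
qed

text \<open>Beyond the confluent the two arcs share the tail \<open>q\<close>; moving the far end
  from the confluent to \<open>ray r \<xi> n\<close> therefore changes the Green functions from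
  \<open>v\<close> and from \<open>r\<close> by the same factor. The bound on \<open>n\<close> keeps
  the confluent at or before index \<open>n\<close>.\<close>

lemma confluent_arcs:
  assumes xi: "\<xi> \<in> tree_boundary adj" and n: "gdist adj r v \<le> n"
  obtains p q s where
    "is_arc adj (p @ confluent adj r v \<xi> # q)" "hd (p @ [confluent adj r v \<xi>]) = v"
    "is_arc adj (s @ confluent adj r v \<xi> # q)" "hd (s @ [confluent adj r v \<xi>]) = r"
    "last (confluent adj r v \<xi> # q) = ray r \<xi> n"
proof -
  define A where "A = set (arc r v) \<inter> range (ray r \<xi>)"
  define c where "c = confluent adj r v \<xi>"
  have "r \<in> A" using ray_props(2)[OF xi, of r] hd_in_set[OF arc_nonempty[of r v]]
    by (auto simp: A_def intro: range_eqI[of _ _ 0])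
  have fin: "finite (gdist adj r ` A)" by (simp add: A_def)
  have c: "c \<in> A \<and> (\<forall>y\<in>A. gdist adj r y \<le> gdist adj r c)"
  proof -
    have "\<exists>x. is_arg_max (gdist adj r) (\<lambda>u. u \<in> A) x"
    proof -
      obtain x where "x \<in> A" "gdist adj r x = Max (gdist adj r ` A)"
        using Max_in[OF fin] \<open>r \<in> A\<close> by fastforce
      then show ?thesis using Max_ge[OF fin] by (auto simp: is_arg_max_def not_less)
    qed
    then have "is_arg_max (gdist adj r) (\<lambda>u. u \<in> A) c"
      unfolding c_def confluent_def arg_max_def A_def by (rule someI_ex)
    then show ?thesis by (auto simp: is_arg_max_def not_less)
  qed
  define m where "m = gdist adj r c"
  obtain j where j: "arc r v ! j = c" "j < length (arc r v)" using c by (auto simp: A_def in_set_conv_nth)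
  have jm: "j = m" using gdist_arc_nth[OF j(2)] j(1) by (simp add: m_def)
  obtain i where i: "c = ray r \<xi> i" using c by (auto simp: A_def)
  \<comment> \<open>Arc and ray both start at \<open>r\<close> and advance one unit of distance per
    step, so the confluent has the same index in both.\<close>
  have im: "i = m" using gdist_ray[OF xi, of r i] i by (simp add: m_def)
  have mn: "m \<le> n" using j jm n by (simp add: length_arc)
  define s where "s = map (ray r \<xi>) [0..<m]"
  define q where "q = map (ray r \<xi>) [Suc m..<Suc n]"
  define d where "d = drop (Suc m) (arc r v)"
  have ray_split: "map (ray r \<xi>) [0..<Suc n] = s @ c # q"
  proof -
    have "[0..<Suc n] = [0..<m] @ [m..<Suc n]" using mn upt_add_eq_append[of 0 m "Suc n - m"] by simp
    also have "[m..<Suc n] = m # [Suc m..<Suc n]" using mn by (simp add: upt_conv_Cons)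
    finally show ?thesis using i im by (simp add: s_def q_def)
  qed
  have arc_split: "arc r v = take m (arc r v) @ c # d"
    using id_take_nth_drop[OF j(2)] j(1) jm by (simp add: d_def)
  have S: "is_arc adj (s @ c # q)"
    using is_chain_arc[OF ray_props(3)[OF xi, of r], of 0 n] ray_split by simp
  have cq: "is_arc adj (c # q)" using is_arc_appendD2[OF S] by simp
  have cd: "is_arc adj (c # d)" using is_arc_appendD2[of adj "take m (arc r v)" "c # d"] is_arc_arc[of r v] arc_split by simp
  have rev_arc: "is_arc adj (rev l)" if "is_arc adj l" for l
  proof -
    have "rev l ! k \<noteq> rev l ! (k + 2)" if k: "k + 2 < length l" for k
    proof -
      define i where "i = length l - Suc (k + 2)"
      have i: "length l - Suc k = i + 2" "i + 2 < length l" using k by (auto simp: i_def)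
      have "rev l ! k = l ! (i + 2)" using k i by (simp add: rev_nth)
      moreover have "rev l ! (k + 2) = l ! i" using k by (simp add: rev_nth i_def)
      moreover have "l ! i \<noteq> l ! (i + 2)" using \<open>is_arc adj l\<close> i unfolding is_arc_def by blast
      ultimately show ?thesis by simp
    qed
    moreover have "successively adj (rev l)"
      using that unfolding is_arc_def by (auto simp: adj_commute intro: successively_mono)
    ultimately show ?thesis using that by (auto simp: is_arc_def)
  qed
  have P: "is_arc adj (rev d @ c # q)"
  proof (cases "d = [] \<or> q = []")
    case True
    then show ?thesis using cq rev_arc[OF cd] by auto
  next
    case False
    then obtain a d' b q' where dq: "d = a # d'" "q = b # q'" by (cases d; cases q) auto
    \<comment> \<open>If the arc and the ray still agreed one step after \<open>c\<close>, that
      vertex would be a more distant common point.\<close>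
    have "a \<noteq> b"
    proof
      assume "a = b"
      have "q \<noteq> []" "b = hd q" using dq(2) by auto
      then have b: "b = ray r \<xi> (Suc m)" by (simp add: q_def hd_map del: upt_Suc)
      have "set d \<subseteq> set (arc r v)" unfolding d_def by (rule set_drop_subset)
      then have "a \<in> set (arc r v)" using dq(1) by simp
      then have "b \<in> A" using \<open>a = b\<close> b by (auto simp: A_def)
      then show False using c gdist_ray[OF xi, of r "Suc m"] b by (auto simp: m_def)
    qed
    moreover have "is_arc adj (rev d' @ [a, c])" using rev_arc[OF cd] dq by simp
    ultimately show ?thesis using is_arc_join[of adj "rev d'" a c b q'] cq dq by simp
  qed
  have "hd (rev d @ [c]) = v"
  proof -
    have "last (take m (arc r v) @ c # d) = v" by (simp only: arc_split[symmetric] last_arc)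
    then have "last (c # d) = v" by simp
    then show ?thesis by (cases d rule: rev_cases) auto
  qed
  moreover have "hd (s @ [c]) = r"
    using ray_props(2)[OF xi, of r] i im by (cases "m = 0") (auto simp: s_def hd_append hd_map)
  moreover have "last (c # q) = ray r \<xi> n"
  proof -
    have "last (c # q) = last (map (ray r \<xi>) [0..<Suc n])" unfolding ray_split by simp
    then show ?thesis by simp
  qed
  ultimately show ?thesis using that[of "rev d" q s] P S unfolding c_def by blast
qed

end

section \<open>Schroedinger operators and their resolvents on truncated trees\<close>

lemma cnj_mult_self: "cnj z * z = (complex_of_real (cmod z))\<^sup>2"
  using complex_norm_square[of z] by (simp add: mult.commute)

lemma delta_self [simp]: "delta v v = 1"
  by (simp add: delta_def)

lemma delta_eq: "delta v u = (if u = v then 1 else 0)"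
  by (simp add: delta_def)

lemma finite_support_delta: "finite {u. delta v u \<noteq> 0}"
  by (simp add: delta_def)

lemma l2_lincomb:
  assumes "\<phi> \<in> l2" "\<psi> \<in> l2"
  shows "(\<lambda>v. a * \<phi> v + b * \<psi> v) \<in> l2"
proof -
  have "(\<lambda>v. 2 * (norm a)\<^sup>2 * (norm (\<phi> v))\<^sup>2 + 2 * (norm b)\<^sup>2 * (norm (\<psi> v))\<^sup>2) summable_on UNIV"
    using assms by (intro summable_on_add summable_on_cmult_right) (auto simp: l2_def)
  then have "(\<lambda>v. (norm (a * \<phi> v + b * \<psi> v))\<^sup>2) summable_on UNIV"
  proof (rule summable_on_comparison_test)
    fix v
    have "(norm (a * \<phi> v + b * \<psi> v))\<^sup>2 \<le> (norm (a * \<phi> v) + norm (b * \<psi> v))\<^sup>2"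
      by (intro power_mono norm_triangle_ineq) auto
    also have "\<dots> \<le> 2 * (norm (a * \<phi> v))\<^sup>2 + 2 * (norm (b * \<psi> v))\<^sup>2"
      using sum_squares_bound[of "norm (a * \<phi> v)" "norm (b * \<psi> v)"] by (simp add: power2_sum)
    finally show "(norm (a * \<phi> v + b * \<psi> v))\<^sup>2
        \<le> 2 * (norm a)\<^sup>2 * (norm (\<phi> v))\<^sup>2 + 2 * (norm b)\<^sup>2 * (norm (\<psi> v))\<^sup>2"
      by (simp add: norm_mult power_mult_distrib)
  qed auto
  then show ?thesis by (simp add: l2_def)
qed

lemma l2_cmult: "\<phi> \<in> l2 \<Longrightarrow> (\<lambda>v. a * \<phi> v) \<in> l2"
  using l2_lincomb[of \<phi> \<phi> a 0] by simp

lemma l2_restrict: "\<phi> \<in> l2 \<Longrightarrow> (\<lambda>v. if v \<in> S then \<phi> v else 0) \<in> l2"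
  unfolding l2_def mem_Collect_eq by (erule summable_on_comparison_test) auto

lemma finite_support_l2:
  assumes "finite {v. f v \<noteq> 0}" shows "f \<in> l2"
proof -
  have "(\<lambda>v. (norm (f v))\<^sup>2) summable_on {v. f v \<noteq> 0}" using assms by simp
  then have "(\<lambda>v. (norm (f v))\<^sup>2) summable_on UNIV"
    by (subst (asm) summable_on_cong_neutral[where T = UNIV and g = "\<lambda>v. (norm (f v))\<^sup>2"]) auto
  then show ?thesis by (simp add: l2_def)
qed

lemma delta_l2 [simp]: "delta v \<in> l2"
  by (intro finite_support_l2 finite_support_delta)

lemma norm_le_l2_norm:
  assumes "\<psi> \<in> l2" shows "norm (\<psi> v) \<le> l2_norm \<psi>"
proof -
  have "sum (\<lambda>v. (norm (\<psi> v))\<^sup>2) {v} \<le> (\<Sum>\<^sub>\<infinity>v. (norm (\<psi> v))\<^sup>2)"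
    using assms by (intro finite_sum_le_infsum) (auto simp: l2_def)
  then show ?thesis unfolding l2_norm_def by (intro real_le_rsqrt) simp
qed

lemma l2_inner_finite:
  assumes "finite A" "\<And>v. v \<notin> A \<Longrightarrow> f v = 0 \<or> g v = 0"
  shows "l2_inner f g = (\<Sum>v\<in>A. cnj (f v) * g v)"
proof -
  have "l2_inner f g = (\<Sum>\<^sub>\<infinity>v\<in>A. cnj (f v) * g v)"
    unfolding l2_inner_def using assms(2) by (intro infsum_cong_neutral) auto
  then show ?thesis using assms(1) by simp
qed

lemma l2_inner_delta_left [simp]: "l2_inner (delta u) \<psi> = \<psi> u"
  by (subst l2_inner_finite[of "{u}"]) (auto simp: delta_def)

lemma l2_inner_delta_right [simp]: "l2_inner \<psi> (delta u) = cnj (\<psi> u)"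
  by (subst l2_inner_finite[of "{u}"]) (auto simp: delta_def)

lemma infsum_antisymmetric:
  fixes k :: "'a \<times> 'a \<Rightarrow> real"
  assumes "\<And>v w. (v, w) \<in> E \<Longrightarrow> (w, v) \<in> E" "\<And>v w. k (v, w) = - k (w, v)"
  shows "infsum k E = 0"
proof -
  have "bij_betw prod.swap E E"
    using assms(1) by (intro bij_betwI[where g = prod.swap]) auto
  then have "infsum k E = infsum (\<lambda>x. k (prod.swap x)) E"
    by (rule infsum_reindex_bij_betw[symmetric])
  also have "\<dots> = infsum (\<lambda>x. - k x) E"
    using assms(2) by (intro infsum_cong) (metis prod.collapse swap_simp)
  finally show ?thesis by (simp add: infsum_uminus)
qed

lemma schr_lincomb:
  "schr adj V S (\<lambda>v. a * \<phi> v + b * \<psi> v) u = a * schr adj V S \<phi> u + b * schr adj V S \<psi> u"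
  by (simp add: schr_def sum.distrib sum_distrib_left algebra_simps)

locale schroedinger = tree adj for adj :: "'v \<Rightarrow> 'v \<Rightarrow> bool" +
  fixes V :: "'v \<Rightarrow> real"
  assumes bounded_degree: "bounded_degree adj"
begin

lemma finite_nbrs [simp]: "finite {w. adj v w}" "finite {w. adj v w \<and> P w}"
proof -
  show "finite {w. adj v w}" using bounded_degree by (auto simp: bounded_degree_def)
  then show "finite {w. adj v w \<and> P w}" by (rule rev_finite_subset) auto
qed

text \<open>Uniformly bounded degree: each vertex is counted at most \<open>D\<close> times.\<close>

lemma summable_edges_fst:
  fixes f :: "'v \<Rightarrow> real"
  assumes "f summable_on UNIV" "\<And>v. f v \<ge> 0"
  shows "(\<lambda>(v, w). f v) summable_on Sigma UNIV (\<lambda>v. {w. adj v w})"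
proof -
  obtain D where D: "\<And>v. card {w. adj v w} \<le> D" using bounded_degree by (auto simp: bounded_degree_def)
  show ?thesis
  proof (rule summable_on_SigmaI)
    show "((\<lambda>w. case (v, w) of (v, w) \<Rightarrow> f v) has_sum (real (card {w. adj v w}) * f v)) {w. adj v w}" for v
      by (rule has_sum_finiteI) auto
    have "(\<lambda>v. real D * f v) summable_on UNIV" using assms(1) by (rule summable_on_cmult_right)
    then show "(\<lambda>v. real (card {w. adj v w}) * f v) summable_on UNIV"
      by (rule summable_on_comparison_test) (use D assms(2) in \<open>auto intro: mult_right_mono\<close>)
  qed (use assms(2) in auto)
qed

lemma summable_edges_snd:
  fixes f :: "'v \<Rightarrow> real"
  assumes "f summable_on UNIV" "\<And>v. f v \<ge> 0"
  shows "(\<lambda>(v, w). f w) summable_on Sigma UNIV (\<lambda>v. {w. adj v w})"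
proof -
  have "bij_betw prod.swap (Sigma UNIV (\<lambda>v. {w. adj v w})) (Sigma UNIV (\<lambda>v. {w. adj v w}))"
    by (intro bij_betwI[where g = prod.swap]) (auto simp: adj_commute)
  from summable_on_reindex_bij_betw[OF this, of "\<lambda>(v, w). f v"] summable_edges_fst[OF assms]
  have "(\<lambda>x. case prod.swap x of (v, w) \<Rightarrow> f v) summable_on Sigma UNIV (\<lambda>v. {w. adj v w})" by blast
  moreover have "(\<lambda>x. case prod.swap x of (v, w) \<Rightarrow> f v) = (\<lambda>(v, w). f w)" by auto
  ultimately show ?thesis by simp
qed

text \<open>Symmetry of the operator, for vectors that need not lie in its domain. The potential
  contributes real terms whose sum may diverge, which is why the imaginary part is taken termwise;
  the hopping terms are absolutely summable over edges and cancel in pairs under reversal.\<close>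

lemma infsum_schr_im:
  assumes "\<psi> \<in> l2"
  shows "(\<Sum>\<^sub>\<infinity>v. Im (cnj (\<psi> v) * schr adj V S \<psi> v)) = 0"
proof -
  define N where "N v = {w. adj v w \<and> w \<in> S}" for v
  define k where "k = (\<lambda>(v, w). Im (cnj (\<psi> v) * \<psi> w))"
  have sq: "(\<lambda>v. (norm (\<psi> v))\<^sup>2) summable_on UNIV" using assms by (simp add: l2_def)
  have "(\<lambda>x. (case x of (v, w) \<Rightarrow> (norm (\<psi> v))\<^sup>2) + (case x of (v, w) \<Rightarrow> (norm (\<psi> w))\<^sup>2)) summable_on Sigma UNIV (\<lambda>v. {w. adj v w})"
    by (intro summable_on_add summable_edges_fst[OF sq] summable_edges_snd[OF sq]) auto
  then have "(\<lambda>x. norm (k x)) summable_on Sigma UNIV (\<lambda>v. {w. adj v w})"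
  proof (rule summable_on_comparison_test)
    fix x
    have "norm (Im (cnj (\<psi> v) * \<psi> w)) \<le> (norm (\<psi> v))\<^sup>2 + (norm (\<psi> w))\<^sup>2" for v w
    proof -
      have "norm (Im (cnj (\<psi> v) * \<psi> w)) \<le> norm (\<psi> v) * norm (\<psi> w)"
        using abs_Im_le_cmod[of "cnj (\<psi> v) * \<psi> w"] by (simp add: norm_mult)
      also have "\<dots> \<le> (norm (\<psi> v))\<^sup>2 + (norm (\<psi> w))\<^sup>2"
        using sum_squares_bound[of "norm (\<psi> v)" "norm (\<psi> w)"]
          mult_nonneg_nonneg[OF norm_ge_zero[of "\<psi> v"] norm_ge_zero[of "\<psi> w"]] by linarith
      finally show ?thesis .
    qed
    then show "norm (k x) \<le> (case x of (v, w) \<Rightarrow> (norm (\<psi> v))\<^sup>2) + (case x of (v, w) \<Rightarrow> (norm (\<psi> w))\<^sup>2)"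
      by (cases x) (simp add: k_def)
  qed auto
  then have "k summable_on Sigma UNIV (\<lambda>v. {w. adj v w})" by (rule abs_summable_summable)
  then have ks: "k summable_on Sigma S N"
    by (rule summable_on_subset_banach) (auto simp: N_def)
  have "(\<Sum>\<^sub>\<infinity>v. Im (cnj (\<psi> v) * schr adj V S \<psi> v)) = (\<Sum>\<^sub>\<infinity>v\<in>S. \<Sum>\<^sub>\<infinity>w\<in>N v. k (v, w))"
  proof (rule infsum_cong_neutral)
    fix v assume "v \<in> UNIV \<inter> S"
    then have "cnj (\<psi> v) * schr adj V S \<psi> v = (\<Sum>w\<in>N v. cnj (\<psi> v) * \<psi> w) + of_real (V v) * (cnj (\<psi> v) * \<psi> v)"
      by (simp add: schr_def N_def distrib_left sum_distrib_left)
    also have "of_real (V v) * (cnj (\<psi> v) * \<psi> v) = of_real (V v * (norm (\<psi> v))\<^sup>2)"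
      by (simp add: cnj_mult_self)
    finally have "cnj (\<psi> v) * schr adj V S \<psi> v = (\<Sum>w\<in>N v. cnj (\<psi> v) * \<psi> w) + of_real (V v * (norm (\<psi> v))\<^sup>2)" .
    then have "Im (cnj (\<psi> v) * schr adj V S \<psi> v) = (\<Sum>w\<in>N v. k (v, w))"
      by (simp add: k_def)
    then show "Im (cnj (\<psi> v) * schr adj V S \<psi> v) = (\<Sum>\<^sub>\<infinity>w\<in>N v. k (v, w))"
      by (simp add: N_def)
  qed (auto simp: schr_def)
  also have "\<dots> = infsum k (Sigma S N)" using ks by (rule infsum_Sigma_banach)
  also have "\<dots> = 0"
    by (rule infsum_antisymmetric) (auto simp: N_def adj_commute k_def)
  finally show ?thesis .
qed

text \<open>Energy identity from pairing the resolvent equation with its solution. A zero source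
  yields uniqueness, and a delta source yields the sign of the imaginary part of a diagonal Green
  function.\<close>

lemma im_inner_resolvent_eq:
  assumes "\<psi> \<in> l2" "finite A" "\<And>v. v \<notin> A \<Longrightarrow> f v = 0"
    and "\<And>v. schr adj V S \<psi> v - \<gamma> * \<psi> v = f v"
  shows "(\<Sum>v\<in>A. Im (cnj (\<psi> v) * f v)) = - Im \<gamma> * (\<Sum>\<^sub>\<infinity>v. (norm (\<psi> v))\<^sup>2)"
proof -
  have sq: "(\<lambda>v. (norm (\<psi> v))\<^sup>2) summable_on UNIV" using assms by (simp add: l2_def)
  have fin: "(\<lambda>v. Im (cnj (\<psi> v) * f v)) summable_on A" using assms(2) by simp
  have "(\<lambda>v. Im (cnj (\<psi> v) * f v)) summable_on UNIV"
    using fin by (subst summable_on_cong_neutral[where S = UNIV and T = A and f = "\<lambda>v. Im (cnj (\<psi> v) * f v)"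
        and g = "\<lambda>v. Im (cnj (\<psi> v) * f v)"]) (auto simp: assms(3))
  then have s: "(\<Sum>\<^sub>\<infinity>v. Im (cnj (\<psi> v) * f v) + Im \<gamma> * (norm (\<psi> v))\<^sup>2)
        = (\<Sum>\<^sub>\<infinity>v. Im (cnj (\<psi> v) * f v)) + (\<Sum>\<^sub>\<infinity>v. Im \<gamma> * (norm (\<psi> v))\<^sup>2)"
    by (intro infsum_add summable_on_cmult_right sq)
  have "Im (cnj (\<psi> v) * schr adj V S \<psi> v) = Im (cnj (\<psi> v) * f v) + Im \<gamma> * (norm (\<psi> v))\<^sup>2" for v
  proof -
    have "schr adj V S \<psi> v = f v + \<gamma> * \<psi> v" using assms(4)[of v] by (simp add: algebra_simps)
    then have "cnj (\<psi> v) * schr adj V S \<psi> v = cnj (\<psi> v) * f v + \<gamma> * of_real ((norm (\<psi> v))\<^sup>2)"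
      by (simp only: complex_norm_square distrib_left mult_ac)
    then show ?thesis by simp
  qed
  then have "0 = (\<Sum>\<^sub>\<infinity>v. Im (cnj (\<psi> v) * f v) + Im \<gamma> * (norm (\<psi> v))\<^sup>2)"
    using infsum_schr_im[OF assms(1), of S] by simp
  moreover have "(\<Sum>\<^sub>\<infinity>v. Im (cnj (\<psi> v) * f v)) = (\<Sum>v\<in>A. Im (cnj (\<psi> v) * f v))"
    using assms(2) by (subst infsum_cong_neutral[where T = A and g = "\<lambda>v. Im (cnj (\<psi> v) * f v)"]) (auto simp: assms(3))
  moreover have "(\<Sum>\<^sub>\<infinity>v. Im \<gamma> * (norm (\<psi> v))\<^sup>2) = Im \<gamma> * (\<Sum>\<^sub>\<infinity>v. (norm (\<psi> v))\<^sup>2)"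
    by (rule infsum_cmult_right) (rule sq)
  ultimately show ?thesis using s by simp
qed

lemma l2_infsum_eq_0D:
  assumes "\<psi> \<in> l2" "(\<Sum>\<^sub>\<infinity>v. (norm (\<psi> v))\<^sup>2) = 0" shows "\<psi> v = 0"
proof -
  have "(\<lambda>v. (norm (\<psi> v))\<^sup>2) summable_on UNIV" using assms(1) by (simp add: l2_def)
  then have "(norm (\<psi> v))\<^sup>2 = 0"
    by (rule nonneg_infsum_le_0D[rotated]) (use assms(2) in auto)
  then show ?thesis by simp
qed

lemma resolvent_eq_unique:
  assumes "\<psi> \<in> l2" "\<phi> \<in> l2" "Im \<gamma> \<noteq> 0"
    and "\<And>v. schr adj V S \<psi> v - \<gamma> * \<psi> v = schr adj V S \<phi> v - \<gamma> * \<phi> v"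
  shows "\<psi> = \<phi>"
proof
  fix v
  define d where "d = (\<lambda>v. 1 * \<psi> v + (- 1) * \<phi> v)"
  have d: "d \<in> l2" unfolding d_def by (intro l2_lincomb assms)
  have "schr adj V S d u - \<gamma> * d u = 0" for u
    unfolding d_def schr_lincomb using assms(4)[of u] by (simp add: algebra_simps)
  then have "0 = - Im \<gamma> * (\<Sum>\<^sub>\<infinity>v. (norm (d v))\<^sup>2)"
    using im_inner_resolvent_eq[OF d, of "{}" "\<lambda>_. 0" S \<gamma>] by simp
  then have "(\<Sum>\<^sub>\<infinity>v. (norm (d v))\<^sup>2) = 0" using assms(3) by simp
  then have "d v = 0" by (rule l2_infsum_eq_0D[OF d])
  then show "\<psi> v = \<phi> v" by (simp add: d_def)
qed

lemma adjacency_l2: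
  assumes "\<psi> \<in> l2" shows "(\<lambda>v. \<Sum>w | adj v w \<and> w \<in> S. \<psi> w) \<in> l2"
proof -
  obtain D where D: "\<And>v. card {w. adj v w} \<le> D" using bounded_degree by (auto simp: bounded_degree_def)
  have sq: "(\<lambda>v. (norm (\<psi> v))\<^sup>2) summable_on UNIV" using assms by (simp add: l2_def)
  have "(\<lambda>v. \<Sum>\<^sub>\<infinity>w\<in>{w. adj v w}. (norm (\<psi> w))\<^sup>2) summable_on UNIV"
    using summable_edges_snd[OF sq] by (intro summable_on_Sigma_banach) auto
  then have "(\<lambda>v. real D * (\<Sum>w | adj v w. (norm (\<psi> w))\<^sup>2)) summable_on UNIV"
    by (intro summable_on_cmult_right) simp
  then have "(\<lambda>v. (norm (\<Sum>w | adj v w \<and> w \<in> S. \<psi> w))\<^sup>2) summable_on UNIV"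
  proof (rule summable_on_comparison_test)
    fix v
    have "(norm (\<Sum>w | adj v w \<and> w \<in> S. \<psi> w))\<^sup>2 \<le> (\<Sum>w | adj v w \<and> w \<in> S. norm (\<psi> w))\<^sup>2"
      by (intro power_mono norm_sum) auto
    also have "\<dots> \<le> (\<Sum>w | adj v w. norm (\<psi> w))\<^sup>2"
      by (intro power_mono sum_mono2 sum_nonneg) auto
    also have "\<dots> \<le> (\<Sum>w | adj v w. (norm (\<psi> w))\<^sup>2) * real (card {w. adj v w})"
      by (rule sum_squared_le_sum_of_squares)
    also have "\<dots> \<le> (\<Sum>w | adj v w. (norm (\<psi> w))\<^sup>2) * real D"
      using D[of v] by (intro mult_left_mono sum_nonneg) auto
    finally show "(norm (\<Sum>w | adj v w \<and> w \<in> S. \<psi> w))\<^sup>2 \<le> real D * (\<Sum>w | adj v w. (norm (\<psi> w))\<^sup>2)"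
      by (simp add: mult.commute)
  qed auto
  then show ?thesis by (simp add: l2_def)
qed

text \<open>The equation expresses \<open>V \<psi>\<close> through \<open>f\<close>,
  \<open>\<psi>\<close> and the adjacency sum, all square-summable.\<close>

lemma resolvent_eq_in_dom:
  assumes "\<psi> \<in> l2" "f \<in> l2" "\<And>v. schr adj V S \<psi> v - \<gamma> * \<psi> v = f v"
  shows "\<psi> \<in> schr_dom V S"
proof -
  have "(\<lambda>v. 1 * (1 * f v + \<gamma> * \<psi> v) + (- 1) * (\<Sum>w | adj v w \<and> w \<in> S. \<psi> w)) \<in> l2"
    by (intro l2_lincomb adjacency_l2 assms)
  from l2_restrict[OF this, of S]
  have "(\<lambda>v. if v \<in> S then of_real (V v) * \<psi> v else 0) \<in> l2"
  proof (rule back_subst[of "\<lambda>f. f \<in> l2"], intro ext)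
    fix v
    show "(if v \<in> S then 1 * (1 * f v + \<gamma> * \<psi> v) + - 1 * (\<Sum>w | adj v w \<and> w \<in> S. \<psi> w) else 0)
        = (if v \<in> S then of_real (V v) * \<psi> v else 0)"
      using assms(3)[of v] by (auto simp: schr_def algebra_simps)
  qed
  then show ?thesis using assms(1) by (simp add: schr_dom_def)
qed

text \<open>The resolvent is encoded by \<open>inv_into\<close>, which is meaningful on the range of
  an injective map; exhibiting a square-summable solution then computes it.\<close>

lemma schr_resolvent_eqI:
  assumes "\<psi> \<in> l2" "f \<in> l2" "Im \<gamma> \<noteq> 0" "\<And>v. schr adj V S \<psi> v - \<gamma> * \<psi> v = f v"
  shows "schr_resolvent adj V S \<gamma> f = \<psi>"
proof -
  have "inj_on (\<lambda>\<psi> v. schr adj V S \<psi> v - \<gamma> * \<psi> v) (schr_dom V S)"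
  proof (rule inj_onI)
    fix \<phi> \<psi> assume *: "\<phi> \<in> schr_dom V S" "\<psi> \<in> schr_dom V S"
      "(\<lambda>v. schr adj V S \<phi> v - \<gamma> * \<phi> v) = (\<lambda>v. schr adj V S \<psi> v - \<gamma> * \<psi> v)"
    then show "\<phi> = \<psi>"
      by (intro resolvent_eq_unique[of \<phi> \<psi> \<gamma> S] assms(3)) (auto simp: schr_dom_def dest: fun_cong)
  qed
  from inv_into_f_f[OF this resolvent_eq_in_dom[OF assms(1,2,4)]] show ?thesis
    unfolding schr_resolvent_def by (simp add: assms(4))
qed

end

section \<open>Green functions\<close>

definition cauchy_kernel :: "complex \<Rightarrow> real \<Rightarrow> complex" where
  "cauchy_kernel \<gamma> x = 1 / (of_real x - \<gamma>)"

lemma bounded_borelI: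
  "F \<in> borel_measurable borel \<Longrightarrow> (\<And>x. norm (F x) \<le> C) \<Longrightarrow> F \<in> bounded_borel"
  by (auto simp: bounded_borel_def bounded_iff)

lemma of_real_minus_neq_0: "Im \<gamma> \<noteq> 0 \<Longrightarrow> complex_of_real x - \<gamma> \<noteq> 0"
  by (auto simp: complex_eq_iff)

lemma norm_cauchy_kernel_le: "Im \<gamma> \<noteq> 0 \<Longrightarrow> norm (cauchy_kernel \<gamma> x) \<le> 1 / \<bar>Im \<gamma>\<bar>"
  using abs_Im_le_cmod[of "of_real x - \<gamma>"]
  by (auto simp: cauchy_kernel_def norm_divide intro!: divide_left_mono mult_pos_pos of_real_minus_neq_0)

lemma cauchy_kernel_bounded_borel: "Im \<gamma> \<noteq> 0 \<Longrightarrow> cauchy_kernel \<gamma> \<in> bounded_borel"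
  by (rule bounded_borelI[OF _ norm_cauchy_kernel_le]) (auto simp: cauchy_kernel_def[abs_def])

lemma const_bounded_borel [simp]: "(\<lambda>x. c) \<in> bounded_borel"
  by (rule bounded_borelI[of _ "norm c"]) auto

lemma mult_bounded_borel:
  assumes "F \<in> bounded_borel" "G \<in> bounded_borel" shows "(\<lambda>x. F x * G x) \<in> bounded_borel"
proof -
  obtain A where A: "\<And>x. norm (F x) \<le> A" using assms(1) by (auto simp: bounded_borel_def bounded_iff)
  obtain B where B: "\<And>x. norm (G x) \<le> B" using assms(2) by (auto simp: bounded_borel_def bounded_iff)
  have "norm (F x * G x) \<le> A * B" for x
    unfolding norm_mult by (intro mult_mono A B order_trans[OF norm_ge_zero A]) auto
  then show ?thesis using assms by (intro bounded_borelI) (auto simp: bounded_borel_def)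
qed

lemma add_bounded_borel:
  assumes "F \<in> bounded_borel" "G \<in> bounded_borel" shows "(\<lambda>x. F x + G x) \<in> bounded_borel"
proof -
  obtain A where A: "\<And>x. norm (F x) \<le> A" using assms(1) by (auto simp: bounded_borel_def bounded_iff)
  obtain B where B: "\<And>x. norm (G x) \<le> B" using assms(2) by (auto simp: bounded_borel_def bounded_iff)
  have "norm (F x + G x) \<le> A + B" for x
    by (rule order_trans[OF norm_triangle_ineq add_mono[OF A B]])
  then show ?thesis using assms by (intro bounded_borelI) (auto simp: bounded_borel_def)
qed

lemma indicator_bounded_borel [simp]: "J \<in> sets borel \<Longrightarrow> indicator J \<in> bounded_borel"
  by (rule bounded_borelI[of _ 1]) (auto simp: indicator_def)

lemma l2_norm_tendsto_pointwise:
  assumes "\<And>n. f n \<in> l2" "g \<in> l2" "(\<lambda>n. l2_norm (\<lambda>v. f n v - g v)) \<longlonglongrightarrow> 0"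
  shows "(\<lambda>n. f n u) \<longlonglongrightarrow> g u"
proof -
  have "norm (f n u - g u) \<le> l2_norm (\<lambda>v. f n v - g v)" for n
    using norm_le_l2_norm[OF l2_lincomb[OF assms(1)[of n] assms(2), of 1 "- 1"], of u] by simp
  then have "(\<lambda>n. f n u - g u) \<longlonglongrightarrow> 0"
    by (intro Lim_null_comparison[OF _ assms(3)] always_eventually) auto
  then show ?thesis by (rule LIM_zero_cancel)
qed

locale spectral = schroedinger adj V for adj :: "'v \<Rightarrow> 'v \<Rightarrow> bool" and V :: "'v \<Rightarrow> real" +
  fixes \<Phi> :: "(real \<Rightarrow> complex) \<Rightarrow> ('v \<Rightarrow> complex) \<Rightarrow> 'v \<Rightarrow> complex"
  assumes calculus: "borel_functional_calculus (schr_dom V UNIV) (schr adj V UNIV) \<Phi>"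
begin

section \<open>The clauses of the functional calculus\<close>

lemma Phi_l2: "F \<in> bounded_borel \<Longrightarrow> \<psi> \<in> l2 \<Longrightarrow> \<Phi> F \<psi> \<in> l2"
  by (rule calculus[unfolded borel_functional_calculus_def, THEN conjunct1, rule_format])

lemma Phi_vec: "F \<in> bounded_borel \<Longrightarrow> \<phi> \<in> l2 \<Longrightarrow> \<psi> \<in> l2 \<Longrightarrow>
    \<Phi> F (\<lambda>v. a * \<phi> v + b * \<psi> v) = (\<lambda>v. a * \<Phi> F \<phi> v + b * \<Phi> F \<psi> v)"
  by (rule calculus[unfolded borel_functional_calculus_def, THEN conjunct2, THEN conjunct1, rule_format])

lemma Phi_fun: "F \<in> bounded_borel \<Longrightarrow> G \<in> bounded_borel \<Longrightarrow> \<psi> \<in> l2 \<Longrightarrow>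
    \<Phi> (\<lambda>x. a * F x + b * G x) \<psi> = (\<lambda>v. a * \<Phi> F \<psi> v + b * \<Phi> G \<psi> v)"
  by (rule calculus[unfolded borel_functional_calculus_def, THEN conjunct2, THEN conjunct2, THEN conjunct1, rule_format])

lemma Phi_mult: "F \<in> bounded_borel \<Longrightarrow> G \<in> bounded_borel \<Longrightarrow> \<psi> \<in> l2 \<Longrightarrow>
    \<Phi> (\<lambda>x. F x * G x) \<psi> = \<Phi> F (\<Phi> G \<psi>)"
  by (rule calculus[unfolded borel_functional_calculus_def, THEN conjunct2, THEN conjunct2, THEN conjunct2, THEN conjunct1, rule_format])

lemma Phi_one: "\<psi> \<in> l2 \<Longrightarrow> \<Phi> (\<lambda>x. 1) \<psi> = \<psi>"
  by (rule calculus[unfolded borel_functional_calculus_def, THEN conjunct2, THEN conjunct2, THEN conjunct2, THEN conjunct2, THEN conjunct1, rule_format])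

lemma Phi_adjoint: "F \<in> bounded_borel \<Longrightarrow> \<phi> \<in> l2 \<Longrightarrow> \<psi> \<in> l2 \<Longrightarrow>
    l2_inner \<phi> (\<Phi> F \<psi>) = l2_inner (\<Phi> (\<lambda>x. cnj (F x)) \<phi>) \<psi>"
  by (rule calculus[unfolded borel_functional_calculus_def, THEN conjunct2, THEN conjunct2, THEN conjunct2, THEN conjunct2, THEN conjunct2, THEN conjunct1, rule_format])

lemma Phi_norm: "F \<in> bounded_borel \<Longrightarrow> \<psi> \<in> l2 \<Longrightarrow>
    l2_norm (\<Phi> F \<psi>) \<le> (SUP x. norm (F x)) * l2_norm \<psi>"
  by (rule calculus[unfolded borel_functional_calculus_def, THEN conjunct2, THEN conjunct2, THEN conjunct2, THEN conjunct2, THEN conjunct2, THEN conjunct2, THEN conjunct1, rule_format])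

lemma Phi_id: "(\<And>n. h n \<in> bounded_borel) \<Longrightarrow> (\<And>n x. norm (h n x) \<le> \<bar>x\<bar>) \<Longrightarrow>
    (\<And>x. (\<lambda>n. h n x) \<longlonglongrightarrow> of_real x) \<Longrightarrow> \<psi> \<in> schr_dom V UNIV \<Longrightarrow>
    (\<lambda>n. l2_norm (\<lambda>v. \<Phi> (h n) \<psi> v - schr adj V UNIV \<psi> v)) \<longlonglongrightarrow> 0"
  by (rule calculus[unfolded borel_functional_calculus_def, THEN conjunct2, THEN conjunct2, THEN conjunct2, THEN conjunct2, THEN conjunct2, THEN conjunct2, THEN conjunct2, THEN conjunct1, rule_format]) auto

lemma Phi_lim: "(\<And>n. h n \<in> bounded_borel) \<Longrightarrow> (\<And>n x. norm (h n x) \<le> C) \<Longrightarrow>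
    (\<And>x. (\<lambda>n. h n x) \<longlonglongrightarrow> F x) \<Longrightarrow> \<psi> \<in> l2 \<Longrightarrow>
    (\<lambda>n. l2_norm (\<lambda>v. \<Phi> (h n) \<psi> v - \<Phi> F \<psi> v)) \<longlonglongrightarrow> 0"
  by (rule calculus[unfolded borel_functional_calculus_def, THEN conjunct2, THEN conjunct2, THEN conjunct2, THEN conjunct2, THEN conjunct2, THEN conjunct2, THEN conjunct2, THEN conjunct2, rule_format]) auto

lemma bounded_limit_borel:
  assumes "\<And>n. h n \<in> bounded_borel" "\<And>n x. norm (h n x) \<le> C" "\<And>x. (\<lambda>n. h n x) \<longlonglongrightarrow> F x"
  shows "F \<in> bounded_borel"
proof (rule bounded_borelI)
  show "F \<in> borel_measurable borel"
    by (rule borel_measurable_LIMSEQ_metric[where f = h]) (use assms in \<open>auto simp: bounded_borel_def\<close>)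
  show "norm (F x) \<le> C" for x
    by (rule Lim_bounded[OF tendsto_norm[OF assms(3)]]) (use assms(2) in auto)
qed

lemma Phi_lim_pointwise:
  assumes "\<And>n. h n \<in> bounded_borel" "\<And>n x. norm (h n x) \<le> C" "\<And>x. (\<lambda>n. h n x) \<longlonglongrightarrow> F x" "\<psi> \<in> l2"
  shows "(\<lambda>n. \<Phi> (h n) \<psi> u) \<longlonglongrightarrow> \<Phi> F \<psi> u"
  using Phi_lim[OF assms] bounded_limit_borel[OF assms(1-3)]
  by (intro l2_norm_tendsto_pointwise Phi_l2 assms) auto

lemma schr_delta: "schr adj V UNIV (delta v) u = (if adj u v then 1 else 0) + of_real (V v) * delta v u"
proof -
  have "(\<Sum>w | adj u w. delta v w) = (\<Sum>w | adj u w. if w = v then 1 else 0)" by (simp add: delta_eq)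
  then show ?thesis by (simp add: schr_def sum.delta') (simp add: delta_eq)
qed

lemma schr_delta_l2: "schr adj V UNIV (delta v) \<in> l2"
proof (rule finite_support_l2, rule finite_subset)
  show "{u. schr adj V UNIV (delta v) u \<noteq> 0} \<subseteq> insert v {u. adj v u}"
    by (auto simp: schr_delta delta_eq adj_commute split: if_splits)
qed simp

text \<open>With \<open>r\<close> the Cauchy kernel, \<open>r x * x\<close> equals
  \<open>1 + \<gamma> * r x\<close> and is bounded although \<open>x\<close> is not. The truncations
  \<open>h n\<close> of the identity give \<open>\<Phi> (r h)\<close> = \<open>\<Phi> r\<close>
  composed with \<open>\<Phi> h\<close>. The left side converges by bounded convergence, the right
  side because \<open>\<Phi> (h n)\<close> tends to the operator on \<open>delta v\<close> and
  \<open>\<Phi> r\<close> is bounded.\<close>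

lemma Phi_cauchy_kernel_delta:
  assumes "Im \<gamma> \<noteq> 0"
  shows "\<Phi> (cauchy_kernel \<gamma>) (\<lambda>u. schr adj V UNIV (delta v) u - \<gamma> * delta v u) = delta v"
proof
  fix u
  let ?r = "cauchy_kernel \<gamma>" and ?d = "delta v" and ?a = "schr adj V UNIV (delta v)"
  note r = cauchy_kernel_bounded_borel[OF assms]
  define h where "h n x = indicator {- real n..real n} x * complex_of_real x" for n x
  have h_bb: "h n \<in> bounded_borel" for n
    by (rule bounded_borelI[of _ "real n"]) (auto simp: h_def[abs_def] indicator_def)
  have h_le: "norm (h n x) \<le> \<bar>x\<bar>" for n x by (simp add: h_def indicator_def)
  have h_lim: "(\<lambda>n. h n x) \<longlonglongrightarrow> of_real x" for x
  proof (rule tendsto_eventually)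
    obtain N :: nat where "\<bar>x\<bar> \<le> real N" using real_arch_simple by blast
    then have "h n x = of_real x" if "n \<ge> N" for n using that by (auto simp: h_def indicator_def abs_le_iff)
    then show "\<forall>\<^sub>F n in sequentially. h n x = of_real x" by (auto simp: eventually_sequentially)
  qed
  have rx: "?r x * of_real x = 1 + \<gamma> * ?r x" for x
    using of_real_minus_neq_0[OF assms, of x] by (simp add: cauchy_kernel_def field_simps)
  have d_dom: "?d \<in> schr_dom V UNIV"
    by (auto simp: schr_dom_def intro!: finite_support_l2 rev_finite_subset[OF finite_support_delta])
  have d: "\<Phi> (h n) ?d \<in> l2" for n by (intro Phi_l2 h_bb delta_l2)
  have 1: "(\<lambda>n. \<Phi> ?r (\<Phi> (h n) ?d) u) \<longlonglongrightarrow> \<Phi> ?r ?a u"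
  proof (rule l2_norm_tendsto_pointwise[where f = "\<lambda>n. \<Phi> ?r (\<Phi> (h n) ?d)" and g = "\<Phi> ?r ?a"])
    have lim: "(\<lambda>n. (SUP x. norm (?r x)) * l2_norm (\<lambda>v. \<Phi> (h n) ?d v - ?a v)) \<longlonglongrightarrow> (SUP x. norm (?r x)) * 0"
      by (intro tendsto_mult tendsto_const Phi_id h_bb h_le h_lim d_dom)
    have le: "l2_norm (\<lambda>v. \<Phi> ?r (\<Phi> (h n) ?d) v - \<Phi> ?r ?a v)
        \<le> (SUP x. norm (?r x)) * l2_norm (\<lambda>v. \<Phi> (h n) ?d v - ?a v)" for n
    proof -
      have e: "(\<lambda>v. \<Phi> ?r (\<Phi> (h n) ?d) v - \<Phi> ?r ?a v) = \<Phi> ?r (\<lambda>v. 1 * \<Phi> (h n) ?d v + (- 1) * ?a v)"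
        by (subst Phi_vec[OF r d schr_delta_l2]) simp
      have "l2_norm (\<Phi> ?r (\<lambda>v. 1 * \<Phi> (h n) ?d v + (- 1) * ?a v)) \<le> (SUP x. norm (?r x)) * l2_norm (\<lambda>v. 1 * \<Phi> (h n) ?d v + (- 1) * ?a v)"
        by (intro Phi_norm r l2_lincomb d schr_delta_l2)
      then show ?thesis unfolding e by simp
    qed
    have nonneg: "l2_norm f \<ge> 0" for f :: "'v \<Rightarrow> complex" by (simp add: l2_norm_def infsum_nonneg)
    show "(\<lambda>n. l2_norm (\<lambda>v. \<Phi> ?r (\<Phi> (h n) ?d) v - \<Phi> ?r ?a v)) \<longlonglongrightarrow> 0"
    proof (rule Lim_null_comparison)
      show "\<forall>\<^sub>F n in sequentially. norm (l2_norm (\<lambda>v. \<Phi> ?r (\<Phi> (h n) ?d) v - \<Phi> ?r ?a v))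
          \<le> (SUP x. norm (?r x)) * l2_norm (\<lambda>v. \<Phi> (h n) ?d v - ?a v)"
        unfolding real_norm_def abs_of_nonneg[OF nonneg] by (intro always_eventually allI le)
    qed (use lim in simp)
  qed (intro Phi_l2 r d schr_delta_l2)+
  have "(\<lambda>n. \<Phi> (\<lambda>x. ?r x * h n x) ?d u) \<longlonglongrightarrow> \<Phi> (\<lambda>x. ?r x * of_real x) ?d u"
  proof (rule Phi_lim_pointwise)
    show "norm (?r x * h n x) \<le> 1 + norm \<gamma> * (1 / \<bar>Im \<gamma>\<bar>)" for n x
    proof -
      have "norm (?r x * h n x) \<le> norm (?r x) * \<bar>x\<bar>"
        unfolding norm_mult by (intro mult_left_mono h_le) auto
      also have "\<dots> = norm (1 + \<gamma> * ?r x)" by (simp add: rx[symmetric] norm_mult)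
      also have "\<dots> \<le> norm (1::complex) + norm (\<gamma> * ?r x)" by (rule norm_triangle_ineq)
      also have "\<dots> \<le> 1 + norm \<gamma> * (1 / \<bar>Im \<gamma>\<bar>)"
        unfolding norm_mult using norm_cauchy_kernel_le[OF assms, of x] by (intro add_mono mult_left_mono) auto
      finally show ?thesis .
    qed
  qed (intro mult_bounded_borel r h_bb tendsto_mult tendsto_const h_lim delta_l2)+
  then have "(\<lambda>n. \<Phi> ?r (\<Phi> (h n) ?d) u) \<longlonglongrightarrow> \<Phi> (\<lambda>x. ?r x * of_real x) ?d u"
    by (simp add: Phi_mult[OF r h_bb delta_l2])
  then have "\<Phi> ?r ?a u = \<Phi> (\<lambda>x. ?r x * of_real x) ?d u" by (rule LIMSEQ_unique[OF 1])
  also have "\<dots> = \<Phi> (\<lambda>x. 1 * 1 + \<gamma> * ?r x) ?d u" by (simp add: rx)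
  also have "\<dots> = ?d u + \<gamma> * \<Phi> ?r ?d u"
    by (subst Phi_fun[OF const_bounded_borel r delta_l2]) (simp add: Phi_one)
  finally have e: "\<Phi> ?r ?a u = ?d u + \<gamma> * \<Phi> ?r ?d u" .
  have "\<Phi> ?r (\<lambda>u. ?a u - \<gamma> * ?d u) = \<Phi> ?r (\<lambda>u. 1 * ?a u + (- \<gamma>) * ?d u)" by simp
  also have "\<dots> = (\<lambda>u. 1 * \<Phi> ?r ?a u + (- \<gamma>) * \<Phi> ?r ?d u)" by (rule Phi_vec[OF r schr_delta_l2 delta_l2])
  finally show "\<Phi> ?r (\<lambda>u. ?a u - \<gamma> * ?d u) u = ?d u" using e by simp
qed

text \<open>Self-adjointness of \<open>H\<close> enters here: \<open>\<Phi> (1 / (x - \<gamma>))\<close> is first a left inverse of \<open>H - \<gamma>\<close> on the \<open>\<delta>\<^sub>v\<close>,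
  and testing against \<open>(H - cnj \<gamma>) \<delta>\<^sub>v\<close> turns this into the pointwise equation.\<close>

lemma resolvent_eq:
  assumes "Im \<gamma> \<noteq> 0"
  shows "schr adj V UNIV (\<Phi> (cauchy_kernel \<gamma>) (delta w)) v - \<gamma> * \<Phi> (cauchy_kernel \<gamma>) (delta w) v = delta w v"
proof -
  let ?\<chi> = "\<Phi> (cauchy_kernel \<gamma>) (delta w)"
  let ?f = "\<lambda>u. schr adj V UNIV (delta v) u - cnj \<gamma> * delta v u"
  have f: "?f \<in> l2" using l2_lincomb[OF schr_delta_l2 delta_l2, of 1 v "- cnj \<gamma>" v] by simp
  have "l2_inner ?f ?\<chi> = l2_inner (\<Phi> (\<lambda>x. cnj (cauchy_kernel \<gamma> x)) ?f) (delta w)"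
    by (intro Phi_adjoint cauchy_kernel_bounded_borel assms f delta_l2)
  also have "(\<lambda>x. cnj (cauchy_kernel \<gamma> x)) = cauchy_kernel (cnj \<gamma>)" by (simp add: cauchy_kernel_def fun_eq_iff)
  also have "\<Phi> (cauchy_kernel (cnj \<gamma>)) ?f = delta v" using assms by (intro Phi_cauchy_kernel_delta) simp
  also have "l2_inner (delta v) (delta w) = delta w v" by (rule l2_inner_delta_left)
  finally have "l2_inner ?f ?\<chi> = delta w v" .
  moreover have "l2_inner ?f ?\<chi> = (\<Sum>u\<in>insert v {u. adj v u}. cnj (?f u) * ?\<chi> u)"
  proof (rule l2_inner_finite)
    show "?f u = 0 \<or> ?\<chi> u = 0" if "u \<notin> insert v {u. adj v u}" for u
      using that by (simp add: schr_delta delta_eq adj_commute)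
  qed simp
  moreover have "\<dots> = schr adj V UNIV ?\<chi> v - \<gamma> * ?\<chi> v"
  proof -
    have "(\<Sum>u | adj v u. cnj (?f u) * ?\<chi> u) = (\<Sum>u | adj v u. ?\<chi> u)"
      by (intro sum.cong) (auto simp: schr_delta delta_eq adj_commute)
    then show ?thesis by (simp add: schr_delta) (simp add: schr_def algebra_simps)
  qed
  ultimately show ?thesis by simp
qed

lemma green_eq:
  assumes "Im \<gamma> \<noteq> 0" shows "green adj V \<gamma> u w = \<Phi> (cauchy_kernel \<gamma>) (delta w) u"
proof -
  have "schr_resolvent adj V UNIV \<gamma> (delta w) = \<Phi> (cauchy_kernel \<gamma>) (delta w)"
    by (intro schr_resolvent_eqI Phi_l2 cauchy_kernel_bounded_borel delta_l2 resolvent_eq assms)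
  then show ?thesis by (simp add: green_on_def)
qed

lemma green_l2: "Im \<gamma> \<noteq> 0 \<Longrightarrow> (\<lambda>u. green adj V \<gamma> u w) \<in> l2"
  by (simp add: green_eq Phi_l2 cauchy_kernel_bounded_borel)

lemma green_resolvent_eq:
  "Im \<gamma> \<noteq> 0 \<Longrightarrow> schr adj V UNIV (\<lambda>u. green adj V \<gamma> u w) v - \<gamma> * green adj V \<gamma> v w = delta w v"
  using resolvent_eq[of \<gamma> w v] by (simp add: green_eq)

text \<open>The adjoint rule exchanges the arguments at the cost of conjugating both value and
  energy. Since the kernel of the operator is real, conjugation turns the solution at
  \<open>cnj \<gamma>\<close> into the solution at \<open>\<gamma>\<close>.\<close>

lemma green_symmetric:
  assumes "Im \<gamma> \<noteq> 0" shows "green adj V \<gamma> u w = green adj V \<gamma> w u"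
proof -
  define \<psi> where "\<psi> v = cnj (green adj V (cnj \<gamma>) v u)" for v
  have im: "Im (cnj \<gamma>) \<noteq> 0" using assms by simp
  have "\<psi> = (\<lambda>v. green adj V \<gamma> v u)"
  proof (rule resolvent_eq_unique[OF _ green_l2[OF assms] assms])
    show "\<psi> \<in> l2" using green_l2[OF im, of u] by (simp add: \<psi>_def l2_def)
    fix v
    have "cnj (schr adj V UNIV (\<lambda>v. green adj V (cnj \<gamma>) v u) v - cnj \<gamma> * green adj V (cnj \<gamma>) v u) = cnj (delta u v)"
      using green_resolvent_eq[OF im, of u v] by simp
    then have "schr adj V UNIV \<psi> v - \<gamma> * \<psi> v = delta u v" by (simp add: \<psi>_def schr_def delta_eq)
    then show "schr adj V UNIV \<psi> v - \<gamma> * \<psi> v = schr adj V UNIV (\<lambda>v. green adj V \<gamma> v u) v - \<gamma> * green adj V \<gamma> v u"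
      using green_resolvent_eq[OF assms, of u v] by simp
  qed
  then have "green adj V \<gamma> w u = \<psi> w" by simp
  also have "\<psi> w = l2_inner (\<Phi> (cauchy_kernel (cnj \<gamma>)) (delta u)) (delta w)"
    by (simp add: \<psi>_def green_eq[OF im])
  also have "cauchy_kernel (cnj \<gamma>) = (\<lambda>x. cnj (cauchy_kernel \<gamma> x))" by (simp add: cauchy_kernel_def fun_eq_iff)
  also have "l2_inner (\<Phi> (\<lambda>x. cnj (cauchy_kernel \<gamma> x)) (delta u)) (delta w) = l2_inner (delta u) (\<Phi> (cauchy_kernel \<gamma>) (delta w))"
    by (intro Phi_adjoint[symmetric] cauchy_kernel_bounded_borel assms delta_l2)
  also have "\<dots> = green adj V \<gamma> u w" by (simp add: green_eq[OF assms])
  finally show ?thesis by simp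
qed

text \<open>A zero would make the pairing of the solution with its source vanish; the energy
  identity would then annihilate the whole solution, against the equation at
  \<open>w\<close>.\<close>

lemma green_diag_nonzero:
  assumes "Im \<gamma> \<noteq> 0" shows "green adj V \<gamma> w w \<noteq> 0"
proof
  assume 0: "green adj V \<gamma> w w = 0"
  let ?\<psi> = "\<lambda>u. green adj V \<gamma> u w"
  have "(\<Sum>v\<in>{w}. Im (cnj (?\<psi> v) * delta w v)) = - Im \<gamma> * (\<Sum>\<^sub>\<infinity>v. (norm (?\<psi> v))\<^sup>2)"
    by (rule im_inner_resolvent_eq[OF green_l2[OF assms], where S = UNIV])
       (simp_all add: green_resolvent_eq[OF assms], simp add: delta_eq)
  then have "(\<Sum>\<^sub>\<infinity>v. (norm (?\<psi> v))\<^sup>2) = 0" using 0 assms by simp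
  then have "?\<psi> v = 0" for v by (rule l2_infsum_eq_0D[OF green_l2[OF assms]])
  then show False using green_resolvent_eq[OF assms, of w w] by (simp add: schr_def)
qed

text \<open>Cutting the edge removes from the equation at \<open>v\<close> just the neighbour term
  \<open>G(w, y)\<close>, which reappears as a source there. The pole \<open>y\<close> lies outside
  and adds none.\<close>

lemma green_truncated_eq:
  assumes "Im \<gamma> \<noteq> 0" "adj v w" "y \<notin> truncated adj v w"
  shows "schr adj V (truncated adj v w) (\<lambda>u. if u \<in> truncated adj v w then green adj V \<gamma> u y else 0) x
     - \<gamma> * (if x \<in> truncated adj v w then green adj V \<gamma> x y else 0) = - green adj V \<gamma> w y * delta v x"
proof -
  let ?S = "truncated adj v w" and ?G = "\<lambda>u. green adj V \<gamma> u y"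
  have vS: "v \<in> ?S" by (rule self_in_truncated[OF assms(2)])
  show ?thesis
  proof (cases "x \<in> ?S")
    case False
    then show ?thesis using vS by (auto simp: schr_def delta_eq)
  next
    case x: True
    have "{u. adj x u} = {u. adj x u \<and> u \<in> ?S} \<union> (if x = v then {w} else {})"
      using truncated_edge[OF assms(2) x] assms(2) by auto
    then have "(\<Sum>u | adj x u. ?G u) = (\<Sum>u\<in>{u. adj x u \<and> u \<in> ?S} \<union> (if x = v then {w} else {}). ?G u)" by simp
    also have "\<dots> = (\<Sum>u | adj x u \<and> u \<in> ?S. ?G u) + ?G w * delta v x"
      using removed_notin_truncated[of w v] by (subst sum.union_disjoint) (auto simp: delta_eq)
    finally have s: "(\<Sum>u | adj x u. ?G u) = (\<Sum>u | adj x u \<and> u \<in> ?S. ?G u) + ?G w * delta v x" .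
    have "x \<noteq> y" using x assms(3) by auto
    then have "(\<Sum>u | adj x u. ?G u) + of_real (V x) * ?G x - \<gamma> * ?G x = 0"
      using green_resolvent_eq[OF assms(1), of y x] by (simp add: schr_def delta_eq)
    moreover have "(\<Sum>u | adj x u \<and> u \<in> ?S. if u \<in> ?S then ?G u else 0) = (\<Sum>u | adj x u \<and> u \<in> ?S. ?G u)"
      by (intro sum.cong) auto
    ultimately show ?thesis using x s by (simp add: schr_def algebra_simps)
  qed
qed

text \<open>No functional calculus is available for the truncated operator; its resolvent at \<open>\<delta>\<^sub>v\<close> is
  obtained by restricting the full Green function with pole at the removed neighbour.\<close>

lemma truncated_resolvent:
  assumes "Im \<gamma> \<noteq> 0" "adj v w"
  obtains \<psi> where "\<psi> \<in> l2" "\<And>x. schr adj V (truncated adj v w) \<psi> x - \<gamma> * \<psi> x = delta v x"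
    "zeta adj V \<gamma> w v = - \<psi> v"
proof -
  let ?S = "truncated adj v w"
  \<comment> \<open>For the pole \<open>w\<close> the restricted function has source
    \<open>- G(w, w)\<close> at \<open>v\<close>; the prefactor normalises it to one.\<close>
  define \<psi> where "\<psi> u = (- 1 / green adj V \<gamma> w w) * (if u \<in> ?S then green adj V \<gamma> u w else 0)" for u
  have l: "\<psi> \<in> l2" unfolding \<psi>_def by (intro l2_cmult l2_restrict green_l2 assms)
  have eq: "schr adj V ?S \<psi> x - \<gamma> * \<psi> x = delta v x" for x
  proof -
    let ?c = "- 1 / green adj V \<gamma> w w" and ?f = "\<lambda>u. if u \<in> ?S then green adj V \<gamma> u w else 0"
    have "schr adj V ?S \<psi> x - \<gamma> * \<psi> x = ?c * (schr adj V ?S ?f x - \<gamma> * ?f x)"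
      using schr_lincomb[of adj V ?S ?c ?f 0 ?f x] by (simp add: \<psi>_def[abs_def] algebra_simps)
    also have "\<dots> = delta v x"
      unfolding green_truncated_eq[OF assms removed_notin_truncated]
      using green_diag_nonzero[OF assms(1), of w] by simp
    finally show ?thesis .
  qed
  have "schr_resolvent adj V ?S \<gamma> (delta v) = \<psi>"
    by (intro schr_resolvent_eqI l delta_l2 assms(1) eq)
  then have "zeta adj V \<gamma> w v = - \<psi> v" by (simp add: zeta_def green_on_def)
  then show ?thesis using that[OF l eq] by simp
qed

text \<open>The restriction of \<open>G(., y)\<close> and a multiple of the truncated Green function
  solve the same equation on the truncated tree, so uniqueness identifies them; evaluation at
  \<open>v\<close> gives the factor.\<close>

lemma green_zeta:
  assumes "Im \<gamma> \<noteq> 0" "adj v w" "y \<notin> truncated adj v w"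
  shows "green adj V \<gamma> v y = zeta adj V \<gamma> w v * green adj V \<gamma> w y"
proof -
  let ?S = "truncated adj v w"
  obtain \<psi> where psi: "\<psi> \<in> l2" "\<And>x. schr adj V ?S \<psi> x - \<gamma> * \<psi> x = delta v x" "zeta adj V \<gamma> w v = - \<psi> v"
    by (rule truncated_resolvent[OF assms(1,2)]) blast
  let ?f = "\<lambda>u. if u \<in> ?S then green adj V \<gamma> u y else 0" and ?c = "- green adj V \<gamma> w y"
  have "?f = (\<lambda>u. ?c * \<psi> u)"
  proof (rule resolvent_eq_unique[of _ _ \<gamma> ?S])
    fix x
    have "schr adj V ?S (\<lambda>u. ?c * \<psi> u) x - \<gamma> * (?c * \<psi> x) = ?c * (schr adj V ?S \<psi> x - \<gamma> * \<psi> x)"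
      using schr_lincomb[of adj V ?S ?c \<psi> 0 \<psi> x] by (simp add: algebra_simps)
    then show "schr adj V ?S ?f x - \<gamma> * ?f x = schr adj V ?S (\<lambda>u. ?c * \<psi> u) x - \<gamma> * (?c * \<psi> x)"
      using green_truncated_eq[OF assms, of x] psi(2)[of x] by simp
  qed (intro l2_cmult l2_restrict green_l2 psi assms)+
  from fun_cong[OF this, of v] show ?thesis
    using self_in_truncated[OF assms(2)] psi(3) by simp
qed

text \<open>The energy identity makes the diagonal Green function Herglotz, and zeta carries the
  opposite sign. The sign survives the limit and resolves the absolute value in the weights of the
  boundary measure.\<close>

lemma Im_zeta_nonpos:
  assumes "Im \<gamma> > 0" "adj v w" shows "Im (zeta adj V \<gamma> w v) \<le> 0"
proof -
  have im: "Im \<gamma> \<noteq> 0" using assms by simp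
  obtain \<psi> where psi: "\<psi> \<in> l2" "\<And>x. schr adj V (truncated adj v w) \<psi> x - \<gamma> * \<psi> x = delta v x"
      "zeta adj V \<gamma> w v = - \<psi> v"
    by (rule truncated_resolvent[OF im assms(2)]) blast
  have "(\<Sum>x\<in>{v}. Im (cnj (\<psi> x) * delta v x)) = - Im \<gamma> * (\<Sum>\<^sub>\<infinity>x. (norm (\<psi> x))\<^sup>2)"
    by (rule im_inner_resolvent_eq[OF psi(1) _ _ psi(2)]) (auto simp: delta_eq)
  then have "Im (\<psi> v) = Im \<gamma> * (\<Sum>\<^sub>\<infinity>x. (norm (\<psi> x))\<^sup>2)" by simp
  then show ?thesis using assms(1) psi(3) by (simp add: infsum_nonneg)
qed

end

section \<open>Spectral measures\<close>

lemma l2_inner_self: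
  assumes "\<psi> \<in> l2" shows "l2_inner \<psi> \<psi> = of_real (\<Sum>\<^sub>\<infinity>v. (norm (\<psi> v))\<^sup>2)"
proof -
  have "(\<lambda>v. (norm (\<psi> v))\<^sup>2) summable_on UNIV" using assms by (simp add: l2_def)
  then have "((\<lambda>v. of_real ((norm (\<psi> v))\<^sup>2)) has_sum complex_of_real (\<Sum>\<^sub>\<infinity>v. (norm (\<psi> v))\<^sup>2)) UNIV"
    by (intro has_sum_of_real has_sum_infsum)
  moreover have "(\<lambda>v. complex_of_real ((norm (\<psi> v))\<^sup>2)) = (\<lambda>v. cnj (\<psi> v) * \<psi> v)"
    by (simp add: cnj_mult_self)
  ultimately show ?thesis unfolding l2_inner_def by (simp only: infsumI)
qed

lemma extend0_bounded_borel:
  assumes "I \<in> sets borel" "F \<in> bounded_borel_on I" shows "extend0 I F \<in> bounded_borel"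
proof -
  have "F \<in> borel_measurable (restrict_space borel I)" using assms(2) by (simp add: bounded_borel_on_def)
  then have "(\<lambda>x. indicator I x *\<^sub>R F x) \<in> borel_measurable borel"
    using assms(1) by (subst (asm) borel_measurable_restrict_space_iff) auto
  moreover have "(\<lambda>x. indicator I x *\<^sub>R F x) = extend0 I F"
    by (auto simp: extend0_def indicator_def)
  ultimately have "extend0 I F \<in> borel_measurable borel" by simp
  moreover obtain C where "\<And>x. x \<in> I \<Longrightarrow> norm (F x) \<le> C" using assms(2) by (auto simp: bounded_borel_on_def bounded_iff)
  then have "norm (extend0 I F x) \<le> max C 0" for x by (auto simp: extend0_def le_max_iff_disj)
  ultimately show ?thesis by (intro bounded_borelI)
qed

context spectral begin

definition qform :: "('v \<Rightarrow> complex) \<Rightarrow> (real \<Rightarrow> complex) \<Rightarrow> complex" where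
  "qform \<phi> F = l2_inner \<phi> (\<Phi> F \<phi>)"

context
  fixes \<phi> :: "'v \<Rightarrow> complex"
  assumes finite_support: "finite {v. \<phi> v \<noteq> 0}"
begin

lemma finite_support_phi_l2: "\<phi> \<in> l2" by (rule finite_support_l2[OF finite_support])

text \<open>With finite support the form is a finite sum of values of
  \<open>\<Phi> F \<phi>\<close>, so linearity and pointwise limits of \<open>\<Phi>\<close> pass to
  it directly.\<close>

lemma qform_sum: "qform \<phi> F = (\<Sum>v | \<phi> v \<noteq> 0. cnj (\<phi> v) * \<Phi> F \<phi> v)"
  unfolding qform_def by (rule l2_inner_finite[OF finite_support]) auto

lemma qform_lincomb:
  "F \<in> bounded_borel \<Longrightarrow> G \<in> bounded_borel \<Longrightarrow> qform \<phi> (\<lambda>x. a * F x + b * G x) = a * qform \<phi> F + b * qform \<phi> G"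
  by (simp add: qform_sum Phi_fun finite_support_phi_l2 sum_distrib_left sum.distrib algebra_simps)

lemma qform_lim:
  assumes "\<And>n. h n \<in> bounded_borel" "\<And>n x. norm (h n x) \<le> C" "\<And>x. (\<lambda>n. h n x) \<longlonglongrightarrow> F x"
  shows "(\<lambda>n. qform \<phi> (h n)) \<longlonglongrightarrow> qform \<phi> F"
  unfolding qform_sum
  by (intro tendsto_sum tendsto_mult tendsto_const Phi_lim_pointwise[OF assms finite_support_phi_l2])

lemma qform_simple:
  assumes "finite Y" "\<And>y. y \<in> Y \<Longrightarrow> B y \<in> sets borel"
  shows "(\<lambda>x. \<Sum>y\<in>Y. c y * indicator (B y) x) \<in> bounded_borel \<and>
    qform \<phi> (\<lambda>x. \<Sum>y\<in>Y. c y * indicator (B y) x) = (\<Sum>y\<in>Y. c y * qform \<phi> (indicator (B y)))"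
  using assms
proof (induction Y rule: finite_induct)
  case empty
  \<comment> \<open>The zero function is written as a combination with zero coefficients, so
    linearity evaluates it.\<close>
  have "qform \<phi> (\<lambda>x. 0 * 0 + 0 * 0) = 0 * qform \<phi> (\<lambda>x. 0) + 0 * qform \<phi> (\<lambda>x. 0)"
    by (intro qform_lincomb const_bounded_borel)
  then show ?case by simp
next
  case (insert y Y)
  let ?G = "\<lambda>x. \<Sum>y\<in>Y. c y * indicator (B y) x"
  have G: "?G \<in> bounded_borel" "qform \<phi> ?G = (\<Sum>y\<in>Y. c y * qform \<phi> (indicator (B y)))"
    using insert by auto
  have I: "indicator (B y) \<in> bounded_borel" using insert by simp
  have e: "(\<lambda>x. \<Sum>y\<in>insert y Y. c y * indicator (B y) x) = (\<lambda>x. c y * indicator (B y) x + 1 * ?G x)"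
    by (simp only: sum.insert[OF insert.hyps] mult_1)
  have 1: "qform \<phi> (\<lambda>x. c y * indicator (B y) x + 1 * ?G x) = c y * qform \<phi> (indicator (B y)) + 1 * qform \<phi> ?G"
    by (rule qform_lincomb[OF I G(1)])
  have 2: "(\<lambda>x. c y * indicator (B y) x + 1 * ?G x) \<in> bounded_borel"
    by (intro add_bounded_borel mult_bounded_borel const_bounded_borel I G)
  show ?case unfolding e 1 G(2) using 2 by (simp only: sum.insert[OF insert.hyps] mult_1 simp_thms)
qed

text \<open>An indicator is idempotent and real, so its image is an orthogonal projection and the
  form is the squared norm of the projected vector.\<close>

lemma qform_indicator:
  assumes "J \<in> sets borel"
  shows "qform \<phi> (indicator J) = of_real (Re (qform \<phi> (indicator J)))" "0 \<le> Re (qform \<phi> (indicator J))"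
proof -
  let ?I = "indicator J :: real \<Rightarrow> complex"
  have I: "?I \<in> bounded_borel" using assms by simp
  have l: "\<Phi> ?I \<phi> \<in> l2" by (intro Phi_l2 I finite_support_phi_l2)
  have "?I = (\<lambda>x. ?I x * ?I x)" by (auto simp: indicator_def)
  then have "\<Phi> ?I \<phi> = \<Phi> ?I (\<Phi> ?I \<phi>)" using Phi_mult[OF I I finite_support_phi_l2] by simp
  then have "qform \<phi> ?I = l2_inner \<phi> (\<Phi> ?I (\<Phi> ?I \<phi>))" by (simp add: qform_def)
  also have "\<dots> = l2_inner (\<Phi> (\<lambda>x. cnj (?I x)) \<phi>) (\<Phi> ?I \<phi>)"
    by (rule Phi_adjoint[OF I finite_support_phi_l2 l])
  also have "(\<lambda>x. cnj (?I x)) = ?I" by (auto simp: indicator_def)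
  finally have "qform \<phi> ?I = of_real (\<Sum>\<^sub>\<infinity>v. (norm (\<Phi> ?I \<phi> v))\<^sup>2)" by (simp add: l2_inner_self[OF l])
  then show "qform \<phi> ?I = of_real (Re (qform \<phi> ?I))" "0 \<le> Re (qform \<phi> ?I)"
    by (simp_all add: infsum_nonneg)
qed

lemma sets_spectral_measure [simp]: "sets (spectral_measure \<Phi> \<phi>) = sets borel"
  unfolding spectral_measure_def by (metis sets.sets_measure_of_eq sets_measure_of_conv space_borel sets.space_closed)

lemma space_spectral_measure [simp]: "space (spectral_measure \<Phi> \<phi>) = UNIV"
  unfolding spectral_measure_def by (simp add: space_measure_of_conv)

text \<open>\<open>measure_of\<close> keeps the given values only once they are shown to form a
  measure; countable additivity comes from bounded pointwise convergence of the calculus.\<close>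

lemma emeasure_spectral_measure:
  assumes "J \<in> sets borel"
  shows "emeasure (spectral_measure \<Phi> \<phi>) J = ennreal (Re (qform \<phi> (indicator J)))"
proof -
  let ?\<mu> = "\<lambda>J. ennreal (Re (qform \<phi> (indicator J)))"
  have "qform \<phi> (\<lambda>x. 0) = 0" using qform_simple[of "{}"] by simp
  moreover have "(indicator {} :: real \<Rightarrow> complex) = (\<lambda>x. 0)" by auto
  ultimately have pos: "positive (sets borel) ?\<mu>" by (simp add: positive_def)
  have ca: "countably_additive (sets borel) ?\<mu>"
    unfolding countably_additive_def
  proof (intro allI impI)
    fix A :: "nat \<Rightarrow> real set"
    assume A: "range A \<subseteq> sets borel" "disjoint_family A" "(\<Union>i. A i) \<in> sets borel"
    have Ai: "A i \<in> sets borel" for i using A(1) by auto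
    \<comment> \<open>The same function is a sum of indicators, where linearity applies, and the
      indicator of a partial union, which is bounded by one and converges.\<close>
    define h where "h n x = (\<Sum>i<n. 1 * indicator (A i) x :: complex)" for n x
    have h_ind: "h n = indicator (\<Union>i<n. A i)" for n
    proof
      fix x
      have "disjoint_family_on A {..<n}" using A(2) by (rule disjoint_family_on_mono[rotated]) simp
      then show "h n x = indicator (\<Union>i<n. A i) x" unfolding h_def by (simp add: indicator_UN_disjoint)
    qed
    have h: "h n \<in> bounded_borel" "qform \<phi> (h n) = (\<Sum>i<n. 1 * qform \<phi> (indicator (A i)))" for n
      using qform_simple[of "{..<n}" A "\<lambda>_. 1"] Ai unfolding h_def[abs_def] by auto
    have "(\<lambda>n. qform \<phi> (h n)) \<longlonglongrightarrow> qform \<phi> (indicator (\<Union>i. A i))"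
    proof (rule qform_lim[where C = 1])
      show "norm (h n x) \<le> 1" for n x unfolding h_ind by (simp add: indicator_def)
      show "(\<lambda>n. h n x) \<longlonglongrightarrow> indicator (\<Union>i. A i) x" for x unfolding h_ind by (rule LIMSEQ_indicator_UN)
    qed (rule h)
    then have "(\<lambda>n. Re (qform \<phi> (h n))) \<longlonglongrightarrow> Re (qform \<phi> (indicator (\<Union>i. A i)))" by (rule tendsto_Re)
    then have "(\<lambda>i. Re (qform \<phi> (indicator (A i)))) sums Re (qform \<phi> (indicator (\<Union>i. A i)))"
      unfolding sums_def h(2) by simp
    then show "(\<Sum>i. ?\<mu> (A i)) = ?\<mu> (\<Union>i. A i)"
      by (intro suminf_ennreal_eq qform_indicator(2) Ai)
  qed
  have "sigma_algebra UNIV (sets (borel :: real measure))"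
    using sets.sigma_algebra_axioms[of "borel :: real measure"] by simp
  from emeasure_measure_of_sigma[OF this pos ca assms] show ?thesis
    by (simp add: spectral_measure_def qform_def)
qed

lemma finite_spectral_measure: "finite_measure (spectral_measure \<Phi> \<phi>)"
  by (rule finite_measureI) (simp add: emeasure_spectral_measure)

lemma measure_spectral_measure:
  "J \<in> sets borel \<Longrightarrow> of_real (measure (spectral_measure \<Phi> \<phi>) J) = qform \<phi> (indicator J)"
  using qform_indicator[of J] by (simp add: measure_def emeasure_spectral_measure)

lemma qform_eq_integral:
  assumes F: "F \<in> bounded_borel"
  shows "qform \<phi> F = (\<integral> x. F x \<partial>spectral_measure \<Phi> \<phi>)"
proof -
  let ?\<mu> = "spectral_measure \<Phi> \<phi>"
  interpret finite_measure ?\<mu> by (rule finite_spectral_measure)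
  have [measurable_cong]: "sets ?\<mu> = sets borel" by simp
  have Fm: "F \<in> borel_measurable borel" using F by (simp add: bounded_borel_def)
  obtain C where C: "\<And>x. norm (F x) \<le> C" using F by (auto simp: bounded_borel_def bounded_iff)
  \<comment> \<open>Approximation around the base point \<open>0\<close> gives the factor
    \<open>2\<close>; the resulting uniform bound serves both the calculus and dominated
    convergence.\<close>
  obtain s where s: "\<And>i. simple_function borel (s i)" "\<And>x. (\<lambda>i. s i x) \<longlonglongrightarrow> F x"
      "\<And>i x. norm (s i x) \<le> 2 * norm (F x)"
    using borel_measurable_implies_sequence_metric[OF Fm, of 0] by (auto simp: dist_norm)
  have sC: "norm (s i x) \<le> 2 * C" for i x using s(3)[of i x] C[of x] by linarith
  have sm: "s i \<in> borel_measurable borel" for i using s(1) by (rule borel_measurable_simple_function)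
  have si: "s i \<in> bounded_borel" "qform \<phi> (s i) = (\<integral> x. s i x \<partial>?\<mu>)" for i
  proof -
    have fin: "finite (range (s i))" using s(1)[of i] by (simp add: simple_function_def)
    have B: "s i -` {y} \<in> sets borel" for y using measurable_sets[OF sm[of i], of "{y}"] by simp
    have eq: "s i = (\<lambda>x. \<Sum>y\<in>range (s i). y * indicator (s i -` {y}) x)"
    proof
      fix x
      have "(\<Sum>y\<in>range (s i). y * indicator (s i -` {y}) x) = (\<Sum>y\<in>range (s i). if y = s i x then y else 0)"
        by (intro sum.cong) (auto simp: indicator_def)
      then show "s i x = (\<Sum>y\<in>range (s i). y * indicator (s i -` {y}) x)" using fin by simp
    qed
    show "s i \<in> bounded_borel" using qform_simple[OF fin, of "\<lambda>y. s i -` {y}" "\<lambda>y. y"] B eq by simp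
    have "qform \<phi> (s i) = (\<Sum>y\<in>range (s i). y * qform \<phi> (indicator (s i -` {y})))"
      using qform_simple[OF fin, of "\<lambda>y. s i -` {y}" "\<lambda>y. y"] B eq by simp
    also have "\<dots> = (\<Sum>y\<in>range (s i). y * (\<integral> x. indicator (s i -` {y}) x \<partial>?\<mu>))"
    proof -
      have "(\<integral> x. indicator (s i -` {y}) x \<partial>?\<mu>) = (\<integral> x. complex_of_real (indicator (s i -` {y}) x) \<partial>?\<mu>)" for y
        by (intro Bochner_Integration.integral_cong) (auto simp: indicator_def)
      then show ?thesis using B by (simp add: measure_spectral_measure[symmetric])
    qed
    also have "\<dots> = (\<integral> x. (\<Sum>y\<in>range (s i). y * indicator (s i -` {y}) x) \<partial>?\<mu>)"
    proof (subst Bochner_Integration.integral_sum)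
      show "integrable ?\<mu> (\<lambda>x. y * indicator (s i -` {y}) x)" for y
      proof (intro integrable_mult_right integrable_const_bound[where B = 1])
        show "(indicator (s i -` {y}) :: real \<Rightarrow> complex) \<in> borel_measurable ?\<mu>"
          using B[of y] by measurable
      qed (auto simp: indicator_def)
    qed simp
    finally show "qform \<phi> (s i) = (\<integral> x. s i x \<partial>?\<mu>)" using eq by simp
  qed
  have "(\<lambda>i. \<integral> x. s i x \<partial>?\<mu>) \<longlonglongrightarrow> (\<integral> x. F x \<partial>?\<mu>)"
    using Fm sm s(2) sC by (intro integral_dominated_convergence[where w = "\<lambda>_. 2 * C"]) auto
  moreover have "(\<lambda>i. qform \<phi> (s i)) \<longlonglongrightarrow> qform \<phi> F"
    by (rule qform_lim[OF si(1) sC s(2)])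
  ultimately show ?thesis using si(2) LIMSEQ_unique by simp
qed

text \<open>The imaginary part of the Cauchy kernel at \<open>Complex E \<eta>\<close> is
  \<open>pi\<close> times the Poisson kernel centred at \<open>E\<close>.\<close>

lemma poisson_integral_eq:
  assumes "\<eta> > 0"
  shows "(\<integral> t. poisson_kernel \<eta> (E - t) \<partial>spectral_measure \<Phi> \<phi>) = Im (qform \<phi> (cauchy_kernel (Complex E \<eta>))) / pi"
proof -
  let ?\<mu> = "spectral_measure \<Phi> \<phi>"
  interpret finite_measure ?\<mu> by (rule finite_spectral_measure)
  have [measurable_cong]: "sets ?\<mu> = sets borel" by simp
  have b: "cauchy_kernel (Complex E \<eta>) \<in> bounded_borel" using assms by (intro cauchy_kernel_bounded_borel) simp
  have int: "integrable ?\<mu> (cauchy_kernel (Complex E \<eta>))"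
    using b norm_cauchy_kernel_le[of "Complex E \<eta>"] assms
    by (intro integrable_const_bound[where B = "1 / \<bar>\<eta>\<bar>"]) (auto simp: bounded_borel_def)
  have "Im (cauchy_kernel (Complex E \<eta>) t) = pi * poisson_kernel \<eta> (E - t)" for t
    by (simp add: cauchy_kernel_def poisson_kernel_def Im_divide power2_commute)
  then have "Im (qform \<phi> (cauchy_kernel (Complex E \<eta>))) = (\<integral> t. pi * poisson_kernel \<eta> (E - t) \<partial>?\<mu>)"
    using int by (simp add: qform_eq_integral[OF b] integral_Im[symmetric])
  then show ?thesis by simp
qed

text \<open>The spectral measure of \<open>\<phi>\<close> is finite and charges no null subset of
  \<open>I\<close>, so the limit theorem for Poisson integrals applies to it.\<close>

lemma qform_eq_boundary_integral:
  assumes I: "I \<in> sets borel" and A: "\<AA> \<in> null_sets lebesgue" and ac: "purely_ac_spectrum_in \<Phi> I"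
    and lim: "\<And>E. E \<in> I - \<AA> \<Longrightarrow>
        ((\<lambda>\<eta>. Im (qform \<phi> (cauchy_kernel (Complex E \<eta>))) / pi) \<longlongrightarrow> u E) (at_right 0)"
    and F: "F \<in> bounded_borel_on I"
  shows "set_integrable lebesgue I (\<lambda>E. F E * of_real (u E))"
    and "qform \<phi> (extend0 I F) = (LINT E:I|lebesgue. F E * of_real (u E))"
proof -
  let ?\<mu> = "spectral_measure \<Phi> \<phi>" and ?F = "extend0 I F"
  have Fb: "?F \<in> bounded_borel" by (rule extend0_bounded_borel[OF I F])
  have null: "emeasure ?\<mu> J = 0" if J: "J \<in> null_sets lborel" "J \<subseteq> I" for J
  proof -
    have "absolutely_continuous (restrict_space lborel I) (restrict_space ?\<mu> I)"
      using ac finite_support_phi_l2 by (simp add: purely_ac_spectrum_in_def)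
    moreover have "J \<in> null_sets (restrict_space lborel I)" using J I by (simp add: null_sets_restrict_space)
    ultimately have "J \<in> null_sets (restrict_space ?\<mu> I)" by (auto simp: absolutely_continuous_def)
    then show ?thesis using I by (subst (asm) null_sets_restrict_space) auto
  qed
  have lim': "((\<lambda>\<eta>. \<integral> t. poisson_kernel \<eta> (E - t) \<partial>?\<mu>) \<longlongrightarrow> u E) (at_right 0)" if "E \<in> I - \<AA>" for E
  proof (rule Lim_transform_eventually[OF lim[OF that]])
    show "\<forall>\<^sub>F \<eta> in at_right 0. Im (qform \<phi> (cauchy_kernel (Complex E \<eta>))) / pi = (\<integral> t. poisson_kernel \<eta> (E - t) \<partial>?\<mu>)"
      using eventually_at_right_less[of 0] by eventually_elim (simp add: poisson_integral_eq)
  qed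
  have F': "?F \<in> borel_measurable borel" "bounded (range ?F)" using Fb by (auto simp: bounded_borel_def)
  note * = integral_eq_poisson_limit[OF finite_spectral_measure sets_spectral_measure I A null lim' F']
  have e: "(\<lambda>x. indicator I x *\<^sub>R (?F x * of_real (u x))) = (\<lambda>x. indicator I x *\<^sub>R (F x * of_real (u x)))"
    "(\<lambda>x. indicator I x *\<^sub>R ?F x) = ?F"
    by (auto simp: extend0_def indicator_def)
  show "set_integrable lebesgue I (\<lambda>E. F E * of_real (u E))"
    using *(1) unfolding set_integrable_def e .
  show "qform \<phi> ?F = (LINT E:I|lebesgue. F E * of_real (u E))"
    using *(2) unfolding set_lebesgue_integral_def e qform_eq_integral[OF Fb] .
qed

end

end

section \<open>The Poisson kernel at real energies\<close>

lemma bval_eqI: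
  "((\<lambda>\<eta>. g (Complex E \<eta>)) \<longlongrightarrow> L) (at_right 0) \<Longrightarrow> bval g E = L"
  unfolding bval_def by (rule tendsto_Lim[OF trivial_limit_at_right_real])

lemma limits_at_right_eq:
  fixes f g :: "real \<Rightarrow> 'a::t2_space"
  assumes "(f \<longlongrightarrow> a) (at_right 0)" "(g \<longlongrightarrow> b) (at_right 0)" "\<And>\<eta>. \<eta> > 0 \<Longrightarrow> f \<eta> = g \<eta>"
  shows "a = b"
proof -
  have "\<forall>\<^sub>F \<eta> in at_right 0. f \<eta> = g \<eta>"
    using eventually_at_right_less[of "0::real"] by eventually_elim (rule assms(3))
  then have "(g \<longlongrightarrow> a) (at_right 0)" by (rule Lim_transform_eventually[OF assms(1)])
  then show ?thesis by (rule tendsto_unique[OF trivial_limit_at_right_real _ assms(2)])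
qed

section \<open>Boundary values of Green functions at one fixed energy\<close>

locale boundary_values = spectral adj V \<Phi>
  for adj :: "'v \<Rightarrow> 'v \<Rightarrow> bool" and V :: "'v \<Rightarrow> real"
    and \<Phi> :: "(real \<Rightarrow> complex) \<Rightarrow> ('v \<Rightarrow> complex) \<Rightarrow> 'v \<Rightarrow> complex" +
  fixes E :: real
  assumes green_diag_limit: "\<exists>L. L \<noteq> 0 \<and> ((\<lambda>\<eta>. green adj V (Complex E \<eta>) v v) \<longlongrightarrow> L) (at_right 0)"
    and zeta_limit: "adj v w \<Longrightarrow> \<exists>L. L \<noteq> 0 \<and> ((\<lambda>\<eta>. zeta adj V (Complex E \<eta>) w v) \<longlongrightarrow> L) (at_right 0)"
begin

definition green_bv :: "'v \<Rightarrow> 'v \<Rightarrow> complex" where "green_bv u w = bval (\<lambda>\<gamma>. green adj V \<gamma> u w) E"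

definition zeta_bv :: "'v \<Rightarrow> 'v \<Rightarrow> complex" where "zeta_bv w v = bval (\<lambda>\<gamma>. zeta adj V \<gamma> w v) E"

lemma zeta_bv_tendsto: "adj v w \<Longrightarrow> ((\<lambda>\<eta>. zeta adj V (Complex E \<eta>) w v) \<longlongrightarrow> zeta_bv w v) (at_right 0)"
  and zeta_bv_nonzero: "adj v w \<Longrightarrow> zeta_bv w v \<noteq> 0"
proof -
  assume "adj v w"
  then obtain L where L: "L \<noteq> 0" "((\<lambda>\<eta>. zeta adj V (Complex E \<eta>) w v) \<longlongrightarrow> L) (at_right 0)"
    using zeta_limit by blast
  moreover have "zeta_bv w v = L" unfolding zeta_bv_def by (rule bval_eqI[OF L(2)])
  ultimately show "((\<lambda>\<eta>. zeta adj V (Complex E \<eta>) w v) \<longlongrightarrow> zeta_bv w v) (at_right 0)" "zeta_bv w v \<noteq> 0" by auto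
qed

text \<open>Only diagonal limits are assumed. An off-diagonal Green function is a diagonal one times
  the zeta factors of the edges of the arc, each with a non-zero limit.\<close>

lemma green_arc_limit:
  assumes "is_arc adj p"
  shows "\<exists>L. L \<noteq> 0 \<and> ((\<lambda>\<eta>. green adj V (Complex E \<eta>) (hd p) (last p)) \<longlongrightarrow> L) (at_right 0)"
  using assms
proof (induction p)
  case (Cons a p)
  show ?case
  proof (cases p)
    case Nil
    then show ?thesis using green_diag_limit by simp
  next
    case p: (Cons b q)
    have arc: "is_arc adj (a # b # q)" using Cons.prems p by simp
    obtain L where L: "L \<noteq> 0" "((\<lambda>\<eta>. green adj V (Complex E \<eta>) b (last p)) \<longlongrightarrow> L) (at_right 0)"
      using Cons.IH is_arc_ConsD[OF arc] p by auto
    have "((\<lambda>\<eta>. green adj V (Complex E \<eta>) a (last p)) \<longlongrightarrow> zeta_bv b a * L) (at_right 0)"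
    proof (rule Lim_transform_eventually[OF tendsto_mult[OF zeta_bv_tendsto[OF is_arc_adj[OF arc]] L(2)]])
      show "\<forall>\<^sub>F \<eta> in at_right 0. zeta adj V (Complex E \<eta>) b a * green adj V (Complex E \<eta>) b (last p)
          = green adj V (Complex E \<eta>) a (last p)"
        using eventually_at_right_less[of "0::real"]
        by eventually_elim
           (use notin_truncated_second[OF arc] p in \<open>simp add: green_zeta[OF _ is_arc_adj[OF arc]]\<close>)
    qed
    moreover have "zeta_bv b a * L \<noteq> 0" using L(1) zeta_bv_nonzero[OF is_arc_adj[OF arc]] by simp
    ultimately show ?thesis using p by (intro exI[of _ "zeta_bv b a * L"]) auto
  qed
qed (simp add: is_arc_def)

lemma green_bv_tendsto: "((\<lambda>\<eta>. green adj V (Complex E \<eta>) u w) \<longlongrightarrow> green_bv u w) (at_right 0)"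
  and green_bv_nonzero [simp]: "green_bv u w \<noteq> 0"
proof -
  obtain L where L: "L \<noteq> 0" "((\<lambda>\<eta>. green adj V (Complex E \<eta>) u w) \<longlongrightarrow> L) (at_right 0)"
    using green_arc_limit[OF is_arc_arc[of u w]] by auto
  moreover have "green_bv u w = L" unfolding green_bv_def by (rule bval_eqI[OF L(2)])
  ultimately show "((\<lambda>\<eta>. green adj V (Complex E \<eta>) u w) \<longlongrightarrow> green_bv u w) (at_right 0)" "green_bv u w \<noteq> 0" by auto
qed

lemma green_bv_symmetric: "green_bv u w = green_bv w u"
  by (rule limits_at_right_eq[OF green_bv_tendsto green_bv_tendsto]) (simp add: green_symmetric)

lemma green_bv_zeta:
  assumes "adj v w" "y \<notin> truncated adj v w" shows "green_bv v y = zeta_bv w v * green_bv w y"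
  by (rule limits_at_right_eq[OF green_bv_tendsto tendsto_mult[OF zeta_bv_tendsto[OF assms(1)] green_bv_tendsto]])
     (simp add: green_zeta[OF _ assms])

lemma Im_zeta_bv_nonpos: "adj v w \<Longrightarrow> Im (zeta_bv w v) \<le> 0"
proof -
  assume a: "adj v w"
  have "\<forall>\<^sub>F \<eta> in at_right 0. Im (zeta adj V (Complex E \<eta>) w v) \<le> 0"
    using eventually_at_right_less[of "0::real"] by eventually_elim (simp add: Im_zeta_nonpos a)
  then show ?thesis
    by (rule tendsto_upperbound[OF tendsto_Im[OF zeta_bv_tendsto[OF a]]]) simp
qed

lemma green_bv_schr_eq:
  "(\<Sum>y | adj u y. green_bv y v) + of_real (V u) * green_bv u v - of_real E * green_bv u v = delta v u"
proof (rule limits_at_right_eq)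
  have "((\<lambda>\<eta>. (\<Sum>y | adj u y. green adj V (Complex E \<eta>) y v) + of_real (V u) * green adj V (Complex E \<eta>) u v
      - (of_real E + \<i> * of_real \<eta>) * green adj V (Complex E \<eta>) u v) \<longlongrightarrow>
     (\<Sum>y | adj u y. green_bv y v) + of_real (V u) * green_bv u v - (of_real E + \<i> * of_real 0) * green_bv u v) (at_right 0)"
    by (intro tendsto_intros green_bv_tendsto)
  then show "((\<lambda>\<eta>. (\<Sum>y | adj u y. green adj V (Complex E \<eta>) y v) + of_real (V u) * green adj V (Complex E \<eta>) u v
      - Complex E \<eta> * green adj V (Complex E \<eta>) u v) \<longlongrightarrow>
     (\<Sum>y | adj u y. green_bv y v) + of_real (V u) * green_bv u v - of_real E * green_bv u v) (at_right 0)"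
    by (simp add: Complex_eq)
  show "((\<lambda>\<eta>. delta v u) \<longlongrightarrow> delta v u) (at_right 0)" by (rule tendsto_const)
  show "(\<Sum>y | adj u y. green adj V (Complex E \<eta>) y v) + of_real (V u) * green adj V (Complex E \<eta>) u v
      - Complex E \<eta> * green adj V (Complex E \<eta>) u v = delta v u" if "\<eta> > 0" for \<eta>
    using green_resolvent_eq[of "Complex E \<eta>" v u] that by (simp add: schr_def)
qed

lemma Psi_bv_eq: "Psi_bv adj V E v w = Im (green_bv v w) / pi"
  unfolding Psi_bv_def by (rule bval_eqI) (auto simp: Psi_def intro!: tendsto_intros green_bv_tendsto)

text \<open>The ratio of \<open>green_bv (hd p) y\<close> to \<open>green_bv (last p) y\<close> when
  the arc \<open>p\<close> can be prolonged to an arc ending at \<open>y\<close>.\<close>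

fun zprod :: "'v list \<Rightarrow> complex" where
  "zprod (a # b # q) = zeta_bv b a * zprod (b # q)"
| "zprod _ = 1"

lemma zprod_nonzero: "is_arc adj p \<Longrightarrow> zprod p \<noteq> 0"
proof (induction p rule: zprod.induct)
  case (1 a b q)
  then show ?case using is_arc_ConsD[OF 1(2)] is_arc_adj[OF 1(2)] zeta_bv_nonzero by auto
qed auto

lemma green_bv_arc:
  "is_arc adj (p @ c # q) \<Longrightarrow> green_bv (hd (p @ [c])) (last (c # q)) = zprod (p @ [c]) * green_bv c (last (c # q))"
proof (induction p)
  case (Cons a p)
  define b where "b = hd (p @ [c])"
  obtain l where l: "p @ c # q = b # l" and l': "\<exists>k. p @ [c] = b # k"
    unfolding b_def by (cases p) auto
  have arc: "is_arc adj (a # b # l)" using Cons.prems l by simp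
  have "last (b # l) = last (c # q)" by (simp only: l[symmetric]) simp
  then have "green_bv a (last (c # q)) = zeta_bv b a * green_bv b (last (c # q))"
    using green_bv_zeta[OF is_arc_adj[OF arc] notin_truncated_second[OF arc]] by simp
  also have "green_bv b (last (c # q)) = zprod (p @ [c]) * green_bv c (last (c # q))"
    using Cons.IH is_arc_ConsD[OF arc] l by (simp add: b_def)
  finally show ?case using l' by auto
qed simp

text \<open>Both arcs to the ray vertex pass through the confluent \<open>c\<close>, so its
  replacement by that vertex multiplies numerator and denominator by the same factor. For fixed
  \<open>n\<close> the right side depends on \<open>\<xi>\<close> through one vertex only, uniformly
  for \<open>v\<close> in the ball of radius \<open>n\<close>.\<close>

lemma poisson_bv_eq:
  assumes xi: "\<xi> \<in> tree_boundary adj" and n: "gdist adj r v \<le> n"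
  shows "poisson_bv adj V r E \<xi> v = green_bv v (ray r \<xi> n) / green_bv r (ray r \<xi> n)"
proof -
  define c where "c = confluent adj r v \<xi>"
  obtain p q s where
    P: "is_arc adj (p @ c # q)" "hd (p @ [c]) = v" and
    S: "is_arc adj (s @ c # q)" "hd (s @ [c]) = r" and
    u: "last (c # q) = ray r \<xi> n"
    unfolding c_def using confluent_arcs[OF xi n] by metis
  have P': "is_arc adj (p @ [c])" using is_arc_appendD1[of adj "p @ [c]" q] P(1) by simp
  have S': "is_arc adj (s @ [c])" using is_arc_appendD1[of adj "s @ [c]" q] S(1) by simp
  have "poisson_bv adj V r E \<xi> v = green_bv c v / green_bv r c"
    unfolding poisson_bv_def poisson_def c_def[symmetric]
    by (rule bval_eqI) (intro tendsto_divide green_bv_tendsto green_bv_nonzero)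
  also have "\<dots> = green_bv v c / green_bv r c" by (simp add: green_bv_symmetric)
  also have "\<dots> = (zprod (p @ [c]) * green_bv c c) / (zprod (s @ [c]) * green_bv c c)"
    using green_bv_arc[of p c "[]"] green_bv_arc[of s c "[]"] P' S' P(2) S(2) by simp
  also have "\<dots> = (zprod (p @ [c]) * green_bv c (ray r \<xi> n)) / (zprod (s @ [c]) * green_bv c (ray r \<xi> n))"
    using zprod_nonzero[OF S'] by simp
  also have "\<dots> = green_bv v (ray r \<xi> n) / green_bv r (ray r \<xi> n)"
    using green_bv_arc[OF P(1)] green_bv_arc[OF S(1)] P(2) S(2) u by simp
  finally show ?thesis .
qed

section \<open>Green's formula on balls and the boundary measure\<close>

definition parent :: "'v \<Rightarrow> 'v \<Rightarrow> 'v" where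
  "parent r y = arc r y ! (gdist adj r y - 1)"

lemma parent_props:
  assumes "gdist adj r y = Suc n"
  shows "adj (parent r y) y" "gdist adj r (parent r y) = n"
proof -
  obtain q where q: "arc r y = q @ [y]" by (rule arc_snoc)
  have lq: "length q = Suc n" using q length_arc[of r y] assms by simp
  then obtain q' x where q': "q = q' @ [x]" by (cases q rule: rev_cases) auto
  have "parent r y = x" using lq assms q q' by (simp add: parent_def nth_append)
  then show "adj (parent r y) y" using is_arc_arc[of r y] q q'
    by (simp add: is_arc_def successively_append_iff)
  show "gdist adj r (parent r y) = n"
    unfolding parent_def using assms gdist_arc_nth[of n r y] length_arc[of r y] by simp
qed

lemma parent_eqI:
  assumes "gdist adj r y = Suc n" "adj u y" "gdist adj r u \<le> n"
  shows "u = parent r y"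
proof -
  have "arc r y = arc r u @ [y]" "gdist adj r u = n" using gdist_step[OF assms(2), of r] assms by auto
  then have "parent r y = arc r u ! n" "length (arc r u) = Suc n"
    using assms(1) length_arc[of r u] by (auto simp: parent_def nth_append)
  then show ?thesis using last_conv_nth[OF arc_nonempty[of r u]] by simp
qed

lemma sphere_attached:
  assumes "gdist adj r y = Suc n"
  shows "{u. gdist adj r u \<le> n \<and> adj u y} = {parent r y}"
proof (intro equalityI subsetI)
  fix u assume "u \<in> {u. gdist adj r u \<le> n \<and> adj u y}"
  then have "u = parent r y" by (intro parent_eqI[OF assms]) auto
  then show "u \<in> {parent r y}" by simp
qed (use parent_props[OF assms] in simp)

text \<open>Discrete divergence theorem: inner edges cancel in pairs, and each edge leaving the ball
  is indexed by its outer end, which has a single neighbour in the ball.\<close>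

lemma sum_ball_antisymmetric:
  fixes k :: "'v \<Rightarrow> 'v \<Rightarrow> complex"
  assumes "\<And>u y. k u y = - k y u"
  shows "(\<Sum>u | gdist adj r u \<le> n. \<Sum>y | adj u y. k u y) = (\<Sum>y | gdist adj r y = Suc n. k (parent r y) y)"
proof -
  define X where "X = {u. gdist adj r u \<le> n}"
  define Y where "Y = {y. gdist adj r y = Suc n}"
  have fX: "finite X" unfolding X_def by (rule finite_ball[OF bounded_degree])
  have fY: "finite Y" unfolding Y_def
    by (rule finite_subset[OF _ finite_ball[OF bounded_degree, of r "Suc n"]]) auto
  have "(\<Sum>y | adj u y. k u y) = (\<Sum>y\<in>X. if adj u y then k u y else 0) + (\<Sum>y\<in>Y. if adj u y then k u y else 0)"
    if "u \<in> X" for u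
  proof -
    have eq: "{y. adj u y} = {y\<in>X. adj u y} \<union> {y\<in>Y. adj u y}"
      using gdist_step[of u _ r] that by (fastforce simp: X_def Y_def)
    have "(\<Sum>y | adj u y. k u y) = (\<Sum>y\<in>{y\<in>X. adj u y} \<union> {y\<in>Y. adj u y}. k u y)"
      by (rule sum.cong[OF eq refl])
    also have "\<dots> = (\<Sum>y\<in>{y\<in>X. adj u y}. k u y) + (\<Sum>y\<in>{y\<in>Y. adj u y}. k u y)"
      using fX fY by (intro sum.union_disjoint) (auto simp: X_def Y_def)
    finally show ?thesis using fX fY by (simp add: sum.inter_filter)
  qed
  then have "(\<Sum>u\<in>X. \<Sum>y | adj u y. k u y)
      = (\<Sum>u\<in>X. \<Sum>y\<in>X. if adj u y then k u y else 0) + (\<Sum>u\<in>X. \<Sum>y\<in>Y. if adj u y then k u y else 0)"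
    by (simp add: sum.distrib)
  also have "(\<Sum>u\<in>X. \<Sum>y\<in>X. if adj u y then k u y else 0) = 0"
  proof -
    let ?S = "\<Sum>u\<in>X. \<Sum>y\<in>X. if adj u y then k u y else 0"
    have "?S = (\<Sum>y\<in>X. \<Sum>u\<in>X. if adj u y then k u y else 0)" by (rule sum.swap)
    also have "\<dots> = (\<Sum>y\<in>X. \<Sum>u\<in>X. - (if adj y u then k y u else 0))"
    proof (intro sum.cong refl)
      fix u y show "(if adj u y then k u y else 0) = - (if adj y u then k y u else 0)"
        using assms[of u y] adj_commute[of u y] by simp
    qed
    also have "\<dots> = - ?S" by (simp add: sum_negf)
    finally show ?thesis by simp
  qed
  also have "(\<Sum>u\<in>X. \<Sum>y\<in>Y. if adj u y then k u y else 0) = (\<Sum>y\<in>Y. \<Sum>u\<in>X. if adj u y then k u y else 0)"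
    by (rule sum.swap)
  also have "\<dots> = (\<Sum>y\<in>Y. k (parent r y) y)"
  proof (intro sum.cong refl)
    fix y assume "y \<in> Y"
    then have "{u\<in>X. adj u y} = {parent r y}" using sphere_attached[of r y n] by (simp add: X_def Y_def)
    then show "(\<Sum>u\<in>X. if adj u y then k u y else 0) = k (parent r y) y"
      using fX by (simp add: sum.inter_filter[symmetric])
  qed
  finally show ?thesis by (simp add: X_def Y_def)
qed

lemma Im_green_bv_eq_sphere_sum:
  assumes "gdist adj r v \<le> n" "gdist adj r w \<le> n"
  shows "of_real (Im (green_bv v w)) = (\<Sum>y | gdist adj r y = Suc n.
      of_real (- Im (zeta_bv (parent r y) y)) * (green_bv v (parent r y) * cnj (green_bv w (parent r y))))"
proof -
  \<comment> \<open>The discrete Wronskian of \<open>G(., v)\<close> and \<open>cnj G(., w)\<close>.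
    In its divergence the terms with \<open>E\<close> and \<open>V\<close> cancel because both are
    real, leaving sources at \<open>v\<close> and \<open>w\<close>.\<close>
  let ?k = "\<lambda>u y. green_bv u v * cnj (green_bv y w) - green_bv y v * cnj (green_bv u w)"
  have fX: "finite {u. gdist adj r u \<le> n}" by (rule finite_ball[OF bounded_degree])
  have "(\<Sum>u | gdist adj r u \<le> n. \<Sum>y | adj u y. ?k u y)
      = (\<Sum>u | gdist adj r u \<le> n. green_bv u v * delta w u - delta v u * cnj (green_bv u w))"
  proof (intro sum.cong refl)
    fix u
    have 1: "(\<Sum>y | adj u y. green_bv y v) = delta v u - of_real (V u) * green_bv u v + of_real E * green_bv u v"
      using green_bv_schr_eq[where u = u and v = v] by (simp add: algebra_simps)
    have w: "(\<Sum>y | adj u y. green_bv y w) = delta w u - of_real (V u) * green_bv u w + of_real E * green_bv u w"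
      using green_bv_schr_eq[where u = u and v = w] by (simp add: algebra_simps)
    have "cnj (\<Sum>y | adj u y. green_bv y w) = cnj (delta w u - of_real (V u) * green_bv u w + of_real E * green_bv u w)"
      by (simp only: w)
    then have 2: "(\<Sum>y | adj u y. cnj (green_bv y w)) = delta w u - of_real (V u) * cnj (green_bv u w) + of_real E * cnj (green_bv u w)"
      by (simp add: delta_eq)
    have "(\<Sum>y | adj u y. ?k u y) = green_bv u v * (\<Sum>y | adj u y. cnj (green_bv y w)) - (\<Sum>y | adj u y. green_bv y v) * cnj (green_bv u w)"
      by (simp add: sum_subtractf sum_distrib_left sum_distrib_right)
    then show "(\<Sum>y | adj u y. ?k u y) = green_bv u v * delta w u - delta v u * cnj (green_bv u w)"
      unfolding 1 2 by (simp add: algebra_simps)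
  qed
  also have "\<dots> = (\<Sum>u | gdist adj r u \<le> n. if u = w then green_bv u v else 0)
      - (\<Sum>u | gdist adj r u \<le> n. if u = v then cnj (green_bv u w) else 0)"
    by (simp add: sum_subtractf delta_eq if_distrib[of "\<lambda>x. _ * x"] if_distrib[of "\<lambda>x. x * _"] cong: if_cong)
  \<comment> \<open>Both poles lie in the ball, so both sources are counted.\<close>
  also have "\<dots> = green_bv w v - cnj (green_bv v w)"
    using fX assms by (simp add: sum.delta)
  also have "\<dots> = 2 * \<i> * of_real (Im (green_bv v w))"
    by (simp add: green_bv_symmetric[of w v] complex_eq_iff)
  finally have "2 * \<i> * of_real (Im (green_bv v w)) = (\<Sum>y | gdist adj r y = Suc n. ?k (parent r y) y)"
    by (subst (asm) sum_ball_antisymmetric) simp_all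
  also have "\<dots> = (\<Sum>y | gdist adj r y = Suc n. 2 * \<i> * (of_real (- Im (zeta_bv (parent r y) y))
      * (green_bv v (parent r y) * cnj (green_bv w (parent r y)))))"
  proof (intro sum.cong refl)
    fix y assume "y \<in> {y. gdist adj r y = Suc n}"
    then have y: "gdist adj r y = Suc n" by simp
    let ?u = "parent r y"
    note u = parent_props[OF y]
    \<comment> \<open>Both poles lie on the inner side of the edge, so crossing it outwards
      multiplies either Green function by the same zeta; the Wronskian becomes
      \<open>- 2 i Im\<close> zeta times a product of values at the inner end.\<close>
    have z: "green_bv y x = zeta_bv ?u y * green_bv ?u x" if "gdist adj r x \<le> n" for x
      using ball_notin_truncated[OF u(1), of r x] u(2) y that by (intro green_bv_zeta adj_sym[OF u(1)]) auto
    have "?k ?u y = (cnj (zeta_bv ?u y) - zeta_bv ?u y) * (green_bv ?u v * cnj (green_bv ?u w))"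
      unfolding z[OF assms(1)] z[OF assms(2)] by (simp add: algebra_simps)
    also have "cnj (zeta_bv ?u y) - zeta_bv ?u y = 2 * \<i> * of_real (- Im (zeta_bv ?u y))" by (simp add: complex_eq_iff)
    finally show "?k ?u y = 2 * \<i> * (of_real (- Im (zeta_bv ?u y)) * (green_bv v ?u * cnj (green_bv w ?u)))"
      by (simp add: green_bv_symmetric[of ?u] mult.assoc)
  qed
  also have "\<dots> = 2 * \<i> * (\<Sum>y | gdist adj r y = Suc n. of_real (- Im (zeta_bv (parent r y) y))
      * (green_bv v (parent r y) * cnj (green_bv w (parent r y))))"
    by (rule sum_distrib_left[symmetric])
  finally show ?thesis by (simp only: mult_cancel_left) simp
qed

text \<open>For \<open>n\<close> covering both vertices the integrand takes the constant value
  \<open>c y\<close> beyond each vertex \<open>y\<close> of the sphere of radius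
  \<open>Suc n\<close>. The factor \<open>|G(r, parent)|^2\<close> in the measure cancels the two
  denominators of the Poisson kernels, and what remains is the sphere sum of Green's
  formula.\<close>

lemma poisson_boundary_integral:
  assumes nu: "is_boundary_measure adj V r E \<nu>"
  shows "has_bochner_integral \<nu> (\<lambda>\<xi>. poisson_bv adj V r E \<xi> v * cnj (poisson_bv adj V r E \<xi> w))
           (of_real (Psi_bv adj V E v w))"
proof -
  define n where "n = max (gdist adj r v) (gdist adj r w)"
  have n: "gdist adj r v \<le> n" "gdist adj r w \<le> n" by (auto simp: n_def)
  define Y where "Y = {y. gdist adj r y = Suc n}"
  have fY: "finite Y" unfolding Y_def
    by (rule finite_subset[OF _ finite_ball[OF bounded_degree, of r "Suc n"]]) auto
  let ?B = "boundary_beyond adj r"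
  define c where "c y = green_bv v (parent r y) * cnj (green_bv w (parent r y)) / of_real ((norm (green_bv r (parent r y)))\<^sup>2)" for y
  define m where "m y = (norm (green_bv r (parent r y)))\<^sup>2 * \<bar>Im (zeta_bv (parent r y) y)\<bar> / pi" for y
  have sp: "space \<nu> = tree_boundary adj" using nu by (simp add: is_boundary_measure_def)
  have em: "emeasure \<nu> (?B y) = ennreal (m y)" if "y \<in> Y" for y
  proof -
    have "y \<in> forward_nbrs adj r (parent r y)"
      using parent_props[of r y n] that by (auto simp: forward_nbrs_def Y_def)
    then show ?thesis using nu by (auto simp: is_boundary_measure_def m_def green_bv_def zeta_bv_def)
  qed
  have B: "?B y \<in> sets \<nu>" if "y \<in> Y" for y
  proof -
    have "y \<noteq> r" using that by (auto simp: Y_def)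
    then show ?thesis using nu by (auto simp: is_boundary_measure_def)
  qed
  have "has_bochner_integral \<nu> (\<lambda>\<xi>. \<Sum>y\<in>Y. indicator (?B y) \<xi> *\<^sub>R c y) (\<Sum>y\<in>Y. measure \<nu> (?B y) *\<^sub>R c y)"
    using B em by (intro has_bochner_integral_sum has_bochner_integral_scaleR_left has_bochner_integral_real_indicator)
      auto
  moreover have "(\<Sum>y\<in>Y. indicator (?B y) \<xi> *\<^sub>R c y) = poisson_bv adj V r E \<xi> v * cnj (poisson_bv adj V r E \<xi> w)"
    if "\<xi> \<in> space \<nu>" for \<xi>
  proof -
    have xi: "\<xi> \<in> tree_boundary adj" using that sp by simp
    let ?y = "ray r \<xi> (Suc n)" and ?u = "ray r \<xi> n"
    have yY: "?y \<in> Y" by (simp add: Y_def gdist_ray[OF xi])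
    have u: "parent r ?y = ?u"
      by (rule parent_eqI[symmetric, of r _ n]) (simp_all add: gdist_ray[OF xi] adj_ray[OF xi])
    \<comment> \<open>A ray meets the sphere in exactly one vertex, so a single indicator is
      non-zero.\<close>
    have "(\<Sum>y\<in>Y. indicator (?B y) \<xi> *\<^sub>R c y) = (\<Sum>y\<in>Y. if y = ?y then c y else 0)"
      by (intro sum.cong refl) (auto simp: boundary_beyond_iff xi Y_def indicator_def)
    also have "\<dots> = c ?y" using fY yY by simp
    also have "\<dots> = (green_bv v ?u / green_bv r ?u) * cnj (green_bv w ?u / green_bv r ?u)"
      unfolding c_def u complex_norm_square by simp
    finally show ?thesis unfolding poisson_bv_eq[OF xi n(1)] poisson_bv_eq[OF xi n(2)] .
  qed
  ultimately have "has_bochner_integral \<nu> (\<lambda>\<xi>. poisson_bv adj V r E \<xi> v * cnj (poisson_bv adj V r E \<xi> w))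
      (\<Sum>y\<in>Y. measure \<nu> (?B y) *\<^sub>R c y)"
    by (simp cong: has_bochner_integral_cong)
  also have "(\<Sum>y\<in>Y. measure \<nu> (?B y) *\<^sub>R c y)
      = (\<Sum>y\<in>Y. of_real (- Im (zeta_bv (parent r y) y)) * (green_bv v (parent r y) * cnj (green_bv w (parent r y)))) / of_real pi"
    unfolding sum_divide_distrib
  proof (intro sum.cong refl)
    fix y assume y: "y \<in> Y"
    have "Im (zeta_bv (parent r y) y) \<le> 0"
      using parent_props(1)[of r y n] y by (intro Im_zeta_bv_nonpos) (simp add: Y_def adj_commute)
    moreover have "measure \<nu> (?B y) = m y" using em[OF y] by (simp add: measure_def m_def)
    ultimately show "measure \<nu> (?B y) *\<^sub>R c y
        = of_real (- Im (zeta_bv (parent r y) y)) * (green_bv v (parent r y) * cnj (green_bv w (parent r y))) / of_real pi"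
      by (simp add: m_def c_def scaleR_conv_of_real)
  qed
  also have "\<dots> = of_real (Psi_bv adj V E v w)"
    using Im_green_bv_eq_sphere_sum[OF n] by (simp add: Psi_bv_eq Y_def)
  finally show ?thesis .
qed

end

section \<open>Polarisation and the eigenfunction expansion\<close>

context spectral begin

lemma boundary_valuesI:
  assumes "exceptional_set adj V \<AA>" "E \<notin> \<AA>"
  shows "boundary_values adj V \<Phi> E"
  by unfold_locales (use assms in \<open>auto simp: exceptional_set_def\<close>)

text \<open>The cross terms carry \<open>c\<close> and \<open>cnj c\<close>; letting
  \<open>c\<close> run through the fourth roots of unity isolates either of them.\<close>

lemma qform_delta_delta:
  assumes F: "F \<in> bounded_borel"
  shows "qform (\<lambda>u. delta v u + c * delta w u) F
    = \<Phi> F (delta v) v + c * \<Phi> F (delta w) v + cnj c * \<Phi> F (delta v) w + cnj c * c * \<Phi> F (delta w) w"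
proof -
  have "\<Phi> F (\<lambda>u. 1 * delta v u + c * delta w u) = (\<lambda>u. 1 * \<Phi> F (delta v) u + c * \<Phi> F (delta w) u)"
    by (rule Phi_vec[OF F delta_l2 delta_l2])
  then have P: "\<Phi> F (\<lambda>u. delta v u + c * delta w u) = (\<lambda>u. \<Phi> F (delta v) u + c * \<Phi> F (delta w) u)" by simp
  have "l2_inner (\<lambda>u. delta v u + c * delta w u) \<psi> = \<psi> v + cnj c * \<psi> w" for \<psi>
  proof -
    have "l2_inner (\<lambda>u. delta v u + c * delta w u) \<psi> = (\<Sum>u\<in>{v, w}. cnj (delta v u + c * delta w u) * \<psi> u)"
      by (rule l2_inner_finite) (auto simp: delta_eq)
    also have "\<dots> = \<psi> v + cnj c * \<psi> w" by (cases "v = w") (auto simp: delta_eq algebra_simps)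
    finally show ?thesis .
  qed
  then show ?thesis unfolding qform_def P by (simp add: algebra_simps)
qed

context
  fixes I \<AA> :: "real set"
  assumes I: "I \<in> sets borel" and ac: "purely_ac_spectrum_in \<Phi> I" and exc: "exceptional_set adj V \<AA>"
begin

lemma exceptional_null: "\<AA> \<in> null_sets lebesgue"
  using exc by (simp add: exceptional_set_def)

text \<open>The symmetry of the Green function makes \<open>u\<close> depend on \<open>c\<close> through \<open>Re c\<close> only.\<close>

lemma qform_polarization:
  fixes v w :: 'v
  assumes F: "F \<in> bounded_borel_on I" and c: "norm c = 1"
  defines "u \<equiv> \<lambda>E. Psi_bv adj V E v v + Psi_bv adj V E w w + 2 * Re c * Psi_bv adj V E v w"
  shows "set_integrable lebesgue I (\<lambda>E. F E * of_real (u E))"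
    and "qform (\<lambda>u. delta v u + c * delta w u) (extend0 I F) = (LINT E:I|lebesgue. F E * of_real (u E))"
proof -
  let ?\<phi> = "\<lambda>u. delta v u + c * delta w u"
  have fin: "finite {u. ?\<phi> u \<noteq> 0}"
    by (rule finite_subset[of _ "{v, w}"]) (auto simp: delta_eq)
  have lim: "((\<lambda>\<eta>. Im (qform ?\<phi> (cauchy_kernel (Complex E \<eta>))) / pi) \<longlongrightarrow> u E) (at_right 0)" if E: "E \<in> I - \<AA>" for E
  proof -
    interpret boundary_values adj V \<Phi> E using E by (intro boundary_valuesI[OF exc]) auto
    have cc: "cnj c * c = 1" using c by (simp add: cnj_mult_self)
    have "Im (qform ?\<phi> (cauchy_kernel (Complex E \<eta>))) =
        Im (green adj V (Complex E \<eta>) v v) + Im (green adj V (Complex E \<eta>) w w)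
          + 2 * Re c * Im (green adj V (Complex E \<eta>) v w)" if "\<eta> > 0" for \<eta>
    proof -
      have im: "Im (Complex E \<eta>) \<noteq> 0" using that by simp
      have "qform ?\<phi> (cauchy_kernel (Complex E \<eta>)) = green adj V (Complex E \<eta>) v v
          + (c + cnj c) * green adj V (Complex E \<eta>) v w + green adj V (Complex E \<eta>) w w"
        unfolding qform_delta_delta[OF cauchy_kernel_bounded_borel[OF im]] green_eq[OF im, symmetric] cc
        using green_symmetric[OF im, of w v] by (simp add: algebra_simps)
      also have "c + cnj c = of_real (2 * Re c)" by (simp add: complex_add_cnj)
      finally show ?thesis by simp
    qed
    note eq = this
    have "((\<lambda>\<eta>. (Im (green adj V (Complex E \<eta>) v v) + Im (green adj V (Complex E \<eta>) w w)
          + 2 * Re c * Im (green adj V (Complex E \<eta>) v w)) / pi) \<longlongrightarrow>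
        (Im (green_bv v v) + Im (green_bv w w) + 2 * Re c * Im (green_bv v w)) / pi) (at_right 0)"
      by (intro tendsto_intros green_bv_tendsto) simp
    moreover have "(Im (green_bv v v) + Im (green_bv w w) + 2 * Re c * Im (green_bv v w)) / pi = u E"
      by (simp add: u_def Psi_bv_eq add_divide_distrib)
    moreover have "\<forall>\<^sub>F \<eta> in at_right 0. (Im (green adj V (Complex E \<eta>) v v) + Im (green adj V (Complex E \<eta>) w w)
          + 2 * Re c * Im (green adj V (Complex E \<eta>) v w)) / pi = Im (qform ?\<phi> (cauchy_kernel (Complex E \<eta>))) / pi"
      using eventually_at_right_less[of "0::real"] by eventually_elim (simp add: eq)
    ultimately show ?thesis using Lim_transform_eventually by fastforce
  qed
  show "set_integrable lebesgue I (\<lambda>E. F E * of_real (u E))"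
    and "qform ?\<phi> (extend0 I F) = (LINT E:I|lebesgue. F E * of_real (u E))"
    using qform_eq_boundary_integral[OF fin I exceptional_null ac lim F] by auto
qed

text \<open>Four-point polarisation. The densities for \<open>\<i>\<close> and \<open>- \<i>\<close>
  coincide because only \<open>Re c\<close> enters them, so these two terms cancel and the matrix
  element is a quarter of the difference between \<open>c = 1\<close> and
  \<open>c = -1\<close>.\<close>

lemma kernel_eq_Psi_integral:
  assumes F: "F \<in> bounded_borel_on I"
  shows "set_integrable lebesgue I (\<lambda>E. F E * of_real (Psi_bv adj V E v w))"
    and "\<Phi> (extend0 I F) (delta w) v = (LINT E:I|lebesgue. F E * of_real (Psi_bv adj V E v w))"
proof -
  let ?F = "extend0 I F"
  note Fb = extend0_bounded_borel[OF I F]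
  define u where "u c E = Psi_bv adj V E v v + Psi_bv adj V E w w + 2 * Re c * Psi_bv adj V E v w" for c E
  define q where "q c = qform (\<lambda>u. delta v u + c * delta w u) ?F" for c
  have int: "set_integrable lebesgue I (\<lambda>E. F E * of_real (u c E))"
    and q: "q c = (LINT E:I|lebesgue. F E * of_real (u c E))" if "norm c = 1" for c
    using qform_polarization[OF F that, of v w] unfolding u_def q_def by auto
  have d: "F E * of_real (u 1 E) - F E * of_real (u (- 1) E) = 4 * (F E * of_real (Psi_bv adj V E v w))" for E
    by (simp add: u_def algebra_simps)
  have 4: "set_integrable lebesgue I (\<lambda>E. 4 * (F E * of_real (Psi_bv adj V E v w)))"
    using set_integral_diff(1)[OF int[of 1] int[of "- 1"]] by (simp add: d)
  then show "set_integrable lebesgue I (\<lambda>E. F E * of_real (Psi_bv adj V E v w))"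
    by (subst (asm) set_integrable_mult_right_iff) auto
  have "q \<i> = q (- \<i>)" by (simp add: q u_def)
  moreover have "q 1 - \<i> * q \<i> - q (- 1) + \<i> * q (- \<i>) = 4 * \<Phi> ?F (delta w) v"
    unfolding q_def qform_delta_delta[OF Fb] by (simp add: algebra_simps)
  ultimately have "4 * \<Phi> ?F (delta w) v = q 1 - q (- 1)" by simp
  also have "\<dots> = (LINT E:I|lebesgue. F E * of_real (u 1 E) - F E * of_real (u (- 1) E))"
    using set_integral_diff(2)[OF int[of 1] int[of "- 1"]] by (simp add: q)
  also have "\<dots> = 4 * (LINT E:I|lebesgue. F E * of_real (Psi_bv adj V E v w))"
    unfolding d by simp
  finally show "\<Phi> ?F (delta w) v = (LINT E:I|lebesgue. F E * of_real (Psi_bv adj V E v w))" by simp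
qed

text \<open>Weighted finite families of vertex pairs are the common form of the three assertions:
  one pair, the support of \<open>f\<close>, or a rectangle around the support of
  \<open>K\<close>.\<close>

lemma finite_sum_Psi_integral:
  assumes F: "F \<in> bounded_borel_on I" and J: "finite J"
  shows "set_integrable lebesgue I (\<lambda>E. F E * (\<Sum>j\<in>J. k j * of_real (Psi_bv adj V E (v j) (w j))))"
    and "(\<Sum>j\<in>J. k j * \<Phi> (extend0 I F) (delta (w j)) (v j))
      = (LINT E:I|lebesgue. F E * (\<Sum>j\<in>J. k j * of_real (Psi_bv adj V E (v j) (w j))))"
proof -
  have e: "F E * (\<Sum>j\<in>J. k j * of_real (Psi_bv adj V E (v j) (w j)))
      = (\<Sum>j\<in>J. k j * (F E * of_real (Psi_bv adj V E (v j) (w j))))" for E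
    by (simp add: sum_distrib_left mult_ac)
  have i: "set_integrable lebesgue I (\<lambda>E. k j * (F E * of_real (Psi_bv adj V E (v j) (w j))))" for j
    by (intro set_integrable_mult_right kernel_eq_Psi_integral(1)[OF F])
  show "set_integrable lebesgue I (\<lambda>E. F E * (\<Sum>j\<in>J. k j * of_real (Psi_bv adj V E (v j) (w j))))"
    using i unfolding e set_integrable_def scaleR_sum_right by (intro Bochner_Integration.integrable_sum) auto
  show "(\<Sum>j\<in>J. k j * \<Phi> (extend0 I F) (delta (w j)) (v j))
      = (LINT E:I|lebesgue. F E * (\<Sum>j\<in>J. k j * of_real (Psi_bv adj V E (v j) (w j))))"
    using i unfolding e set_integrable_def set_lebesgue_integral_def scaleR_sum_right
    by (subst Bochner_Integration.integral_sum)
       (auto simp: kernel_eq_Psi_integral(2)[OF F] set_lebesgue_integral_def mult_scaleR_right[symmetric]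
         simp del: mult_scaleR_right intro!: sum.cong)
qed

text \<open>The inner integral is computed for every \<open>E\<close> off the null set and equals
  the \<open>Psi_bv\<close> integrand there, which also provides its measurability. Passing
  \<open>g\<close> and \<open>T\<close> as equations lets each assertion keep its own form of the
  integrand.\<close>

lemma finite_sum_poisson_integral:
  assumes F: "F \<in> bounded_borel_on I" and J: "finite J"
    and nu: "\<forall>E. E \<notin> \<AA> \<longrightarrow> is_boundary_measure adj V r E (\<nu> E)"
    and g: "\<And>E \<xi>. g E \<xi> = F E * (\<Sum>j\<in>J. k j * (poisson_bv adj V r E \<xi> (v j) * cnj (poisson_bv adj V r E \<xi> (w j))))"
    and T: "T = (\<Sum>j\<in>J. k j * \<Phi> (extend0 I F) (delta (w j)) (v j))"
  shows "(\<forall>E \<in> I - \<AA>. integrable (\<nu> E) (g E)) \<and>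
    set_integrable lebesgue I (\<lambda>E. LINT \<xi>|\<nu> E. g E \<xi>) \<and> T = (LINT E:I|lebesgue. LINT \<xi>|\<nu> E. g E \<xi>)"
proof -
  let ?h = "\<lambda>E. F E * (\<Sum>j\<in>J. k j * of_real (Psi_bv adj V E (v j) (w j)))"
  have b: "has_bochner_integral (\<nu> E) (g E) (?h E)" if "E \<notin> \<AA>" for E
  proof -
    interpret boundary_values adj V \<Phi> E by (rule boundary_valuesI[OF exc that])
    show ?thesis
      unfolding g by (intro has_bochner_integral_mult_right has_bochner_integral_sum
          poisson_boundary_integral[OF nu[rule_format, OF that]])
  qed
  have "AE E in lebesgue. E \<notin> \<AA>" by (rule AE_not_in[OF exceptional_null])
  then have ae: "AE E in lebesgue. indicator I E *\<^sub>R (LINT \<xi>|\<nu> E. g E \<xi>) = indicator I E *\<^sub>R ?h E"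
    by eventually_elim (use b has_bochner_integral_integral_eq in force)
  note h = finite_sum_Psi_integral[OF F J, where k = k and v = v and w = w]
  have hi: "integrable lebesgue (\<lambda>E. indicator I E *\<^sub>R ?h E)" using h(1) by (simp add: set_integrable_def)
  have m: "(\<lambda>E. indicator I E *\<^sub>R (LINT \<xi>|\<nu> E. g E \<xi>)) \<in> borel_measurable lebesgue"
    by (rule borel_measurable_lebesgue_cong_AE[OF borel_measurable_integrable[OF hi] ae])
  have "set_integrable lebesgue I (\<lambda>E. LINT \<xi>|\<nu> E. g E \<xi>)"
    unfolding set_integrable_def
    using integrable_cong_AE[OF m borel_measurable_integrable[OF hi] ae] hi by blast
  moreover have "T = (LINT E:I|lebesgue. LINT \<xi>|\<nu> E. g E \<xi>)"
    unfolding T h(2) set_lebesgue_integral_def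
    by (rule integral_cong_AE[OF m borel_measurable_integrable[OF hi] ae, symmetric])
  moreover have "integrable (\<nu> E) (g E)" if "E \<in> I - \<AA>" for E
    using b[of E] that by (simp add: has_bochner_integral_iff)
  ultimately show ?thesis by simp
qed

end

lemma Phi_finite_sum:
  assumes F: "F \<in> bounded_borel" and "finite A"
  shows "(\<lambda>u. \<Sum>w\<in>A. f w * delta w u) \<in> l2 \<and>
    \<Phi> F (\<lambda>u. \<Sum>w\<in>A. f w * delta w u) = (\<lambda>u. \<Sum>w\<in>A. f w * \<Phi> F (delta w) u)"
  using assms(2)
proof (induction A rule: finite_induct)
  case empty
  \<comment> \<open>Any vector with zero coefficients represents the zero function;
    \<open>undefined\<close> is an arbitrary vertex.\<close>
  have "\<Phi> F (\<lambda>u. 0 * delta undefined u + 0 * delta undefined u) = (\<lambda>u. 0 * \<Phi> F (delta undefined) u + 0 * \<Phi> F (delta undefined) u)"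
    by (rule Phi_vec[OF F delta_l2 delta_l2])
  then show ?case by (simp add: finite_support_l2)
next
  case (insert w A)
  let ?s = "\<lambda>u. \<Sum>w\<in>A. f w * delta w u"
  have e: "(\<lambda>u. \<Sum>w\<in>insert w A. f w * delta w u) = (\<lambda>u. f w * delta w u + 1 * ?s u)"
    using insert.hyps by simp
  have "\<Phi> F (\<lambda>u. f w * delta w u + 1 * ?s u) = (\<lambda>u. f w * \<Phi> F (delta w) u + 1 * \<Phi> F ?s u)"
    using insert.IH by (intro Phi_vec[OF F delta_l2]) auto
  moreover have "(\<lambda>u. f w * delta w u + 1 * ?s u) \<in> l2"
    using insert.IH by (intro l2_lincomb delta_l2) auto
  ultimately show ?case unfolding e using insert.IH insert.hyps by simp
qed

lemma Phi_finite_support: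
  assumes F: "F \<in> bounded_borel" and "finite A" "\<And>v. v \<notin> A \<Longrightarrow> f v = 0"
  shows "\<Phi> F f v = (\<Sum>w\<in>A. f w * \<Phi> F (delta w) v)"
proof -
  have "f = (\<lambda>u. \<Sum>w\<in>A. f w * delta w u)"
  proof
    fix u
    have "(\<Sum>w\<in>A. f w * delta w u) = (\<Sum>w\<in>A. if w = u then f w else 0)"
      by (intro sum.cong) (auto simp: delta_eq)
    then show "f u = (\<Sum>w\<in>A. f w * delta w u)" using assms(2,3) by simp
  qed
  then have "\<Phi> F f = \<Phi> F (\<lambda>u. \<Sum>w\<in>A. f w * delta w u)" by (rule arg_cong)
  then show ?thesis using Phi_finite_sum[OF F assms(2), of f] by simp
qed

end

theorem theorem3p8:
  fixes adj :: "'v \<Rightarrow> 'v \<Rightarrow> bool" and V :: "'v \<Rightarrow> real" and orig :: 'v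
    and \<Phi> :: "(real \<Rightarrow> complex) \<Rightarrow> ('v \<Rightarrow> complex) \<Rightarrow> 'v \<Rightarrow> complex"
    and I \<AA> :: "real set"
    and \<nu> :: "real \<Rightarrow> (nat \<Rightarrow> 'v) set measure"
  assumes "is_tree adj" and "bounded_degree adj"
    and "borel_functional_calculus (schr_dom V UNIV) (schr adj V UNIV) \<Phi>"
    and "I \<in> sets borel" and "purely_ac_spectrum_in \<Phi> I"
    and "exceptional_set adj V \<AA>"
    and "\<And>E. E \<notin> \<AA> \<Longrightarrow> is_boundary_measure adj V orig E (\<nu> E)"
  shows
    "(\<forall>F \<in> bounded_borel_on I. \<forall>v w.
        set_integrable lebesgue I (\<lambda>E. F E * of_real (Psi_bv adj V E v w)) \<and>
        l2_inner (delta v) (\<Phi> (extend0 I F) (delta w))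
          = (LINT E:I|lebesgue. F E * of_real (Psi_bv adj V E v w)) \<and>
        (\<forall>E \<in> I - \<AA>. integrable (\<nu> E)
           (\<lambda>\<xi>. F E * poisson_bv adj V orig E \<xi> v * cnj (poisson_bv adj V orig E \<xi> w))) \<and>
        set_integrable lebesgue I (\<lambda>E. LINT \<xi>|\<nu> E.
           F E * poisson_bv adj V orig E \<xi> v * cnj (poisson_bv adj V orig E \<xi> w)) \<and>
        l2_inner (delta v) (\<Phi> (extend0 I F) (delta w))
          = (LINT E:I|lebesgue. LINT \<xi>|\<nu> E.
               F E * poisson_bv adj V orig E \<xi> v * cnj (poisson_bv adj V orig E \<xi> w)))
   \<and> (\<forall>f. finite {v. f v \<noteq> 0} \<longrightarrow> (\<forall>F \<in> bounded_borel_on I. \<forall>v.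
        set_integrable lebesgue I
          (\<lambda>E. F E * l2_inner (\<lambda>w. cnj (f w)) (\<lambda>w. of_real (Psi_bv adj V E v w))) \<and>
        \<Phi> (extend0 I F) f v
          = (LINT E:I|lebesgue.
               F E * l2_inner (\<lambda>w. cnj (f w)) (\<lambda>w. of_real (Psi_bv adj V E v w))) \<and>
        (\<forall>E \<in> I - \<AA>. integrable (\<nu> E)
           (\<lambda>\<xi>. F E * poisson_bv adj V orig E \<xi> v * l2_inner (poisson_bv adj V orig E \<xi>) f)) \<and>
        set_integrable lebesgue I (\<lambda>E. LINT \<xi>|\<nu> E.
           F E * poisson_bv adj V orig E \<xi> v * l2_inner (poisson_bv adj V orig E \<xi>) f) \<and>
        \<Phi> (extend0 I F) f v
          = (LINT E:I|lebesgue. LINT \<xi>|\<nu> E.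
               F E * poisson_bv adj V orig E \<xi> v * l2_inner (poisson_bv adj V orig E \<xi>) f)))
   \<and> (\<forall>K. finite {(v, w). K v w \<noteq> 0} \<longrightarrow> (\<forall>F \<in> bounded_borel_on I.
        (\<forall>E \<in> I - \<AA>. integrable (\<nu> E)
           (\<lambda>\<xi>. F E * l2_inner (poisson_bv adj V orig E \<xi>)
                              (kernel_apply K (poisson_bv adj V orig E \<xi>)))) \<and>
        set_integrable lebesgue I (\<lambda>E. LINT \<xi>|\<nu> E.
           F E * l2_inner (poisson_bv adj V orig E \<xi>)
                          (kernel_apply K (poisson_bv adj V orig E \<xi>))) \<and>
        op_trace (\<Phi> (extend0 I F) \<circ> kernel_apply K)
          = (LINT E:I|lebesgue. LINT \<xi>|\<nu> E.
               F E * l2_inner (poisson_bv adj V orig E \<xi>)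
                              (kernel_apply K (poisson_bv adj V orig E \<xi>)))))"
proof -
  interpret spectral adj V \<Phi>
    using assms(1-3) by unfold_locales
  note sums = finite_sum_Psi_integral[OF assms(4,5,6)]
  have "\<forall>E. E \<notin> \<AA> \<longrightarrow> is_boundary_measure adj V orig E (\<nu> E)" using assms(7) by blast
  note poisson = finite_sum_poisson_integral[OF assms(4,5,6) _ _ this]
  let ?P = "poisson_bv adj V orig"
  show ?thesis
  proof (intro conjI allI impI ballI)
    fix F v w assume F: "F \<in> bounded_borel_on I"
    show "set_integrable lebesgue I (\<lambda>E. F E * of_real (Psi_bv adj V E v w))"
      and "l2_inner (delta v) (\<Phi> (extend0 I F) (delta w)) = (LINT E:I|lebesgue. F E * of_real (Psi_bv adj V E v w))"
      using kernel_eq_Psi_integral[OF assms(4,5,6) F] by simp_all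
    have "(\<forall>E \<in> I - \<AA>. integrable (\<nu> E) (\<lambda>\<xi>. F E * ?P E \<xi> v * cnj (?P E \<xi> w))) \<and>
      set_integrable lebesgue I (\<lambda>E. LINT \<xi>|\<nu> E. F E * ?P E \<xi> v * cnj (?P E \<xi> w)) \<and>
      l2_inner (delta v) (\<Phi> (extend0 I F) (delta w)) = (LINT E:I|lebesgue. LINT \<xi>|\<nu> E. F E * ?P E \<xi> v * cnj (?P E \<xi> w))"
      by (rule poisson[OF F, where J = "{()}" and k = "\<lambda>_. 1" and v = "\<lambda>_. v" and w = "\<lambda>_. w"]) simp_all
    then show "\<And>E. E \<in> I - \<AA> \<Longrightarrow> integrable (\<nu> E) (\<lambda>\<xi>. F E * ?P E \<xi> v * cnj (?P E \<xi> w))"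
      and "set_integrable lebesgue I (\<lambda>E. LINT \<xi>|\<nu> E. F E * ?P E \<xi> v * cnj (?P E \<xi> w))"
      and "l2_inner (delta v) (\<Phi> (extend0 I F) (delta w)) = (LINT E:I|lebesgue. LINT \<xi>|\<nu> E. F E * ?P E \<xi> v * cnj (?P E \<xi> w))"
      by auto
  next
    fix f :: "'v \<Rightarrow> complex" and F v assume fin: "finite {v. f v \<noteq> 0}" and F: "F \<in> bounded_borel_on I"
    let ?A = "{v. f v \<noteq> 0}"
    note Fb = extend0_bounded_borel[OF assms(4) F]
    have T: "\<Phi> (extend0 I F) f v = (\<Sum>w\<in>?A. f w * \<Phi> (extend0 I F) (delta w) v)"
      by (rule Phi_finite_support[OF Fb fin]) simp
    have "l2_inner (\<lambda>w. cnj (f w)) (\<lambda>w. of_real (Psi_bv adj V E v w)) = (\<Sum>w\<in>?A. f w * of_real (Psi_bv adj V E v w))" for E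
      by (subst l2_inner_finite[OF fin]) auto
    then show "set_integrable lebesgue I (\<lambda>E. F E * l2_inner (\<lambda>w. cnj (f w)) (\<lambda>w. of_real (Psi_bv adj V E v w)))"
      and "\<Phi> (extend0 I F) f v = (LINT E:I|lebesgue. F E * l2_inner (\<lambda>w. cnj (f w)) (\<lambda>w. of_real (Psi_bv adj V E v w)))"
      using sums[OF F fin, where k = f and v = "\<lambda>_. v" and w = "\<lambda>w. w"] T by simp_all
    have "(\<forall>E \<in> I - \<AA>. integrable (\<nu> E) (\<lambda>\<xi>. F E * ?P E \<xi> v * l2_inner (?P E \<xi>) f)) \<and>
      set_integrable lebesgue I (\<lambda>E. LINT \<xi>|\<nu> E. F E * ?P E \<xi> v * l2_inner (?P E \<xi>) f) \<and>
      \<Phi> (extend0 I F) f v = (LINT E:I|lebesgue. LINT \<xi>|\<nu> E. F E * ?P E \<xi> v * l2_inner (?P E \<xi>) f)"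
    proof (rule poisson[OF F fin, where k = f and v = "\<lambda>_. v" and w = "\<lambda>w. w", OF _ T])
      fix E \<xi>
      have "l2_inner (?P E \<xi>) f = (\<Sum>w\<in>?A. cnj (?P E \<xi> w) * f w)"
        by (rule l2_inner_finite[OF fin]) auto
      then show "F E * ?P E \<xi> v * l2_inner (?P E \<xi>) f = F E * (\<Sum>w\<in>?A. f w * (?P E \<xi> v * cnj (?P E \<xi> w)))"
        by (simp add: sum_distrib_left mult_ac)
    qed
    then show "\<And>E. E \<in> I - \<AA> \<Longrightarrow> integrable (\<nu> E) (\<lambda>\<xi>. F E * ?P E \<xi> v * l2_inner (?P E \<xi>) f)"
      and "set_integrable lebesgue I (\<lambda>E. LINT \<xi>|\<nu> E. F E * ?P E \<xi> v * l2_inner (?P E \<xi>) f)"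
      and "\<Phi> (extend0 I F) f v = (LINT E:I|lebesgue. LINT \<xi>|\<nu> E. F E * ?P E \<xi> v * l2_inner (?P E \<xi>) f)"
      by auto
  next
    fix K :: "'v \<Rightarrow> 'v \<Rightarrow> complex" and F assume fin: "finite {(v, w). K v w \<noteq> 0}" and F: "F \<in> bounded_borel_on I"
    \<comment> \<open>Row and column supports: the finite set of entries is enlarged to a rectangle
      so that double sums can be exchanged.\<close>
    define A where "A = fst ` {(v, w). K v w \<noteq> 0}"
    define B where "B = snd ` {(v, w). K v w \<noteq> 0}"
    have fA: "finite A" and fB: "finite B" using fin by (auto simp: A_def B_def)
    have K0: "K u v = 0" if "u \<notin> A \<or> v \<notin> B" for u v
      using that by (force simp: A_def B_def)
    note Fb = extend0_bounded_borel[OF assms(4) F]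
    have K_apply: "kernel_apply K g u = (\<Sum>v\<in>B. K u v * g v)" for g u
    proof -
      have "kernel_apply K g u = (\<Sum>\<^sub>\<infinity>v\<in>B. K u v * g v)"
        unfolding kernel_apply_def using K0 by (intro infsum_cong_neutral) auto
      then show ?thesis using fB by simp
    qed
    have K_delta: "kernel_apply K (delta v) = (\<lambda>u. K u v)" for v
    proof
      fix u
      have "kernel_apply K (delta v) u = (\<Sum>x\<in>B. if x = v then K u x else 0)"
        unfolding K_apply by (intro sum.cong) (auto simp: delta_eq)
      then show "kernel_apply K (delta v) u = K u v" using fB K0[of u v] by auto
    qed
    have diag: "\<Phi> (extend0 I F) (kernel_apply K (delta v)) v = (\<Sum>u\<in>A. K u v * \<Phi> (extend0 I F) (delta u) v)" for v
      unfolding K_delta using K0 by (intro Phi_finite_support[OF Fb fA]) auto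
    have "op_trace (\<Phi> (extend0 I F) \<circ> kernel_apply K) = (\<Sum>\<^sub>\<infinity>v\<in>B. \<Phi> (extend0 I F) (kernel_apply K (delta v)) v)"
      unfolding op_trace_def
    proof (rule infsum_cong_neutral)
      \<comment> \<open>A column outside \<open>B\<close> is zero, so the trace reduces to a finite
        sum.\<close>
      show "l2_inner (delta v) ((\<Phi> (extend0 I F) \<circ> kernel_apply K) (delta v)) = 0" if "v \<in> UNIV - B" for v
        using that K0 by (simp add: diag)
    qed auto
    also have "\<dots> = (\<Sum>v\<in>B. \<Sum>u\<in>A. K u v * \<Phi> (extend0 I F) (delta u) v)"
      using fB by (simp add: diag)
    also have "\<dots> = (\<Sum>(v, u)\<in>B \<times> A. K u v * \<Phi> (extend0 I F) (delta u) v)"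
      by (rule sum.cartesian_product)
    finally have T: "op_trace (\<Phi> (extend0 I F) \<circ> kernel_apply K)
        = (\<Sum>j\<in>B \<times> A. K (snd j) (fst j) * \<Phi> (extend0 I F) (delta (snd j)) (fst j))"
      by (simp add: case_prod_unfold)
    have "(\<forall>E \<in> I - \<AA>. integrable (\<nu> E) (\<lambda>\<xi>. F E * l2_inner (?P E \<xi>) (kernel_apply K (?P E \<xi>)))) \<and>
      set_integrable lebesgue I (\<lambda>E. LINT \<xi>|\<nu> E. F E * l2_inner (?P E \<xi>) (kernel_apply K (?P E \<xi>))) \<and>
      op_trace (\<Phi> (extend0 I F) \<circ> kernel_apply K)
        = (LINT E:I|lebesgue. LINT \<xi>|\<nu> E. F E * l2_inner (?P E \<xi>) (kernel_apply K (?P E \<xi>)))"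
    \<comment> \<open>In the trace the entry \<open>K u v\<close> meets the matrix element of
      \<open>F(H)\<close> at \<open>(v, u)\<close>; the index pair is therefore
      \<open>(v, u)\<close>, with the column index first.\<close>
    proof (rule poisson[OF F finite_cartesian_product[OF fB fA], where k = "\<lambda>j. K (snd j) (fst j)" and v = fst and w = snd, OF _ T])
      fix E \<xi>
      have "l2_inner (?P E \<xi>) (kernel_apply K (?P E \<xi>)) = (\<Sum>u\<in>A. cnj (?P E \<xi> u) * (\<Sum>v\<in>B. K u v * ?P E \<xi> v))"
        using K0 by (subst l2_inner_finite[OF fA]) (auto simp: K_apply)
      also have "\<dots> = (\<Sum>u\<in>A. \<Sum>v\<in>B. K u v * (?P E \<xi> v * cnj (?P E \<xi> u)))"
        by (simp add: sum_distrib_left mult_ac)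
      also have "\<dots> = (\<Sum>v\<in>B. \<Sum>u\<in>A. K u v * (?P E \<xi> v * cnj (?P E \<xi> u)))" by (rule sum.swap)
      also have "\<dots> = (\<Sum>j\<in>B \<times> A. K (snd j) (fst j) * (?P E \<xi> (fst j) * cnj (?P E \<xi> (snd j))))"
        by (simp add: sum.cartesian_product case_prod_unfold)
      finally show "F E * l2_inner (?P E \<xi>) (kernel_apply K (?P E \<xi>))
          = F E * (\<Sum>j\<in>B \<times> A. K (snd j) (fst j) * (?P E \<xi> (fst j) * cnj (?P E \<xi> (snd j))))" by simp
    qed
    then show "\<And>E. E \<in> I - \<AA> \<Longrightarrow> integrable (\<nu> E) (\<lambda>\<xi>. F E * l2_inner (?P E \<xi>) (kernel_apply K (?P E \<xi>)))"
      and "set_integrable lebesgue I (\<lambda>E. LINT \<xi>|\<nu> E. F E * l2_inner (?P E \<xi>) (kernel_apply K (?P E \<xi>)))"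
      and "op_trace (\<Phi> (extend0 I F) \<circ> kernel_apply K)
        = (LINT E:I|lebesgue. LINT \<xi>|\<nu> E. F E * l2_inner (?P E \<xi>) (kernel_apply K (?P E \<xi>)))"
      by auto
  qed
qed

end
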